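(* Each of the problems EPG Subgraph, EPG Subgraph-Free, EPG Minor and EPG Minor-Free is fixed-parameter tractable with respect to the combined parameter $\min(\#1_{\max},\#0_{\max}) + |V|$, where $|V|$ is the number of vertices of the underlying graph.
   Context: An edge periodic temporal graph (EPG) $\mathcal{G}=(V,E,\tau)$ consists of an undirected graph $G=(V,E)$ (the underlying graph) and a map $\tau:E\to\{0,1\}^*$ assigning each edge a nonempty binary label containing at least one $1$; edge $e$ is present at time step $t\ge0$ iff $\tau(e)[t\bmod|\tau(e)|]=1$. $\#1_{\max}$ (resp. $\#0_{\max}$) is the maximum number of $1$'s (resp. $0$'s) in a label $\tau(e)$ over $e\in E$. The snapshot $\mathcal{G}(t)$ is $(V,\{e\in E: e\text{ present at } t\})$. "Subgraph" means induced subgraph (up to isomorphism). Given an EPG $\mathcal{G}$ and a graph $H$: EPG Subgraph asks whether some $\mathcal{G}(t)$ contains $H$ as an induced subgraph; EPG Subgraph-Free asks whether some $\mathcal{G}(t)$ does not contain $H$ as an induced subgraph; EPG Minor asks whether some $\mathcal{G}(t)$ has $H$ as a minor; EPG Minor-Free asks whether some $\mathcal{G}(t)$ does not have $H$ as a minor. *)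

theory Defs
  imports Main
begin

section \<open>Graphs, induced subgraphs, minors\<close>

record 'v graph =
  verts :: "'v set"
  edges :: "'v set set"

definition simple_graph :: "('v, 'b) graph_scheme \<Rightarrow> bool" where
  "simple_graph G \<longleftrightarrow> finite (verts G) \<and> (\<forall>e\<in>edges G. e \<subseteq> verts G \<and> card e = 2)"

definition graph_iso :: "'v graph \<Rightarrow> 'w graph \<Rightarrow> bool" where
  "graph_iso G H \<longleftrightarrow>
     (\<exists>f. bij_betw f (verts G) (verts H) \<and> (\<lambda>e. f ` e) ` edges G = edges H)"

definition induced_subgraph :: "'v graph \<Rightarrow> 'v set \<Rightarrow> 'v graph" where
  "induced_subgraph G S = \<lparr>verts = S, edges = {e \<in> edges G. e \<subseteq> S}\<rparr>"

definition has_induced_subgraph :: "'v graph \<Rightarrow> 'w graph \<Rightarrow> bool" where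
  "has_induced_subgraph G H \<longleftrightarrow> (\<exists>S \<subseteq> verts G. graph_iso (induced_subgraph G S) H)"

definition delete_vertex :: "'v graph \<Rightarrow> 'v \<Rightarrow> 'v graph" where
  "delete_vertex G v = \<lparr>verts = verts G - {v}, edges = {e \<in> edges G. v \<notin> e}\<rparr>"

definition delete_edge :: "'v graph \<Rightarrow> 'v set \<Rightarrow> 'v graph" where
  "delete_edge G e = \<lparr>verts = verts G, edges = edges G - {e}\<rparr>"

text \<open>The edge between \<open>u\<close> and \<open>v\<close> is contracted into the vertex \<open>u\<close>;
  loops and parallel edges that arise are dropped.\<close>

definition contract :: "'v graph \<Rightarrow> 'v \<Rightarrow> 'v \<Rightarrow> 'v graph" where
  "contract G u v =
     \<lparr>verts = verts G - {v},
      edges = {e \<in> edges G. v \<notin> e} \<union> {{u, w} | w. {v, w} \<in> edges G \<and> w \<noteq> u}\<rparr>"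

inductive minor_step :: "'v graph \<Rightarrow> 'v graph \<Rightarrow> bool" where
  vertex: "v \<in> verts G \<Longrightarrow> minor_step G (delete_vertex G v)"
| edge: "e \<in> edges G \<Longrightarrow> minor_step G (delete_edge G e)"
| contract: "{u, v} \<in> edges G \<Longrightarrow> minor_step G (contract G u v)"

definition has_minor :: "'v graph \<Rightarrow> 'w graph \<Rightarrow> bool" where
  "has_minor G H \<longleftrightarrow> (\<exists>G'. minor_step\<^sup>*\<^sup>* G G' \<and> graph_iso G' H)"

section \<open>Edge periodic temporal graphs\<close>

text \<open>Only the values of \<open>label\<close> on the edges are relevant.\<close>

record 'v epg = "'v graph" +
  label :: "'v set \<Rightarrow> bool list"

definition epg :: "'v epg \<Rightarrow> bool" where
  "epg G \<longleftrightarrow> simple_graph G \<and> (\<forall>e\<in>edges G. label G e \<noteq> [] \<and> True \<in> set (label G e))"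

definition present :: "'v epg \<Rightarrow> 'v set \<Rightarrow> nat \<Rightarrow> bool" where
  "present G e t \<longleftrightarrow> label G e ! (t mod length (label G e))"

definition snapshot :: "'v epg \<Rightarrow> nat \<Rightarrow> 'v graph" where
  "snapshot G t = \<lparr>verts = verts G, edges = {e \<in> edges G. present G e t}\<rparr>"

text \<open>The inserted \<open>0\<close> fixes the value of the maximum for edgeless graphs.\<close>

definition label_max :: "bool \<Rightarrow> 'v epg \<Rightarrow> nat" where
  "label_max b G = Max (insert 0 ((\<lambda>e. count_list (label G e) b) ` edges G))"

abbreviation ones_max :: "'v epg \<Rightarrow> nat" where
  "ones_max \<equiv> label_max True"

abbreviation zeros_max :: "'v epg \<Rightarrow> nat" where
  "zeros_max \<equiv> label_max False"

text \<open>In all four problems an instance is a pair of an edge periodic temporal graph and a graph.\<close>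

fun epg_subgraph :: "'v epg \<times> 'w graph \<Rightarrow> bool" where
  "epg_subgraph (G, H) \<longleftrightarrow> (\<exists>t. has_induced_subgraph (snapshot G t) H)"

fun epg_subgraph_free :: "'v epg \<times> 'w graph \<Rightarrow> bool" where
  "epg_subgraph_free (G, H) \<longleftrightarrow> (\<exists>t. \<not> has_induced_subgraph (snapshot G t) H)"

fun epg_minor :: "'v epg \<times> 'w graph \<Rightarrow> bool" where
  "epg_minor (G, H) \<longleftrightarrow> (\<exists>t. has_minor (snapshot G t) H)"

fun epg_minor_free :: "'v epg \<times> 'w graph \<Rightarrow> bool" where
  "epg_minor_free (G, H) \<longleftrightarrow> (\<exists>t. \<not> has_minor (snapshot G t) H)"

fun epg_parameter :: "'v epg \<times> 'w graph \<Rightarrow> nat" where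
  "epg_parameter (G, H) = min (ones_max G) (zeros_max G) + card (verts G)"

section \<open>The model of computation\<close>

text \<open>Algorithms are programs of the WHILE language over binary trees of
  N. D. Jones (Computability and Complexity: From a Programming Perspective, MIT Press 1997),
  where every elementary operation takes one unit of time.  There are no operations on whole
  trees other than taking apart and building a single node, and a test only inspects the root.
  Although sharing allows a tree of exponential size to be built in linear time, the trees can be
  kept as pointers into a heap that grows by at most one node per step, so these programs and
  multitape Turing machines simulate each other with polynomial overhead.\<close>

datatype tree = Leaf | Node tree tree

fun tree_size :: "tree \<Rightarrow> nat" where
  "tree_size Leaf = 1"
| "tree_size (Node a b) = 1 + tree_size a + tree_size b"

fun left :: "tree \<Rightarrow> tree" where
  "left Leaf = Leaf"
| "left (Node a b) = a"

fun right :: "tree \<Rightarrow> tree" where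
  "right Leaf = Leaf"
| "right (Node a b) = b"

datatype expr = Var nat | LeafE | NodeE expr expr | LeftE expr | RightE expr

type_synonym store = "nat \<Rightarrow> tree"

fun eval_expr :: "expr \<Rightarrow> store \<Rightarrow> tree" where
  "eval_expr (Var x) s = s x"
| "eval_expr LeafE s = Leaf"
| "eval_expr (NodeE a b) s = Node (eval_expr a s) (eval_expr b s)"
| "eval_expr (LeftE a) s = left (eval_expr a s)"
| "eval_expr (RightE a) s = right (eval_expr a s)"

fun cost :: "expr \<Rightarrow> nat" where
  "cost (Var x) = 1"
| "cost LeafE = 1"
| "cost (NodeE a b) = 1 + cost a + cost b"
| "cost (LeftE a) = 1 + cost a"
| "cost (RightE a) = 1 + cost a"

datatype com =
    Assign nat expr
  | Seq com com
  | If expr com com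
  | While expr com

text \<open>\<open>exec c s t s'\<close>: started in \<open>s\<close>, the program \<open>c\<close> halts in \<open>s'\<close> after \<open>t\<close> units of time.
  In tests, \<open>Leaf\<close> counts as false and all other trees count as true.\<close>

inductive exec :: "com \<Rightarrow> store \<Rightarrow> nat \<Rightarrow> store \<Rightarrow> bool" where
  Assign: "exec (Assign x e) s (1 + cost e) (s(x := eval_expr e s))"
| Seq: "exec c1 s t1 s1 \<Longrightarrow> exec c2 s1 t2 s2 \<Longrightarrow> exec (Seq c1 c2) s (t1 + t2) s2"
| IfTrue: "eval_expr e s \<noteq> Leaf \<Longrightarrow> exec c1 s t s1 \<Longrightarrow> exec (If e c1 c2) s (1 + cost e + t) s1"
| IfFalse: "eval_expr e s = Leaf \<Longrightarrow> exec c2 s t s1 \<Longrightarrow> exec (If e c1 c2) s (1 + cost e + t) s1"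
| WhileTrue: "eval_expr e s \<noteq> Leaf \<Longrightarrow> exec c s t1 s1 \<Longrightarrow> exec (While e c) s1 t2 s2 \<Longrightarrow>
    exec (While e c) s (1 + cost e + t1 + t2) s2"
| WhileFalse: "eval_expr e s = Leaf \<Longrightarrow> exec (While e c) s (1 + cost e) s"

text \<open>Input and output are passed in variable \<open>0\<close>.\<close>

definition runs :: "com \<Rightarrow> tree \<Rightarrow> nat \<Rightarrow> tree \<Rightarrow> bool" where
  "runs p x t y \<longleftrightarrow> (\<exists>s'. exec p ((\<lambda>_. Leaf)(0 := x)) t s' \<and> s' 0 = y)"

lemma exec_deterministic:
  "exec c s t s1 \<Longrightarrow> exec c s t' s1' \<Longrightarrow> t' = t \<and> s1' = s1"
proof (induction arbitrary: t' s1' rule: exec.induct)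
  case (Assign x e s)
  then show ?case by cases simp
next
  case (Seq c1 s t1 s1 c2 t2 s2)
  from Seq.prems show ?case by cases (metis Seq.IH)
next
  case (IfTrue e s c1 t s1 c2)
  from IfTrue.prems show ?case
    by cases (metis IfTrue.IH, metis IfTrue.hyps(1))
next
  case (IfFalse e s c2 t s1 c1)
  from IfFalse.prems show ?case
    by cases (metis IfFalse.hyps(1), metis IfFalse.IH)
next
  case (WhileTrue e s c t1 s1 t2 s2)
  from WhileTrue.prems show ?case
    by cases (metis WhileTrue.IH, metis WhileTrue.hyps(1))
next
  case (WhileFalse e s c)
  from WhileFalse.prems show ?case
    by cases (metis WhileFalse.hyps, simp)
qed

lemma runs_deterministic: "runs p x t y \<Longrightarrow> runs p x t' y' \<Longrightarrow> t' = t \<and> y' = y"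
  unfolding runs_def using exec_deterministic by blast

section \<open>Encodings and fixed-parameter tractability\<close>

fun enc_nat :: "nat \<Rightarrow> tree" where
  "enc_nat 0 = Leaf"
| "enc_nat (Suc n) = Node Leaf (enc_nat n)"

fun enc_list :: "tree list \<Rightarrow> tree" where
  "enc_list [] = Leaf"
| "enc_list (x # xs) = Node x (enc_list xs)"

fun enc_bool :: "bool \<Rightarrow> tree" where
  "enc_bool False = Leaf"
| "enc_bool True = Node Leaf Leaf"

definition computable :: "(nat \<Rightarrow> nat) \<Rightarrow> bool" where
  "computable f \<longleftrightarrow> (\<exists>p. \<forall>n. \<exists>t. runs p (enc_nat n) t (enc_nat (f n)))"

text \<open>\<open>encodes i x\<close> means that the tree \<open>x\<close> is an encoding of the instance \<open>i\<close>; an instance may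
  have several encodings, all of which have to be treated correctly.\<close>

definition fpt :: "('i \<Rightarrow> tree \<Rightarrow> bool) \<Rightarrow> ('i \<Rightarrow> nat) \<Rightarrow> ('i \<Rightarrow> bool) \<Rightarrow> bool" where
  "fpt encodes \<kappa> P \<longleftrightarrow>
     (\<exists>p f c. computable f \<and>
        (\<forall>i x. encodes i x \<longrightarrow>
           (\<exists>t y. runs p x t y \<and> t \<le> f (\<kappa> i) * tree_size x ^ c \<and> (y \<noteq> Leaf \<longleftrightarrow> P i))))"

text \<open>A graph is given by its number of vertices and the list of its edges, where a vertex is
  represented by its position in some enumeration \<open>vs\<close> of the vertices and the edge list \<open>ps\<close>
  contains each edge exactly once.\<close>

definition edge_at :: "'v list \<Rightarrow> nat \<times> nat \<Rightarrow> 'v set" where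
  "edge_at vs = (\<lambda>(i, j). {vs ! i, vs ! j})"

definition enumerates :: "'v list \<Rightarrow> (nat \<times> nat) list \<Rightarrow> ('v, 'b) graph_scheme \<Rightarrow> bool" where
  "enumerates vs ps G \<longleftrightarrow>
     distinct vs \<and> set vs = verts G \<and>
     (\<forall>(i, j) \<in> set ps. i < length vs \<and> j < length vs) \<and>
     distinct (map (edge_at vs) ps) \<and> set (map (edge_at vs) ps) = edges G"

fun enc_pair :: "nat \<times> nat \<Rightarrow> tree" where
  "enc_pair (i, j) = Node (enc_nat i) (enc_nat j)"

definition encodes_graph :: "'v graph \<Rightarrow> tree \<Rightarrow> bool" where
  "encodes_graph G x \<longleftrightarrow> simple_graph G \<and>
     (\<exists>vs ps. enumerates vs ps G \<and>
        x = Node (enc_nat (length vs)) (enc_list (map enc_pair ps)))"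

definition encodes_epg :: "'v epg \<Rightarrow> tree \<Rightarrow> bool" where
  "encodes_epg G x \<longleftrightarrow> epg G \<and>
     (\<exists>vs ps. enumerates vs ps G \<and>
        x = Node (enc_nat (length vs))
              (enc_list (map (\<lambda>p. Node (enc_pair p)
                 (enc_list (map enc_bool (label G (edge_at vs p))))) ps)))"

fun encodes_instance :: "'v epg \<times> 'w graph \<Rightarrow> tree \<Rightarrow> bool" where
  "encodes_instance (G, H) x \<longleftrightarrow>
     (\<exists>y z. encodes_epg G y \<and> encodes_graph H z \<and> x = Node y z)"

lemma enumerates_ex:
  assumes "simple_graph G"
  shows "\<exists>vs ps. enumerates vs ps G"
proof -
  from assms have fin: "finite (verts G)" by (simp add: simple_graph_def)
  then obtain vs where vs: "distinct vs" "set vs = verts G"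
    using finite_distinct_list by metis
  have "edges G \<subseteq> Pow (verts G)" using assms by (auto simp: simple_graph_def)
  with fin have "finite (edges G)" by (meson finite_Pow_iff finite_subset)
  then obtain es where es: "distinct es" "set es = edges G"
    using finite_distinct_list by metis
  have "\<exists>p. fst p < length vs \<and> snd p < length vs \<and> edge_at vs p = e" if "e \<in> edges G" for e
  proof -
    from that assms have "e \<subseteq> set vs" "card e = 2" by (auto simp: simple_graph_def vs)
    then obtain u v where "e = {u, v}" "u \<in> set vs" "v \<in> set vs"
      by (auto simp: card_2_iff)
    then obtain i j where "i < length vs" "j < length vs" "e = {vs ! i, vs ! j}"
      by (metis in_set_conv_nth)
    then show ?thesis by (intro exI[of _ "(i, j)"]) (simp add: edge_at_def)
  qed
  then obtain g where g: "\<And>e. e \<in> edges G \<Longrightarrow>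
      fst (g e) < length vs \<and> snd (g e) < length vs \<and> edge_at vs (g e) = e"
    by metis
  have "map (edge_at vs) (map g es) = es"
    unfolding map_map by (rule map_idI) (simp add: g es(2))
  then have "enumerates vs (map g es) G"
    unfolding enumerates_def using vs es g by (auto simp: split_beta)
  then show ?thesis by blast
qed

lemma encodes_instance_ex: "(\<exists>x. encodes_instance (G, H) x) \<longleftrightarrow> epg G \<and> simple_graph H"
proof
  assume "epg G \<and> simple_graph H"
  then obtain vs ps vs' ps' where "enumerates vs ps G" "enumerates vs' ps' H"
    using enumerates_ex[of G] enumerates_ex[of H] by (auto simp: epg_def)
  then have "(\<exists>y. encodes_epg G y) \<and> (\<exists>z. encodes_graph H z)"
    using \<open>epg G \<and> simple_graph H\<close> unfolding encodes_epg_def encodes_graph_def by blast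
  then show "\<exists>x. encodes_instance (G, H) x" by auto
qed (force simp: encodes_epg_def encodes_graph_def)

end

(*
  A snapshot is determined by the set of edges that have their minority value (the one that is less
  frequent in the label) at the given time.  Each label has at most k = min(#1max, #0max) minority
  positions.  For every edge guess either its majority value or one of these positions a; in the
  latter case the time is restricted to the residue class of a modulo the length m of the label, and
  substituting t = a + m * s turns all labels into periodic labels in s with no more minority
  positions than before.  It remains to avoid K <= k * |E| residue classes, and by a theorem of
  Crittenden and Vanden Eynden this is possible at some s < 2 ^ K if it is possible at all.  Thus
  boundedly many times produce every snapshot, and no arithmetic with the least common multiple of
  the label lengths is needed.  Each snapshot is then tested by brute force, where H is a minor iff
  it embeds as a subgraph after a sequence of contractions.

  The running times follow from closure properties of the functions that are computable in time
  f(k) * n ^ c with results of size f(k) * n ^ c.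
*)
theory Submission
  imports Defs "HOL-Computational_Algebra.Polynomial"
begin

section \<open>Growth classes\<close>

text \<open>The obstacle is that label lengths are not bounded by the parameter. Their least common
  multiple, and with it the first time at which a snapshot occurs, can grow like n ^ |E|, which is
  not of the form f(k) * n ^ c. So such times are never computed: a substitution rewrites the labels
  instead, and afterwards only times below a bound that is independent of all label lengths are
  tried. Written out over \<open>length l\<close> entries, a substituted label would repeat each
  visited position gcd(m, \<open>length l\<close>) times and could gain minority entries; hence the
  least period in \<open>subsample\<close>. Leaving a guessed majority value unenforced does no
  harm: each time of a substituted graph is a time of the original one, so only true snapshots are
  produced, and completeness needs just one sequence of guesses that fits a given time. A label made
  constant stays constant under later substitutions, so a single pass over the edges suffices.
  Numbers can be kept in unary because all numbers that occur are of size f(k) * n ^ c.\<close>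

text \<open>All running times and sizes are bounded by a tower of fixed height in the parameter times a fixed
  power of the input size.  The class of these bounds is closed under sums and products, and its
  parameter part also under powers, so explicit bounds need not be tracked.\<close>

fun tow :: "nat \<Rightarrow> nat \<Rightarrow> nat" where
  "tow 0 k = k + 4"
| "tow (Suc d) k = 2 ^ tow d k"

text \<open>The offset 4 in \<open>tow\<close> is the threshold of \<open>square_le_exp\<close>,
  which thereby applies at every height. The summand \<open>d\<close> is what puts each constant
  below a tower in \<open>pab_const\<close>.\<close>

lemma tow_ge: "d + 4 \<le> tow d k"
proof (induction d)
  case (Suc d)
  have "tow d k < 2 ^ tow d k" by (rule less_exp)
  with Suc have "Suc d + 4 \<le> 2 ^ tow d k" by linarith
  then show ?case by simp
qed simp

lemma tow_mono: "d \<le> d' \<Longrightarrow> tow d k \<le> tow d' k"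
  by (induction d' rule: dec_induct) (auto intro: order.trans less_imp_le[OF less_exp])

lemma square_le_exp: "4 \<le> x \<Longrightarrow> x * x \<le> (2::nat) ^ x"
proof (induction x rule: dec_induct)
  case (step x)
  have "Suc x * Suc x = x * x + (2 * x + 1)" by simp
  also have "\<dots> \<le> x * x + x * x"
  proof -
    have "4 * x \<le> x * x" using step(1) by (intro mult_right_mono) auto
    then show ?thesis using step(1) by linarith
  qed
  also have "\<dots> \<le> 2 ^ Suc x" using step.IH by simp
  finally show ?case .
qed simp

lemma tow_mult:
  assumes "x \<le> tow d k" "y \<le> tow e k"
  shows "x * y \<le> tow (Suc (max d e)) k"
proof -
  let ?m = "tow (max d e) k"
  have "x \<le> ?m" "y \<le> ?m" using assms tow_mono[of d "max d e" k] tow_mono[of e "max d e" k] by auto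
  then have "x * y \<le> ?m * ?m" by (rule mult_le_mono)
  also have "\<dots> \<le> 2 ^ ?m" by (rule square_le_exp) (use tow_ge[of "max d e" k] in simp)
  finally show ?thesis by simp
qed

lemma tow_add:
  assumes "x \<le> tow d k" "y \<le> tow e k"
  shows "x + y \<le> tow (Suc (max d e)) k"
proof -
  let ?m = "tow (max d e) k"
  have *: "x \<le> ?m" "y \<le> ?m" using assms tow_mono[of d "max d e" k] tow_mono[of e "max d e" k] by auto
  have "2 * ?m \<le> ?m * ?m" using tow_ge[of "max d e" k] by (intro mult_right_mono) auto
  also have "\<dots> \<le> tow (Suc (max d e)) k" using tow_mult[of ?m "max d e" k ?m "max d e"] by simp
  finally show ?thesis using * by simp
qed

section \<open>Bounds in the parameter alone, and in the parameter and the input size\<close>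

definition param_bounded :: "(nat \<Rightarrow> nat) \<Rightarrow> bool" where
  "param_bounded b \<longleftrightarrow> (\<exists>d. \<forall>k. b k \<le> tow d k)"

lemma pab_const: "param_bounded (\<lambda>_. c)"
  unfolding param_bounded_def using tow_ge[of c] by (intro exI[of _ c]) (metis add_leD1)

lemma pab_id: "param_bounded (\<lambda>k. k)"
  unfolding param_bounded_def by (intro exI[of _ 0]) simp

lemma pab_mult: "param_bounded b \<Longrightarrow> param_bounded b' \<Longrightarrow> param_bounded (\<lambda>k. b k * b' k)"
  unfolding param_bounded_def using tow_mult by meson

lemma pab_add: "param_bounded b \<Longrightarrow> param_bounded b' \<Longrightarrow> param_bounded (\<lambda>k. b k + b' k)"
  unfolding param_bounded_def using tow_add by meson

lemma pab_power:
  assumes "param_bounded b" "param_bounded b'"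
  shows "param_bounded (\<lambda>k. b k ^ b' k)"
proof -
  obtain d where d: "\<And>k. b k * b' k \<le> tow d k"
    using pab_mult[OF assms] unfolding param_bounded_def by blast
  have "b k ^ b' k \<le> tow (Suc d) k" for k
  proof -
    have "b k ^ b' k \<le> (2 ^ b k) ^ b' k" by (intro power_mono less_imp_le[OF less_exp]) simp
    also have "\<dots> = 2 ^ (b k * b' k)" by (simp add: power_mult)
    also have "\<dots> \<le> tow (Suc d) k" using d by simp
    finally show ?thesis .
  qed
  then show ?thesis unfolding param_bounded_def by blast
qed

lemma pab_Suc: "param_bounded b \<Longrightarrow> param_bounded (\<lambda>k. Suc (b k))"
  using pab_add[of b "\<lambda>_. 1"] pab_const[of 1] by simp

lemmas pab_intros = pab_const pab_id pab_mult pab_add pab_power pab_Suc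

text \<open>The base \<open>n + 2\<close> is positive, so that powers grow with the exponent also at
  \<open>n = 0\<close>. In \<open>fpt_if_feas\<close> it is turned into a power of \<open>n\<close>
  by \<open>n + 2 \<le> n ^ 2\<close>, valid for \<open>n \<ge> 2\<close>, which doubles the
  exponent.\<close>

definition fpt_bounded :: "(nat \<Rightarrow> nat \<Rightarrow> nat) \<Rightarrow> bool" where
  "fpt_bounded b \<longleftrightarrow> (\<exists>d c. \<forall>k n. b k n \<le> tow d k * (n + 2) ^ c)"

lemma fb_param: "param_bounded b \<Longrightarrow> fpt_bounded (\<lambda>k n. b k)"
  unfolding param_bounded_def fpt_bounded_def by (metis mult.right_neutral power_0)

lemma fb_const: "fpt_bounded (\<lambda>k n. c)"
  by (rule fb_param[OF pab_const])

lemma fb_size: "fpt_bounded (\<lambda>k n. n)"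
  unfolding fpt_bounded_def by (rule exI[of _ 0], rule exI[of _ 1]) (simp add: algebra_simps trans_le_add2)

lemma fb_mult:
  assumes "fpt_bounded b" "fpt_bounded b'"
  shows "fpt_bounded (\<lambda>k n. b k n * b' k n)"
proof -
  obtain d c d' c' where *: "\<And>k n. b k n \<le> tow d k * (n + 2) ^ c"
      "\<And>k n. b' k n \<le> tow d' k * (n + 2) ^ c'"
    using assms unfolding fpt_bounded_def by blast
  have "b k n * b' k n \<le> tow (Suc (max d d')) k * (n + 2) ^ (c + c')" for k n
  proof -
    have "b k n * b' k n \<le> (tow d k * (n + 2) ^ c) * (tow d' k * (n + 2) ^ c')"
      by (intro mult_le_mono *)
    also have "\<dots> = (tow d k * tow d' k) * (n + 2) ^ (c + c')" by (simp add: power_add)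
    also have "\<dots> \<le> tow (Suc (max d d')) k * (n + 2) ^ (c + c')"
      by (intro mult_le_mono1 tow_mult order.refl)
    finally show ?thesis .
  qed
  then show ?thesis unfolding fpt_bounded_def by blast
qed

lemma fb_add:
  assumes "fpt_bounded b" "fpt_bounded b'"
  shows "fpt_bounded (\<lambda>k n. b k n + b' k n)"
proof -
  obtain d c d' c' where *: "\<And>k n. b k n \<le> tow d k * (n + 2) ^ c"
      "\<And>k n. b' k n \<le> tow d' k * (n + 2) ^ c'"
    using assms unfolding fpt_bounded_def by blast
  have "b k n + b' k n \<le> tow (Suc (max d d')) k * (n + 2) ^ (c + c')" for k n
  proof -
    have "b k n + b' k n \<le> tow d k * (n + 2) ^ (c + c') + tow d' k * (n + 2) ^ (c + c')"
    proof (rule add_mono)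
      have "(n + 2) ^ c \<le> (n + 2) ^ (c + c')" "(n + 2) ^ c' \<le> (n + 2) ^ (c + c')"
        by (auto intro!: power_increasing)
      then show "b k n \<le> tow d k * (n + 2) ^ (c + c')" "b' k n \<le> tow d' k * (n + 2) ^ (c + c')"
        using *[of k n] by (meson mult_le_mono2 order.trans)+
    qed
    also have "\<dots> = (tow d k + tow d' k) * (n + 2) ^ (c + c')" by (simp add: add_mult_distrib)
    also have "\<dots> \<le> tow (Suc (max d d')) k * (n + 2) ^ (c + c')"
      by (intro mult_le_mono1 tow_add order.refl)
    finally show ?thesis .
  qed
  then show ?thesis unfolding fpt_bounded_def by blast
qed

lemmas fb_intros = fb_const fb_size fb_mult fb_add

section \<open>Encodable types\<close>

text \<open>The type determines the encoding, so feasibility can be stated for HOL functions. The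
  instances share representations: a nonempty list looks like the pair of its head and tail, and a
  number like a list of that many units. Conversions between these are programs that do
  nothing.\<close>

class encodable =
  fixes encode :: "'a \<Rightarrow> tree"

instantiation unit :: encodable begin
definition encode_unit :: "unit \<Rightarrow> tree" where [simp]: "encode_unit _ = Leaf"
instance ..
end

instantiation nat :: encodable begin
definition encode_nat :: "nat \<Rightarrow> tree" where [simp]: "encode_nat = enc_nat"
instance ..
end

instantiation bool :: encodable begin
definition encode_bool :: "bool \<Rightarrow> tree" where [simp]: "encode_bool = enc_bool"
instance ..
end

instantiation prod :: (encodable, encodable) encodable begin
definition encode_prod :: "'a \<times> 'b \<Rightarrow> tree" where
  [simp]: "encode_prod p = Node (encode (fst p)) (encode (snd p))"
instance ..
end

instantiation list :: (encodable) encodable begin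
definition encode_list :: "'a list \<Rightarrow> tree" where [simp]: "encode_list xs = enc_list (map encode xs)"
instance ..
end

definition tsize :: "'a::encodable \<Rightarrow> nat" where
  "tsize x = tree_size (encode x)"

lemma tsize_pos: "0 < tsize x"
  unfolding tsize_def by (cases "encode x") auto

lemma tsize_simps [simp]:
  "tsize () = 1" "tsize m = 2 * m + 1" "tsize False = 1" "tsize True = 3"
  "tsize p = 1 + tsize (fst p) + tsize (snd p)"
  "tsize ([] :: 'c list) = 1" "tsize (x # xs) = 1 + tsize x + tsize xs"
  for p :: "'a::encodable \<times> 'b::encodable" and m :: nat and x :: "'c::encodable"
proof -
  show "tsize m = 2 * m + 1" for m :: nat by (induction m) (auto simp: tsize_def)
qed (auto simp: tsize_def)

lemma tsize_list: "tsize xs = 1 + (\<Sum>x\<leftarrow>xs. 1 + tsize x)"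
  by (induction xs) auto

lemma length_less_tsize: "length xs < tsize xs"
  by (induction xs) auto

lemma length_le_tsize: "length xs \<le> tsize xs"
  by (rule less_imp_le[OF length_less_tsize])

lemma tsize_mem: "x \<in> set xs \<Longrightarrow> tsize x \<le> tsize xs"
  by (induction xs) auto

lemma tsize_list_le:
  assumes "\<And>x. x \<in> set xs \<Longrightarrow> tsize x \<le> b"
  shows "tsize xs \<le> 1 + length xs * (1 + b)"
  using assms by (induction xs) (auto, fastforce)

text \<open>Each list ends in a \<open>Leaf\<close>, and appending removes one of the two; hence the
  \<open>+ 1\<close>.\<close>

lemma tsize_append: "tsize (xs @ ys) + 1 = tsize xs + tsize ys"
  by (induction xs) auto

lemma tsize_rev [simp]: "tsize (rev xs) = tsize xs"
  by (simp add: tsize_list rev_map[symmetric] sum_list_rev)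

section \<open>Bounded execution\<close>

text \<open>Programs only use variable 0 as an accumulator and variable 1 as a stack.  Programs that leave
  the stack unchanged can be combined without renaming variables.\<close>

definition steps :: "com \<Rightarrow> tree \<Rightarrow> tree \<Rightarrow> nat \<Rightarrow> tree \<Rightarrow> tree \<Rightarrow> bool" where
  "steps p x st b y st' \<longleftrightarrow> (\<forall>s. s 0 = x \<longrightarrow> s 1 = st \<longrightarrow>
     (\<exists>t s'. exec p s t s' \<and> t \<le> b \<and> s' 0 = y \<and> s' 1 = st'))"

lemma steps_mono: "steps p x st b y st' \<Longrightarrow> b \<le> b' \<Longrightarrow> steps p x st b' y st'"
  unfolding steps_def by (blast intro: order.trans)

lemma steps_runs:
  assumes "steps p x Leaf b y st"
  obtains t where "runs p x t y" "t \<le> b"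
proof -
  let ?s = "(\<lambda>_. Leaf)(0 := x) :: store"
  have "?s 0 = x" "?s 1 = Leaf" by simp_all
  with assms obtain t s' where "exec p ?s t s'" "t \<le> b" "s' 0 = y" unfolding steps_def by blast
  with that show thesis unfolding runs_def by blast
qed

lemma steps_acc:
  assumes "\<And>s. s 0 = x \<Longrightarrow> s 1 = st \<Longrightarrow> eval_expr e s = y"
  shows "steps (Assign 0 e) x st (1 + cost e) y st"
  unfolding steps_def using assms exec.Assign[of 0 e] by fastforce

lemma steps_stack:
  assumes "\<And>s. s 0 = x \<Longrightarrow> s 1 = st \<Longrightarrow> eval_expr e s = st'"
  shows "steps (Assign 1 e) x st (1 + cost e) x st'"
  unfolding steps_def using assms exec.Assign[of 1 e] by fastforce

lemma steps_Seq:
  "steps p x st b y st' \<Longrightarrow> steps q y st' b' z st'' \<Longrightarrow> steps (Seq p q) x st (b + b') z st''"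
  unfolding steps_def by (blast intro: add_mono exec.Seq)

lemma steps_If:
  assumes "x \<noteq> Leaf \<Longrightarrow> steps p x st b y st'" "x = Leaf \<Longrightarrow> steps q x st b y st'"
  shows "steps (If (Var 0) p q) x st (2 + b) y st'"
  unfolding steps_def
proof (intro allI impI)
  fix s :: store assume s: "s 0 = x" "s 1 = st"
  show "\<exists>t s'. exec (If (Var 0) p q) s t s' \<and> t \<le> 2 + b \<and> s' 0 = y \<and> s' 1 = st'"
  proof (cases "x = Leaf")
    case True
    with assms(2) s obtain t s' where *: "exec q s t s'" "t \<le> b" "s' 0 = y" "s' 1 = st'"
      unfolding steps_def by blast
    have "exec (If (Var 0) p q) s (1 + cost (Var 0) + t) s'"
      by (rule IfFalse) (use True s * in auto)
    with * show ?thesis by (intro exI[of _ "1 + cost (Var 0) + t"] exI[of _ s']) auto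
  next
    case False
    with assms(1) s obtain t s' where *: "exec p s t s'" "t \<le> b" "s' 0 = y" "s' 1 = st'"
      unfolding steps_def by blast
    have "exec (If (Var 0) p q) s (1 + cost (Var 0) + t) s'"
      by (rule IfTrue) (use False s * in auto)
    with * show ?thesis by (intro exI[of _ "1 + cost (Var 0) + t"] exI[of _ s']) auto
  qed
qed

text \<open>In \<open>steps_fold\<close> the left part of the accumulator is the list still to be
  processed, and its encoding is \<open>Leaf\<close> exactly if it is empty. The 3 is the time of
  one test.\<close>

lemma steps_While_done:
  assumes "left x = Leaf"
  shows "steps (While (LeftE (Var 0)) p) x st 3 x st"
  unfolding steps_def
proof (intro allI impI)
  fix s :: store assume s: "s 0 = x" "s 1 = st"
  have "exec (While (LeftE (Var 0)) p) s (1 + cost (LeftE (Var 0))) s"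
    by (rule WhileFalse) (use assms s in simp)
  with s show "\<exists>t s'. exec (While (LeftE (Var 0)) p) s t s' \<and> t \<le> 3 \<and> s' 0 = x \<and> s' 1 = st"
    by (intro exI) auto
qed

lemma steps_While:
  assumes "left x \<noteq> Leaf" "steps p x st b y st'" "steps (While (LeftE (Var 0)) p) y st' b' z st''"
  shows "steps (While (LeftE (Var 0)) p) x st (3 + b + b') z st''"
  unfolding steps_def
proof (intro allI impI)
  fix s :: store assume s: "s 0 = x" "s 1 = st"
  obtain t1 s1 where 1: "exec p s t1 s1" "t1 \<le> b" "s1 0 = y" "s1 1 = st'"
    using assms(2) s unfolding steps_def by blast
  obtain t2 s2 where 2: "exec (While (LeftE (Var 0)) p) s1 t2 s2" "t2 \<le> b'" "s2 0 = z" "s2 1 = st''"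
    using assms(3) 1 unfolding steps_def by blast
  have "exec (While (LeftE (Var 0)) p) s (1 + cost (LeftE (Var 0)) + t1 + t2) s2"
    by (rule WhileTrue[OF _ 1(1) 2(1)]) (use assms(1) s in simp)
  with 1 2 show "\<exists>t s'. exec (While (LeftE (Var 0)) p) s t s' \<and> t \<le> 3 + b + b' \<and> s' 0 = z \<and> s' 1 = st''"
    by (intro exI[of _ "1 + cost (LeftE (Var 0)) + t1 + t2"] exI[of _ s2]) auto
qed

section \<open>Feasible functions\<close>

text \<open>A domain \<open>D\<close> assigns to a parameter value \<open>k\<close> and a size \<open>n\<close> the inputs to be considered.
  The size of the results is bounded as well, because sharing allows a program to build a tree of
  exponential size in linear time.\<close>

definition small :: "(nat \<Rightarrow> nat \<Rightarrow> 'a::encodable set) \<Rightarrow> bool" where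
  "small D \<longleftrightarrow> (\<exists>b. fpt_bounded b \<and> (\<forall>k n. \<forall>a\<in>D k n. tsize a \<le> b k n))"

definition feas :: "(nat \<Rightarrow> nat \<Rightarrow> 'a::encodable set) \<Rightarrow> ('a \<Rightarrow> 'b::encodable) \<Rightarrow> bool" where
  "feas D f \<longleftrightarrow> small D \<and> small (\<lambda>k n. f ` D k n) \<and>
     (\<exists>p b. fpt_bounded b \<and> (\<forall>k n. \<forall>a\<in>D k n. \<forall>st. steps p (encode a) st (b k n) (encode (f a)) st))"

lemma smallI: "fpt_bounded b \<Longrightarrow> (\<And>k n a. a \<in> D k n \<Longrightarrow> tsize a \<le> b k n) \<Longrightarrow> small D"
  unfolding small_def by blast

lemma smallE:
  assumes "small D"
  obtains b where "fpt_bounded b" "\<And>k n a. a \<in> D k n \<Longrightarrow> tsize a \<le> b k n"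
  using assms unfolding small_def by blast

lemma small_image_Pair:
  assumes "small (\<lambda>k n. f ` D k n)" "small (\<lambda>k n. g ` D k n)"
  shows "small (\<lambda>k n. (\<lambda>a. (f a, g a)) ` D k n)"
proof -
  obtain b b' where "fpt_bounded b" "\<And>k n a. a \<in> f ` D k n \<Longrightarrow> tsize a \<le> b k n"
    "fpt_bounded b'" "\<And>k n a. a \<in> g ` D k n \<Longrightarrow> tsize a \<le> b' k n"
    using assms by (elim smallE) blast
  then show ?thesis
    by (intro smallI[of "\<lambda>k n. 1 + b k n + b' k n"]) (force intro!: fb_intros add_mono)+
qed

lemma feasI:
  assumes "small D" "small (\<lambda>k n. f ` D k n)" "fpt_bounded b"
    "\<And>k n a st. a \<in> D k n \<Longrightarrow> steps p (encode a) st (b k n) (encode (f a)) st"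
  shows "feas D f"
  using assms unfolding feas_def by blast

lemma feasE:
  assumes "feas D f"
  obtains p b where "fpt_bounded b"
    "\<And>k n a st. a \<in> D k n \<Longrightarrow> steps p (encode a) st (b k n) (encode (f a)) st"
  using assms unfolding feas_def by blast

lemma feas_small: "feas D f \<Longrightarrow> small D"
  and feas_small_image: "feas D f \<Longrightarrow> small (\<lambda>k n. f ` D k n)"
  unfolding feas_def by auto

lemma feas_size:
  assumes "feas D f"
  obtains b where "fpt_bounded b" "\<And>k n a. a \<in> D k n \<Longrightarrow> tsize (f a) \<le> b k n"
  using feas_small_image[OF assms] by (elim smallE) (use that in blast)

lemma small_subset: "small D \<Longrightarrow> (\<And>k n. D' k n \<subseteq> D k n) \<Longrightarrow> small D'"
  unfolding small_def by (meson subsetD)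

lemma feas_subset:
  assumes "feas D f" "\<And>k n. D' k n \<subseteq> D k n"
  shows "feas D' f"
proof -
  obtain p b where "fpt_bounded b"
    "\<And>k n a st. a \<in> D k n \<Longrightarrow> steps p (encode a) st (b k n) (encode (f a)) st"
    using assms(1) by (rule feasE) blast
  moreover have "small D'" "small (\<lambda>k n. f ` D' k n)"
    using small_subset[OF feas_small[OF assms(1)]] small_subset[OF feas_small_image[OF assms(1)]] assms(2)
    by (meson image_mono)+
  ultimately show ?thesis using assms(2) by (intro feasI) (blast intro: subsetD)+
qed

lemma feas_cong:
  assumes "feas D f" "\<And>k n a. a \<in> D k n \<Longrightarrow> f a = g a"
  shows "feas D g"
proof -
  have "(\<lambda>k n. g ` D k n) = (\<lambda>k n. f ` D k n)" using assms(2) by (auto simp: fun_eq_iff image_def)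
  then show ?thesis using assms unfolding feas_def by simp
qed

text \<open>Both time bounds refer to the same \<open>k\<close> and \<open>n\<close>, not to the
  size of the intermediate result, so they simply add up. The price is that \<open>f a\<close> has
  to lie in the domain of \<open>g\<close> for the same \<open>k\<close> and
  \<open>n\<close>.\<close>

lemma feas_comp:
  assumes f: "feas D f" and g: "feas D' g" and "\<And>k n a. a \<in> D k n \<Longrightarrow> f a \<in> D' k n"
  shows "feas D (\<lambda>a. g (f a))"
proof -
  obtain p b where p: "fpt_bounded b"
    "\<And>k n a st. a \<in> D k n \<Longrightarrow> steps p (encode a) st (b k n) (encode (f a)) st"
    using f by (rule feasE) blast
  obtain p' b' where p': "fpt_bounded b'"
    "\<And>k n a st. a \<in> D' k n \<Longrightarrow> steps p' (encode a) st (b' k n) (encode (g a)) st"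
    using g by (rule feasE) blast
  show ?thesis
  proof (rule feasI[where p = "Seq p p'" and b = "\<lambda>k n. b k n + b' k n"])
    show "small (\<lambda>k n. (\<lambda>a. g (f a)) ` D k n)"
      by (rule small_subset[OF feas_small_image[OF g]]) (use assms(3) in blast)
    show "fpt_bounded (\<lambda>k n. b k n + b' k n)" using p p' by (intro fb_intros)
    show "steps (Seq p p') (encode a) st (b k n + b' k n) (encode (g (f a))) st" if "a \<in> D k n" for k n a st
      by (rule steps_Seq[OF p(2)[OF that] p'(2)[OF assms(3)[OF that]]])
  qed (use feas_small[OF f] in simp)
qed

lemma feas_expr:
  assumes "small D" "small (\<lambda>k n. f ` D k n)"
    "\<And>k n a s. a \<in> D k n \<Longrightarrow> s 0 = encode a \<Longrightarrow> eval_expr e s = encode (f a)"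
  shows "feas D f"
proof (rule feasI[OF assms(1,2), where p = "Assign 0 e"])
  show "fpt_bounded (\<lambda>k n. 1 + cost e)" by (intro fb_intros)
  show "steps (Assign 0 e) (encode a) st (1 + cost e) (encode (f a)) st" if "a \<in> D k n" for k n a st
    using assms(3)[OF that] by (intro steps_acc) simp
qed

lemma feas_id: "small D \<Longrightarrow> feas D (\<lambda>a. a)"
  by (rule feas_expr[where e = "Var 0"]) auto

fun const_expr :: "tree \<Rightarrow> expr" where
  "const_expr Leaf = LeafE"
| "const_expr (Node a b) = NodeE (const_expr a) (const_expr b)"

lemma eval_const_expr [simp]: "eval_expr (const_expr x) s = x"
  by (induction x) auto

lemma feas_const:
  assumes "small D"
  shows "feas D (\<lambda>_. c)"
proof (rule feas_expr[where e = "const_expr (encode c)"])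
  show "small (\<lambda>k n. (\<lambda>_. c) ` D k n)" by (rule smallI[of "\<lambda>k n. tsize c"]) (auto intro: fb_intros)
qed (use assms in auto)

text \<open>For operations of constant time that add at most a constant to the size: these can
  follow any feasible function.\<close>

lemma feas_prog:
  assumes "feas D f" "\<And>a st. steps p (encode a) st c (encode (g a)) st" "\<And>a. tsize (g a) \<le> c + tsize a"
  shows "feas D (\<lambda>a. g (f a))"
proof (rule feas_comp[OF assms(1)])
  obtain b where b: "fpt_bounded b" "\<And>k n a. a \<in> D k n \<Longrightarrow> tsize (f a) \<le> b k n"
    using feas_size[OF assms(1)] by blast
  show "feas (\<lambda>k n. f ` D k n) g"
  proof (rule feasI)
    show "small (\<lambda>k n. g ` f ` D k n)"
    proof (rule smallI[of "\<lambda>k n. c + b k n"])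
      show "fpt_bounded (\<lambda>k n. c + b k n)" using b by (intro fb_intros)
      show "tsize x \<le> c + b k n" if "x \<in> g ` f ` D k n" for k n x
        using that b(2) assms(3) by (auto) (meson add_left_mono order.trans)
    qed
    show "fpt_bounded (\<lambda>k n. c)" by (rule fb_const)
  qed (use assms feas_small_image in auto)
qed auto

lemma feas_expr_comp:
  assumes "feas D f" "\<And>a s. s 0 = encode a \<Longrightarrow> eval_expr e s = encode (g a)" "\<And>a. tsize (g a) \<le> c + tsize a"
  shows "feas D (\<lambda>a. g (f a))"
  using assms(1)
proof (rule feas_prog)
  show "steps (Assign 0 e) (encode a) st (1 + cost e + c) (encode (g a)) st" for a st
    by (rule steps_mono[OF steps_acc]) (use assms(2) in auto)
  show "tsize (g a) \<le> 1 + cost e + c + tsize a" for a using assms(3)[of a] by simp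
qed

section \<open>Elementary operations, pairing and branching\<close>

lemma feas_fst: "feas D f \<Longrightarrow> feas D (\<lambda>a. fst (f a))"
  by (rule feas_expr_comp[where g = fst and e = "LeftE (Var 0)" and c = 0]) (auto)

lemma feas_snd: "feas D f \<Longrightarrow> feas D (\<lambda>a. snd (f a))"
  by (rule feas_expr_comp[where g = snd and e = "RightE (Var 0)" and c = 0]) (auto)

text \<open>\<open>right Leaf = Leaf\<close> agrees with \<open>tl [] = []\<close>, and in
  \<open>feas_pred\<close> with truncated subtraction.\<close>

lemma feas_tl: "feas D f \<Longrightarrow> feas D (\<lambda>a. tl (f a))"
proof (rule feas_expr_comp[where g = tl and e = "RightE (Var 0)" and c = 0])
  show "tsize (tl xs) \<le> 0 + tsize xs" for xs :: "'c::encodable list" by (cases xs) auto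
  show "eval_expr (RightE (Var 0)) s = encode (tl xs)" if "s 0 = encode xs" for xs :: "'c::encodable list" and s
    using that by (cases xs) auto
qed

lemma feas_Suc: "feas D f \<Longrightarrow> feas D (\<lambda>a. Suc (f a))"
  by (rule feas_expr_comp[where g = Suc and e = "NodeE LeafE (Var 0)" and c = 2]) auto

lemma feas_pred: "feas D f \<Longrightarrow> feas D (\<lambda>a. f a - Suc 0)"
proof (rule feas_expr_comp[where g = "\<lambda>n. n - Suc 0" and e = "RightE (Var 0)" and c = 0])
  show "eval_expr (RightE (Var 0)) s = encode (m - Suc 0)" if "s 0 = encode m" for m s
    using that by (cases m) auto
qed auto

lemma feas_replicate_unit: "feas D f \<Longrightarrow> feas D (\<lambda>a. replicate (f a) ())"
proof (rule feas_expr_comp[where g = "\<lambda>n. replicate n ()" and e = "Var 0" and c = 0])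
  show "eval_expr (Var 0) s = encode (replicate m ())" if "s 0 = encode m" for m s
  proof -
    have "enc_nat m = encode (replicate m ())" by (induction m) auto
    then show ?thesis using that by simp
  qed
  show "tsize (replicate m ()) \<le> 0 + tsize m" for m by (induction m) auto
qed

text \<open>The program for \<open>f\<close> overwrites the accumulator, so a copy of the argument
  is pushed first. Then \<open>f a\<close> is stored next to that copy while the program for
  \<open>g\<close> runs, and finally the pair is assembled and the stack restored. The numerals in
  the bound are the times of the single assignments.\<close>

lemma feas_Pair:
  assumes f: "feas D f" and g: "feas D g"
  shows "feas D (\<lambda>a. (f a, g a))"
proof -
  obtain p b where p: "fpt_bounded b"
    "\<And>k n a st. a \<in> D k n \<Longrightarrow> steps p (encode a) st (b k n) (encode (f a)) st"
    using f by (rule feasE) blast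
  obtain p' b' where p': "fpt_bounded b'"
    "\<And>k n a st. a \<in> D k n \<Longrightarrow> steps p' (encode a) st (b' k n) (encode (g a)) st"
    using g by (rule feasE) blast
  let ?c1 = "Assign 1 (NodeE (Var 0) (Var 1))"
  let ?c2 = "Seq (Assign 1 (NodeE (NodeE (Var 0) (LeftE (Var 1))) (RightE (Var 1))))
                 (Assign 0 (RightE (LeftE (Var 1))))"
  let ?c3 = "Seq (Assign 0 (NodeE (LeftE (LeftE (Var 1))) (Var 0))) (Assign 1 (RightE (Var 1)))"
  let ?p = "Seq ?c1 (Seq p (Seq ?c2 (Seq p' ?c3)))"
  show ?thesis
  proof (rule feasI[where p = ?p and b = "\<lambda>k n. 4 + (b k n + ((8 + 4) + (b' k n + (6 + 3))))"])
    show "small (\<lambda>k n. (\<lambda>a. (f a, g a)) ` D k n)"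
      by (intro small_image_Pair feas_small_image assms)
    show "fpt_bounded (\<lambda>k n. 4 + (b k n + ((8 + 4) + (b' k n + (6 + 3)))))" using p p' by (intro fb_intros)
    fix k n a st assume a: "a \<in> D k n"
    show "steps ?p (encode a) st (4 + (b k n + ((8 + 4) + (b' k n + (6 + 3))))) (encode (f a, g a)) st"
    proof (intro steps_Seq)
      show "steps (Assign 1 (NodeE (Var 0) (Var 1))) (encode a) st 4 (encode a) (Node (encode a) st)"
        by (rule steps_mono[OF steps_stack]) auto
      show "steps p (encode a) (Node (encode a) st) (b k n) (encode (f a)) (Node (encode a) st)"
        by (rule p(2)[OF a])
      show "steps (Assign 1 (NodeE (NodeE (Var 0) (LeftE (Var 1))) (RightE (Var 1))))
          (encode (f a)) (Node (encode a) st) 8 (encode (f a)) (Node (Node (encode (f a)) (encode a)) st)"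
        by (rule steps_mono[OF steps_stack]) auto
      show "steps (Assign 0 (RightE (LeftE (Var 1)))) (encode (f a)) (Node (Node (encode (f a)) (encode a)) st)
          4 (encode a) (Node (Node (encode (f a)) (encode a)) st)"
        by (rule steps_mono[OF steps_acc]) auto
      show "steps p' (encode a) (Node (Node (encode (f a)) (encode a)) st) (b' k n)
          (encode (g a)) (Node (Node (encode (f a)) (encode a)) st)"
        by (rule p'(2)[OF a])
      show "steps (Assign 0 (NodeE (LeftE (LeftE (Var 1))) (Var 0)))
          (encode (g a)) (Node (Node (encode (f a)) (encode a)) st) 6
          (encode (f a, g a)) (Node (Node (encode (f a)) (encode a)) st)"
        by (rule steps_mono[OF steps_acc]) auto
      show "steps (Assign 1 (RightE (Var 1)))
          (encode (f a, g a)) (Node (Node (encode (f a)) (encode a)) st) 3 (encode (f a, g a)) st"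
        by (rule steps_mono[OF steps_stack]) auto
    qed
  qed (use feas_small[OF f] in simp)
qed

lemma feas_Cons:
  assumes "feas D f" "feas D g"
  shows "feas D (\<lambda>a. f a # g a)"
  using feas_expr_comp[OF feas_Pair[OF assms], where g = "\<lambda>p. fst p # snd p" and e = "Var 0" and c = 0]
  by simp

lemma feas_Nil_iff:
  assumes "feas D f"
  shows "feas D (\<lambda>a. f a = [])"
  using assms
proof (rule feas_prog[where g = "\<lambda>xs. xs = []"])
  show "steps (If (Var 0) (Assign 0 LeafE) (Assign 0 (NodeE LeafE LeafE))) (encode xs) st (2 + 4) (encode (xs = [])) st"
    for xs :: "'c::encodable list" and st
    by (rule steps_If; rule steps_mono[OF steps_acc]; cases xs) auto
  show "tsize (xs = []) \<le> 2 + 4 + tsize xs" for xs :: "'c::encodable list"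
    by (cases xs) auto
qed

lemma feas_hd:
  assumes "feas D f"
  shows "feas D (\<lambda>a. hd (f a))"
  using assms
proof (rule feas_prog[where g = hd])
  \<comment> \<open>\<open>hd []\<close> is some fixed value of its type, so its encoding can be a
    constant of the program.\<close>
  let ?c = "encode (hd [] :: 'b)"
  let ?t = "5 + cost (const_expr ?c) + tree_size ?c"
  show "steps (If (Var 0) (Assign 0 (LeftE (Var 0))) (Assign 0 (const_expr ?c))) (encode xs) st (2 + ?t) (encode (hd xs)) st"
    for xs :: "'b list" and st
    by (rule steps_If; rule steps_mono[OF steps_acc]; cases xs) auto
  show "tsize (hd xs) \<le> 2 + ?t + tsize xs" for xs :: "'b list"
    by (cases xs) (auto simp: tsize_def)
qed

lemma feas_if:
  assumes c: "feas D c" and f: "feas (\<lambda>k n. {a \<in> D k n. c a}) f" and g: "feas (\<lambda>k n. {a \<in> D k n. \<not> c a}) g"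
  shows "feas D (\<lambda>a. if c a then f a else g a)"
proof -
  obtain p0 b0 where p0: "fpt_bounded b0"
    "\<And>k n a st. a \<in> D k n \<Longrightarrow> steps p0 (encode a) st (b0 k n) (encode (c a)) st"
    using c by (rule feasE) blast
  obtain p b where p: "fpt_bounded b"
    "\<And>k n a st. a \<in> {a \<in> D k n. c a} \<Longrightarrow> steps p (encode a) st (b k n) (encode (f a)) st"
    using f by (rule feasE) blast
  obtain p' b' where p': "fpt_bounded b'"
    "\<And>k n a st. a \<in> {a \<in> D k n. \<not> c a} \<Longrightarrow> steps p' (encode a) st (b' k n) (encode (g a)) st"
    using g by (rule feasE) blast
  let ?pop = "Seq (Assign 0 (LeftE (Var 1))) (Assign 1 (RightE (Var 1)))"
  have pop: "steps ?pop x (Node y st) (3 + 3) y st" for x y st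
    by (rule steps_Seq; (rule steps_mono[OF steps_acc] | rule steps_mono[OF steps_stack]); simp)
  let ?p = "Seq (Assign 1 (NodeE (Var 0) (Var 1))) (Seq p0 (If (Var 0) (Seq ?pop p) (Seq ?pop p')))"
  let ?b = "\<lambda>k n. 4 + (b0 k n + (2 + ((3 + 3) + (b k n + b' k n))))"
  show ?thesis
  proof (rule feasI[where p = ?p and b = ?b])
    obtain m m' where m: "fpt_bounded m" "\<And>k n a. a \<in> {a \<in> D k n. c a} \<Longrightarrow> tsize (f a) \<le> m k n"
      "fpt_bounded m'" "\<And>k n a. a \<in> {a \<in> D k n. \<not> c a} \<Longrightarrow> tsize (g a) \<le> m' k n"
      using f g by (elim feas_size) blast
    show "small (\<lambda>k n. (\<lambda>a. if c a then f a else g a) ` D k n)"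
      by (rule smallI[of "\<lambda>k n. m k n + m' k n"])
         (use m in \<open>auto intro!: fb_intros intro: trans_le_add1 trans_le_add2\<close>)
    show "fpt_bounded ?b" using p0 p p' by (intro fb_intros)
    fix k n a st assume a: "a \<in> D k n"
    have "steps (If (Var 0) (Seq ?pop p) (Seq ?pop p')) (encode (c a)) (Node (encode a) st)
      (2 + ((3 + 3) + (b k n + b' k n))) (encode (if c a then f a else g a)) st"
    proof (rule steps_If; rule steps_Seq[OF pop])
      assume "encode (c a) \<noteq> Leaf"
      then have "c a" by (cases "c a") auto
      then show "steps p (encode a) st (b k n + b' k n) (encode (if c a then f a else g a)) st"
        by (simp, intro steps_mono[OF p(2)]) (use a in auto)
    next
      assume "encode (c a) = Leaf"
      then have "\<not> c a" by (cases "c a") auto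
      then show "steps p' (encode a) st (b k n + b' k n) (encode (if c a then f a else g a)) st"
        by (simp, intro steps_mono[OF p'(2)]) (use a in auto)
    qed
    then show "steps ?p (encode a) st (?b k n) (encode (if c a then f a else g a)) st"
      by (intro steps_Seq[OF steps_mono[OF steps_stack] steps_Seq[OF p0(2)[OF a]]]) auto
  qed (use feas_small[OF c] in simp)
qed

lemma feas_if':
  assumes "feas D c" "feas D f" "feas D g"
  shows "feas D (\<lambda>a. if c a then f a else g a)"
  by (rule feas_if; use assms in \<open>auto elim: feas_subset\<close>)

section \<open>Loops over lists\<close>

definition loop_body :: "com \<Rightarrow> com" where
  "loop_body p =
     Seq (Assign 1 (NodeE (Var 0) (Var 1)))
    (Seq (Assign 0 (NodeE (LeftE (LeftE (Var 0))) (RightE (Var 0))))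
    (Seq p
    (Seq (Assign 0 (NodeE (RightE (LeftE (LeftE (Var 1))))
                          (NodeE (Var 0) (RightE (RightE (LeftE (Var 1)))))))
         (Assign 1 (RightE (Var 1))))))"

text \<open>The accumulator holds the remaining list, the running value and the fixed argument.
  \<open>loop_body\<close> saves this triple on the stack, hands \<open>p\<close> the triple with
  the head in place of the list, and rebuilds it with the tail and the new running value. 29 is one
  test (3) and four assignments (4, 7, 12, 3); the leading 3 is the last test, which fails.\<close>

lemma steps_fold:
  assumes "\<And>ys x zs st. xs = ys @ x # zs \<Longrightarrow>
    steps p (encode (x, fold f ys i, a)) st b (encode (f x (fold f ys i))) st"
  shows "steps (While (LeftE (Var 0)) (loop_body p)) (encode (xs, i, a)) st
    (3 + length xs * (29 + b)) (encode ([] :: 'x::encodable list, fold f xs i, a)) st"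
  using assms
proof (induction xs arbitrary: i)
  case Nil
  then show ?case using steps_While_done by auto
next
  case (Cons x xs)
  let ?s = "Node (encode (x # xs, i, a)) st"
  have *: "steps (While (LeftE (Var 0)) (loop_body p)) (encode (xs, f x i, a)) st
    (3 + length xs * (29 + b)) (encode ([] :: 'x list, fold f xs (f x i), a)) st"
  proof (rule Cons.IH)
    fix ys y zs st assume "xs = ys @ y # zs"
    then show "steps p (encode (y, fold f ys (f x i), a)) st b (encode (f y (fold f ys (f x i)))) st"
      using Cons.prems[of "x # ys" y zs st] by simp
  qed
  have "steps (loop_body p) (encode (x # xs, i, a)) st (4 + (7 + (b + (12 + 3)))) (encode (xs, f x i, a)) st"
    unfolding loop_body_def
  proof (intro steps_Seq)
    show "steps (Assign 1 (NodeE (Var 0) (Var 1))) (encode (x # xs, i, a)) st 4 (encode (x # xs, i, a)) ?s"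
      by (rule steps_mono[OF steps_stack]) auto
    show "steps (Assign 0 (NodeE (LeftE (LeftE (Var 0))) (RightE (Var 0)))) (encode (x # xs, i, a)) ?s 7
        (encode (x, i, a)) ?s"
      by (rule steps_mono[OF steps_acc]) auto
    show "steps p (encode (x, i, a)) ?s b (encode (f x i)) ?s"
      using Cons.prems[of "[]"] by simp
    show "steps (Assign 0 (NodeE (RightE (LeftE (LeftE (Var 1))))
        (NodeE (Var 0) (RightE (RightE (LeftE (Var 1))))))) (encode (f x i)) ?s 12 (encode (xs, f x i, a)) ?s"
      by (rule steps_mono[OF steps_acc]) auto
    show "steps (Assign 1 (RightE (Var 1))) (encode (xs, f x i, a)) ?s 3 (encode (xs, f x i, a)) st"
      by (rule steps_mono[OF steps_stack]) auto
  qed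
  from steps_mono[OF steps_While[OF _ this *]] show ?case by simp
qed

text \<open>The size of the running values must be bounded separately in \<open>acc\<close>:
  iterating a cheap body can still build a tree of exponential size. The domain of the body is
  handed over as an equation, because some bodies only use that it is small, whereas others use
  which triples occur in it.\<close>

lemma feas_fold:
  fixes f :: "'x::encodable \<Rightarrow> 'c::encodable \<Rightarrow> 'a::encodable \<Rightarrow> 'c"
  assumes xs: "feas D xs" and init: "feas D init"
    and acc: "small (\<lambda>k n. {fold (\<lambda>x acc. f x acc a) ys (init a) |a ys zs. a \<in> D k n \<and> xs a = ys @ zs})"
    and step: "\<And>D'. D' = (\<lambda>k n. {(x, fold (\<lambda>x acc. f x acc a) ys (init a), a) |a ys x zs. a \<in> D k n \<and> xs a = ys @ x # zs}) \<Longrightarrow>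
      small D' \<Longrightarrow> feas D' (\<lambda>p. f (fst p) (fst (snd p)) (snd (snd p)))"
  shows "feas D (\<lambda>a. fold (\<lambda>x acc. f x acc a) (xs a) (init a))"
proof -
  define D' where "D' = (\<lambda>k n. {(x, fold (\<lambda>x acc. f x acc a) ys (init a), a) |a ys x zs. a \<in> D k n \<and> xs a = ys @ x # zs})"
  obtain l where l: "fpt_bounded l" "\<And>k n a. a \<in> D k n \<Longrightarrow> tsize (xs a) \<le> l k n"
    using feas_size[OF xs] by blast
  obtain m where m: "fpt_bounded m" "\<And>k n a ys zs. a \<in> D k n \<Longrightarrow> xs a = ys @ zs \<Longrightarrow>
      tsize (fold (\<lambda>x acc. f x acc a) ys (init a)) \<le> m k n"
    using acc by (rule smallE) blast
  obtain d where d: "fpt_bounded d" "\<And>k n a. a \<in> D k n \<Longrightarrow> tsize a \<le> d k n"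
    using feas_small[OF xs] by (rule smallE) blast
  have "small D'"
  proof (rule smallI)
    show "fpt_bounded (\<lambda>k n. 1 + l k n + (1 + m k n + d k n))" using l m d by (intro fb_intros)
    fix k n p assume "p \<in> D' k n"
    then obtain x a ys zs where p: "p = (x, fold (\<lambda>x acc. f x acc a) ys (init a), a)" "a \<in> D k n" "xs a = ys @ x # zs"
      unfolding D'_def by blast
    have "tsize x \<le> tsize (xs a)" by (rule tsize_mem) (simp add: p)
    with l(2)[OF p(2)] m(2)[OF p(2,3)] d(2)[OF p(2)] show "tsize p \<le> 1 + l k n + (1 + m k n + d k n)"
      by (simp add: p(1))
  qed
  then have "feas D' (\<lambda>p. f (fst p) (fst (snd p)) (snd (snd p)))"
    by (rule step[OF D'_def])
  then obtain p b where p: "fpt_bounded b"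
    "\<And>k n a st. a \<in> D' k n \<Longrightarrow> steps p (encode a) st (b k n) (encode (f (fst a) (fst (snd a)) (snd (snd a)))) st"
    by (rule feasE) blast
  have "feas D (\<lambda>a. (xs a, init a, a))" by (intro feas_Pair feas_id xs init feas_small[OF xs])
  then obtain q b' where q: "fpt_bounded b'"
    "\<And>k n a st. a \<in> D k n \<Longrightarrow> steps q (encode a) st (b' k n) (encode (xs a, init a, a)) st"
    by (rule feasE) blast
  let ?p = "Seq q (Seq (While (LeftE (Var 0)) (loop_body p)) (Assign 0 (LeftE (RightE (Var 0)))))"
  let ?b = "\<lambda>k n. b' k n + ((3 + l k n * (29 + b k n)) + 4)"
  show ?thesis
  proof (rule feasI[where p = ?p and b = ?b])
    show "small (\<lambda>k n. (\<lambda>a. fold (\<lambda>x acc. f x acc a) (xs a) (init a)) ` D k n)"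
      by (rule smallI[OF m(1)]) (use m(2) in auto)
    show "fpt_bounded ?b" using p q l by (intro fb_intros)
    fix k n a st assume a: "a \<in> D k n"
    let ?F = "\<lambda>x acc. f x acc a"
    have len: "length (xs a) \<le> l k n" using length_le_tsize[of "xs a"] l(2)[OF a] by simp
    show "steps ?p (encode a) st (?b k n) (encode (fold ?F (xs a) (init a))) st"
    proof (intro steps_Seq)
      show "steps q (encode a) st (b' k n) (encode (xs a, init a, a)) st" by (rule q(2)[OF a])
      have "steps (While (LeftE (Var 0)) (loop_body p)) (encode (xs a, init a, a)) st
        (3 + length (xs a) * (29 + b k n)) (encode ([] :: 'x list, fold ?F (xs a) (init a), a)) st"
      proof (rule steps_fold)
        fix ys x zs st assume "xs a = ys @ x # zs"
        with a have "(x, fold ?F ys (init a), a) \<in> D' k n" unfolding D'_def by blast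
        from p(2)[OF this] show "steps p (encode (x, fold ?F ys (init a), a)) st (b k n)
           (encode (?F x (fold ?F ys (init a)))) st" by simp
      qed
      then show "steps (While (LeftE (Var 0)) (loop_body p)) (encode (xs a, init a, a)) st
        (3 + l k n * (29 + b k n)) (encode ([] :: 'x list, fold ?F (xs a) (init a), a)) st"
        by (rule steps_mono) (use len in simp)
      show "steps (Assign 0 (LeftE (RightE (Var 0)))) (encode ([] :: 'x list, fold ?F (xs a) (init a), a)) st
        4 (encode (fold ?F (xs a) (init a))) st"
        by (rule steps_mono[OF steps_acc]) auto
    qed
  qed (use feas_small[OF xs] in simp)
qed

section \<open>List operations derived from loops\<close>

definition ext :: "(nat \<Rightarrow> nat \<Rightarrow> 'a set) \<Rightarrow> ('a \<Rightarrow> 'x list) \<Rightarrow> nat \<Rightarrow> nat \<Rightarrow> ('x \<times> 'a) set" where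
  "ext D xs k n = {(x, a). a \<in> D k n \<and> x \<in> set (xs a)}"

lemma tsize_prefix: "tsize ys \<le> tsize (ys @ zs)"
  using tsize_append[of ys zs] tsize_pos[of zs] by linarith

lemma small_fold_prefix:
  assumes "feas D xs" "\<And>a ys zs. xs a = ys @ zs \<Longrightarrow> tsize (g a ys) \<le> c * tsize (xs a) + c"
  shows "small (\<lambda>k n. {g a ys |a ys zs. a \<in> D k n \<and> xs a = ys @ zs})"
proof -
  obtain b where b: "fpt_bounded b" "\<And>k n a. a \<in> D k n \<Longrightarrow> tsize (xs a) \<le> b k n"
    using feas_size[OF assms(1)] by blast
  show ?thesis
  proof (rule smallI)
    show "fpt_bounded (\<lambda>k n. c * b k n + c)" using b by (intro fb_intros)
    show "tsize p \<le> c * b k n + c" if "p \<in> {g a ys |a ys zs. a \<in> D k n \<and> xs a = ys @ zs}" for k n p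
      using that assms(2) b(2) by (force intro: order.trans[OF assms(2)])
  qed
qed

lemma feas_rev:
  assumes "feas D xs"
  shows "feas D (\<lambda>a. rev (xs a))"
proof -
  have "feas D (\<lambda>a. fold (\<lambda>x acc. x # acc) (xs a) [])"
  proof (rule feas_fold[where f = "\<lambda>x acc a. x # acc" and init = "\<lambda>_. []"])
    have *: "fold (\<lambda>x acc. x # acc) ys [] = rev ys" for ys :: "'b list" by (simp add: fold_Cons_rev)
    show "small (\<lambda>k n. {fold (\<lambda>x acc. x # acc) ys [] |a ys zs. a \<in> D k n \<and> xs a = ys @ zs})"
      by (rule small_fold_prefix[OF assms, where c = 1]) (auto simp: * intro: tsize_prefix le_SucI)
  qed (intro feas_Cons feas_fst feas_snd feas_id feas_const assms feas_small[OF assms] | assumption)+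
  then show ?thesis by (simp add: fold_Cons_rev)
qed

lemma small_fold_ext:
  assumes xs: "feas D xs" and f: "feas (ext D xs) (\<lambda>p. f (fst p) (snd p))"
    and "\<And>a ys zs. xs a = ys @ zs \<Longrightarrow> tsize (g a ys) \<le> c + (\<Sum>x\<leftarrow>ys. c + tsize (f x a))"
  shows "small (\<lambda>k n. {g a ys |a ys zs. a \<in> D k n \<and> xs a = ys @ zs})"
proof -
  obtain b where b: "fpt_bounded b" "\<And>k n a. a \<in> D k n \<Longrightarrow> tsize (xs a) \<le> b k n"
    using feas_size[OF xs] by blast
  obtain m where m: "fpt_bounded m" "\<And>k n p. p \<in> ext D xs k n \<Longrightarrow> tsize (f (fst p) (snd p)) \<le> m k n"
    using feas_size[OF f] by blast
  show ?thesis
  proof (rule smallI)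
    show "fpt_bounded (\<lambda>k n. c + b k n * (c + m k n))" using b m by (intro fb_intros)
    fix k n p assume "p \<in> {g a ys |a ys zs. a \<in> D k n \<and> xs a = ys @ zs}"
    then obtain a ys zs where p: "p = g a ys" "a \<in> D k n" "xs a = ys @ zs" by blast
    have "tsize p \<le> c + (\<Sum>x\<leftarrow>ys. c + tsize (f x a))" using assms(3)[OF p(3)] p(1) by simp
    also have "(\<Sum>x\<leftarrow>ys. c + tsize (f x a)) \<le> (\<Sum>x\<leftarrow>ys. c + m k n)"
      using p(2,3) m(2)[of "(_, a)" k n] by (intro sum_list_mono) (auto simp: ext_def)
    also have "\<dots> = length ys * (c + m k n)" by (simp add: sum_list_triv)
    also have "\<dots> \<le> b k n * (c + m k n)"
      using b(2)[OF p(2)] length_le_tsize[of "xs a"] p(3) by (intro mult_right_mono) auto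
    finally show "tsize p \<le> c + b k n * (c + m k n)" by simp
  qed
qed

lemma small_ext:
  assumes "feas D xs"
  shows "small (ext D xs)"
proof -
  obtain b where b: "fpt_bounded b" "\<And>k n a. a \<in> D k n \<Longrightarrow> tsize (xs a) \<le> b k n"
    using feas_size[OF assms(1)] by blast
  obtain d where d: "fpt_bounded d" "\<And>k n a. a \<in> D k n \<Longrightarrow> tsize a \<le> d k n"
    using feas_small[OF assms(1)] by (rule smallE) blast
  show ?thesis
  proof (rule smallI)
    show "fpt_bounded (\<lambda>k n. 1 + b k n + d k n)" using b d by (intro fb_intros)
    show "tsize p \<le> 1 + b k n + d k n" if "p \<in> ext D xs k n" for k n p
      using that b(2) d(2) by (auto simp: ext_def intro!: add_mono intro: order.trans[OF tsize_mem])
  qed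
qed

lemma feas_ext_body:
  assumes "feas (ext D xs) (\<lambda>p. f (fst p) (snd p))" "small D'"
    "\<And>k n p. p \<in> D' k n \<Longrightarrow> snd (snd p) \<in> D k n \<and> fst p \<in> set (xs (snd (snd p)))"
  shows "feas D' (\<lambda>p. f (fst p) (snd (snd p)))"
proof -
  have "feas D' (\<lambda>q. (\<lambda>p. f (fst p) (snd p)) (fst q, snd (snd q)))"
    by (rule feas_comp[OF _ assms(1)])
       (use assms(2,3) in \<open>auto intro!: feas_Pair feas_fst feas_snd feas_id simp: ext_def\<close>)
  then show ?thesis by simp
qed

text \<open>The body may refer to the element and to the argument, so its domain is
  \<open>ext D xs\<close>. Smallness of that domain is offered as a premise because decomposing the
  body with \<open>feas_intros\<close> ends in \<open>feas_id\<close>, which asks for it. The rules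
  for \<open>filter\<close>, \<open>takeWhile\<close> and bounded quantifiers have the same
  form.\<close>

lemma feas_map:
  assumes xs: "feas D xs" and f: "small (ext D xs) \<Longrightarrow> feas (ext D xs) (\<lambda>p. f (fst p) (snd p))"
  shows "feas D (\<lambda>a. map (\<lambda>x. f x a) (xs a))"
proof -
  note f = f[OF small_ext[OF xs]]
  have *: "fold (\<lambda>x acc. f x a # acc) ys [] = rev (map (\<lambda>x. f x a) ys)" for a ys
    by (induction ys rule: rev_induct) auto
  have "feas D (\<lambda>a. fold (\<lambda>x acc. f x a # acc) (xs a) [])"
  proof (rule feas_fold[where f = "\<lambda>x acc a. f x a # acc" and init = "\<lambda>_. []"])
    show "small (\<lambda>k n. {fold (\<lambda>x acc. f x a # acc) ys [] |a ys zs. a \<in> D k n \<and> xs a = ys @ zs})"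
    proof (rule small_fold_ext[OF xs f])
      show "tsize (fold (\<lambda>x acc. f x a # acc) ys []) \<le> 1 + (\<Sum>x\<leftarrow>ys. 1 + tsize (f x a))" for a ys
        by (simp add: * tsize_list[of "map _ _"] comp_def)
    qed
    fix D' assume D': "D' = (\<lambda>k n. {(x, fold (\<lambda>x acc. f x a # acc) ys [], a) |a ys x zs.
          a \<in> D k n \<and> xs a = ys @ x # zs})" "small D'"
    show "feas D' (\<lambda>p. f (fst p) (snd (snd p)) # fst (snd p))"
    proof (intro feas_Cons)
      show "feas D' (\<lambda>p. f (fst p) (snd (snd p)))"
        by (rule feas_ext_body[OF f D'(2)]) (auto simp: D'(1))
    qed (intro feas_fst feas_snd feas_id D')
  qed (intro feas_const xs feas_small[OF xs])+
  from feas_rev[OF this] show ?thesis by (simp add: * rev_map)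
qed

lemma feas_filter:
  assumes xs: "feas D xs" and f: "small (ext D xs) \<Longrightarrow> feas (ext D xs) (\<lambda>p. f (fst p) (snd p))"
  shows "feas D (\<lambda>a. filter (\<lambda>x. f x a) (xs a))"
proof -
  note f = f[OF small_ext[OF xs]]
  have *: "fold (\<lambda>x acc. if f x a then x # acc else acc) ys [] = rev (filter (\<lambda>x. f x a) ys)" for a ys
    by (induction ys rule: rev_induct) auto
  have "feas D (\<lambda>a. fold (\<lambda>x acc. if f x a then x # acc else acc) (xs a) [])"
  proof (rule feas_fold[where f = "\<lambda>x acc a. if f x a then x # acc else acc" and init = "\<lambda>_. []"])
    show "small (\<lambda>k n. {fold (\<lambda>x acc. if f x a then x # acc else acc) ys [] |a ys zs. a \<in> D k n \<and> xs a = ys @ zs})"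
    proof (rule small_fold_prefix[OF xs])
      fix a ys zs assume xs: "xs a = ys @ zs"
      have "tsize (filter P ys) \<le> tsize ys" for P by (induction ys) auto
      then show "tsize (fold (\<lambda>x acc. if f x a then x # acc else acc) ys []) \<le> 1 * tsize (xs a) + 1"
        using order.trans[OF _ tsize_prefix, of _ ys zs] by (simp add: * xs le_SucI)
    qed
    fix D' assume D': "D' = (\<lambda>k n. {(x, fold (\<lambda>x acc. if f x a then x # acc else acc) ys [], a) |a ys x zs.
          a \<in> D k n \<and> xs a = ys @ x # zs})" "small D'"
    show "feas D' (\<lambda>p. if f (fst p) (snd (snd p)) then fst p # fst (snd p) else fst (snd p))"
    proof (intro feas_if' feas_Cons)
      show "feas D' (\<lambda>p. f (fst p) (snd (snd p)))"
        by (rule feas_ext_body[OF f D'(2)]) (auto simp: D'(1))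
    qed (intro feas_fst feas_snd feas_id D')+
  qed (intro feas_const xs feas_small[OF xs])+
  from feas_rev[OF this] show ?thesis by (simp add: * )
qed

section \<open>Connectives, bounded quantifiers and concatenation\<close>

lemma feas_not: "feas D f \<Longrightarrow> feas D (\<lambda>a. \<not> f a)"
  by (rule feas_cong[OF feas_if'[OF _ feas_const[of _ False] feas_const[of _ True]]]) (auto intro: feas_small)

lemma feas_conj: "feas D f \<Longrightarrow> feas D g \<Longrightarrow> feas D (\<lambda>a. f a \<and> g a)"
  by (rule feas_cong[OF feas_if'[of D f g "\<lambda>_. False"]]) (auto intro: feas_small feas_const)

lemma feas_disj: "feas D f \<Longrightarrow> feas D g \<Longrightarrow> feas D (\<lambda>a. f a \<or> g a)"
  using feas_not[OF feas_conj[OF feas_not feas_not], of D f g] by simp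

lemma feas_imp: "feas D f \<Longrightarrow> feas D g \<Longrightarrow> feas D (\<lambda>a. f a \<longrightarrow> g a)"
  using feas_disj[OF feas_not, of D f g] by simp

lemma feas_bex:
  assumes xs: "feas D xs" and f: "small (ext D xs) \<Longrightarrow> feas (ext D xs) (\<lambda>p. f (fst p) (snd p))"
  shows "feas D (\<lambda>a. \<exists>x\<in>set (xs a). f x a)"
  using feas_not[OF feas_Nil_iff[OF feas_filter[OF assms]]] by (simp add: filter_empty_conv)

lemma feas_ball:
  assumes xs: "feas D xs" and f: "small (ext D xs) \<Longrightarrow> feas (ext D xs) (\<lambda>p. f (fst p) (snd p))"
  shows "feas D (\<lambda>a. \<forall>x\<in>set (xs a). f x a)"
  using feas_not[OF feas_bex[OF xs feas_not[OF f]]] by simp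

lemma feas_append:
  assumes xs: "feas D xs" and ys: "feas D ys"
  shows "feas D (\<lambda>a. xs a @ ys a)"
proof -
  obtain b where b: "fpt_bounded b" "\<And>k n a. a \<in> D k n \<Longrightarrow> tsize (rev (xs a)) \<le> b k n"
    using feas_size[OF feas_rev[OF xs]] by blast
  obtain b' where b': "fpt_bounded b'" "\<And>k n a. a \<in> D k n \<Longrightarrow> tsize (ys a) \<le> b' k n"
    using feas_size[OF ys] by blast
  have "feas D (\<lambda>a. fold (\<lambda>x acc. x # acc) (rev (xs a)) (ys a))"
  proof (rule feas_fold[where f = "\<lambda>x acc a. x # acc" and init = "ys" and xs = "\<lambda>a. rev (xs a)"])
    show "small (\<lambda>k n. {fold (\<lambda>x acc. x # acc) us (ys a) |a us vs. a \<in> D k n \<and> rev (xs a) = us @ vs})"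
    proof (rule smallI)
      show "fpt_bounded (\<lambda>k n. b k n + b' k n)" using b b' by (intro fb_intros)
      fix k n p assume "p \<in> {fold (\<lambda>x acc. x # acc) us (ys a) |a us vs. a \<in> D k n \<and> rev (xs a) = us @ vs}"
      then obtain a us vs where p: "p = rev us @ ys a" "a \<in> D k n" "rev (xs a) = us @ vs"
        by (auto simp: fold_Cons_rev)
      have "tsize p + 1 = tsize us + tsize (ys a)" using tsize_append[of "rev us"] p(1) by simp
      moreover have "tsize us \<le> b k n" using b(2)[OF p(2)] tsize_prefix[of us vs] p(3) by simp
      ultimately show "tsize p \<le> b k n + b' k n" using b'(2)[OF p(2)] by simp
    qed
  qed (intro feas_Cons feas_fst feas_snd feas_id feas_const feas_rev xs ys | assumption)+
  then show ?thesis by (simp add: fold_Cons_rev)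
qed

lemma feas_concat:
  assumes xs: "feas D xs"
  shows "feas D (\<lambda>a. concat (xs a))"
proof -
  have *: "fold (\<lambda>x acc. acc @ x) ys [] = concat ys" for ys :: "'b list list"
    by (induction ys rule: rev_induct) auto
  have size: "tsize (concat ys) \<le> tsize ys" for ys :: "'b list list"
  proof (induction ys)
    case (Cons x ys)
    then show ?case using tsize_append[of x "concat ys"] by simp
  qed simp
  have "feas D (\<lambda>a. fold (\<lambda>x acc. acc @ x) (xs a) [])"
  proof (rule feas_fold[where f = "\<lambda>x acc a. acc @ x" and init = "\<lambda>_. []"])
    show "small (\<lambda>k n. {fold (\<lambda>x acc. acc @ x) ys [] |a ys zs. a \<in> D k n \<and> xs a = ys @ zs})"
    proof (rule small_fold_prefix[OF xs])
      fix a ys zs assume "xs a = ys @ zs"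
      then show "tsize (fold (\<lambda>x acc. acc @ x) ys []) \<le> 1 * tsize (xs a) + 1"
        using order.trans[OF size tsize_prefix, of ys zs] by (simp add: * le_SucI)
    qed
  qed (intro feas_append feas_fst feas_snd feas_id feas_const xs feas_small[OF xs] | assumption)+
  then show ?thesis by (simp add: *)
qed

lemma feas_length:
  assumes xs: "feas D xs"
  shows "feas D (\<lambda>a. length (xs a))"
proof -
  have *: "fold (\<lambda>x acc. Suc acc) ys 0 = length ys" for ys :: "'b list"
    by (induction ys rule: rev_induct) auto
  have "feas D (\<lambda>a. fold (\<lambda>x acc. Suc acc) (xs a) 0)"
  proof (rule feas_fold[where f = "\<lambda>x acc a. Suc acc" and init = "\<lambda>_. 0"])
    show "small (\<lambda>k n. {fold (\<lambda>x acc. Suc acc) ys 0 |a ys zs. a \<in> D k n \<and> xs a = ys @ zs})"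
    proof (rule small_fold_prefix[OF xs])
      fix a ys zs assume "xs a = ys @ zs"
      then show "tsize (fold (\<lambda>x acc. Suc acc) ys 0) \<le> 2 * tsize (xs a) + 2"
        using order.trans[OF length_le_tsize tsize_prefix, of ys zs] by (simp add: *)
    qed
  qed (intro feas_Suc feas_fst feas_snd feas_id feas_const xs feas_small[OF xs] | assumption)+
  then show ?thesis by (simp add: *)
qed

section \<open>Unary arithmetic and iteration\<close>

lemma feas_add:
  assumes f: "feas D f" and g: "feas D g"
  shows "feas D (\<lambda>a. f a + g a :: nat)"
proof -
  \<comment> \<open>A number and a list of that many units have the same encoding, so addition is
    concatenation.\<close>
  have "feas D (\<lambda>a. length (replicate (f a) () @ replicate (g a) ()))"
    by (intro feas_length feas_append feas_replicate_unit f g)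
  then show ?thesis by simp
qed

lemma feas_mult:
  assumes f: "feas D f" and g: "feas D g"
  shows "feas D (\<lambda>a. f a * g a :: nat)"
proof -
  have "feas D (\<lambda>a. length (concat (map (\<lambda>_. replicate (g a) ()) (replicate (f a) ()))))"
    by (intro feas_length feas_concat feas_map feas_replicate_unit f
        feas_comp[where f = snd and g = g and D = "ext _ _", OF _ g] feas_snd feas_id)
       (auto simp: ext_def)
  then show ?thesis by (simp add: length_concat sum_list_replicate map_replicate)
qed

text \<open>A function that is feasible on every small domain can be used like an elementary
  operation, since the image of a feasible function is small. This form lets the components of the
  algorithm be composed without describing their domains.\<close>

lemma feas_subst:
  assumes "\<And>D'. small D' \<Longrightarrow> feas D' g" "feas D f"
  shows "feas D (\<lambda>a. g (f a))"
  by (rule feas_comp[OF assms(2) assms(1)[OF feas_small_image[OF assms(2)]]]) auto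

lemma fold_const_funpow: "fold (\<lambda>_. h) xs = h ^^ length xs"
  by (induction xs) (auto simp: funpow_swap1)

lemma feas_funpow:
  fixes h :: "'a::encodable \<Rightarrow> 'b::encodable \<Rightarrow> 'b"
  assumes m: "feas D m" and x: "feas D x"
    and h: "\<And>D'. small D' \<Longrightarrow> feas D' (\<lambda>p. h (snd p) (fst p))"
    and bd: "fpt_bounded b" "\<And>k n a i. a \<in> D k n \<Longrightarrow> i \<le> m a \<Longrightarrow> tsize ((h a ^^ i) (x a)) \<le> b k n"
  shows "feas D (\<lambda>a. (h a ^^ m a) (x a))"
proof -
  have "feas D (\<lambda>a. fold (\<lambda>_ acc. h a acc) (replicate (m a) ()) (x a))"
  proof (rule feas_fold[where f = "\<lambda>_ acc a. h a acc" and xs = "\<lambda>a. replicate (m a) ()" and init = x])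
    show "small (\<lambda>k n. {fold (\<lambda>_ acc. h a acc) ys (x a) |a ys zs. a \<in> D k n \<and> replicate (m a) () = ys @ zs})"
    proof (rule smallI[OF bd(1)])
      fix k n y assume "y \<in> {fold (\<lambda>_ acc. h a acc) ys (x a) |a ys zs. a \<in> D k n \<and> replicate (m a) () = ys @ zs}"
      then obtain a ys zs where y: "y = (h a ^^ length ys) (x a)" "a \<in> D k n" "replicate (m a) () = ys @ zs"
        unfolding fold_const_funpow by blast
      have "length ys \<le> m a" using arg_cong[OF y(3), of length] by simp
      then show "tsize y \<le> b k n" using bd(2)[OF y(2)] y(1) by simp
    qed
    show "feas D' (\<lambda>p. h (snd (snd p)) (fst (snd p)))" if "small D'" for D'
    proof (rule feas_comp[where f = snd])
      show *: "feas D' snd" using feas_snd[OF feas_id[OF that]] by simp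
      show "feas (\<lambda>k n. snd ` D' k n) (\<lambda>p. h (snd p) (fst p))" by (intro h feas_small_image[OF *])
    qed auto
  qed (intro feas_replicate_unit m x)+
  then show ?thesis by (simp add: fold_const_funpow)
qed

lemma feas_funpow_shrink:
  fixes h :: "'b::encodable \<Rightarrow> 'b"
  assumes f: "feas D f" and g: "feas D g"
    and h: "\<And>D'. small D' \<Longrightarrow> feas D' h" and size: "\<And>x. tsize (h x) \<le> tsize x"
  shows "feas D (\<lambda>a. (h ^^ f a) (g a))"
proof -
  obtain b where b: "fpt_bounded b" "\<And>k n a. a \<in> D k n \<Longrightarrow> tsize (g a) \<le> b k n"
    using feas_size[OF g] by blast
  have le: "tsize ((h ^^ m) x) \<le> tsize x" for m x
  proof (induction m)
    case (Suc m)
    then show ?case using size[of "(h ^^ m) x"] by simp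
  qed simp
  show ?thesis
  proof (rule feas_funpow[where h = "\<lambda>_. h", OF f g _ b(1)])
    show "feas D' (\<lambda>p. h (fst p))" if "small D'" for D' :: "nat \<Rightarrow> nat \<Rightarrow> ('b \<times> 'a) set"
      by (rule feas_subst[OF _ feas_fst[OF feas_id[OF that]]]) (rule h)
  qed (rule order.trans[OF le b(2)])
qed

lemma feas_diff:
  assumes "feas D f" "feas D g"
  shows "feas D (\<lambda>a. f a - g a :: nat)"
proof -
  have "((\<lambda>x. x - Suc 0) ^^ m) x = x - m" for m x by (induction m) auto
  moreover have "feas D (\<lambda>a. ((\<lambda>x. x - Suc 0) ^^ g a) (f a))"
    by (intro feas_funpow_shrink assms feas_pred feas_id) auto
  ultimately show ?thesis by simp
qed

lemma feas_drop:
  assumes "feas D f" "feas D xs"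
  shows "feas D (\<lambda>a. drop (f a) (xs a))"
proof -
  have "(tl ^^ m) x = drop m x" for m and x :: "'b list" by (induction m) (auto simp: drop_Suc tl_drop)
  moreover have "feas D (\<lambda>a. (tl ^^ f a) (xs a))"
  proof (intro feas_funpow_shrink assms feas_tl feas_id)
    show "tsize (tl x) \<le> tsize x" for x :: "'b list" by (cases x) auto
  qed
  ultimately show ?thesis by simp
qed

lemma feas_eq_nat:
  assumes "feas D f" "feas D g"
  shows "feas D (\<lambda>a. f a = (g a :: nat))"
proof -
  have "feas D (\<lambda>a. replicate (f a - g a) () = [] \<and> replicate (g a - f a) () = [])"
    by (intro feas_conj feas_Nil_iff feas_replicate_unit feas_diff assms)
  then show ?thesis by (rule feas_cong) auto
qed

lemma feas_le_nat:
  assumes "feas D f" "feas D g"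
  shows "feas D (\<lambda>a. f a \<le> (g a :: nat))"
proof -
  have "feas D (\<lambda>a. replicate (f a - g a) () = [])"
    by (intro feas_Nil_iff feas_replicate_unit feas_diff assms)
  then show ?thesis by (rule feas_cong) auto
qed

lemma feas_eq_pair:
  assumes "feas D f" "feas D g"
  shows "feas D (\<lambda>a. f a = (g a :: nat \<times> nat))"
proof -
  have "feas D (\<lambda>a. fst (f a) = fst (g a) \<and> snd (f a) = snd (g a))"
    by (intro feas_conj feas_eq_nat feas_fst feas_snd assms)
  then show ?thesis by (simp add: prod_eq_iff)
qed

lemma feas_mod:
  assumes f: "feas D f" and g: "feas D g"
  shows "feas D (\<lambda>a. f a mod (g a :: nat))"
proof -
  \<comment> \<open>A counter that wraps around at \<open>m\<close>. For \<open>m = 0\<close> it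
    never does, in accordance with \<open>i mod 0 = i\<close>.\<close>
  let ?h = "\<lambda>m acc. if Suc acc = m then 0 else Suc acc"
  have *: "(?h m ^^ i) 0 = i mod m" for m i
    by (induction i) (auto simp: mod_Suc)
  have "feas D (\<lambda>a. fold (\<lambda>_ acc. ?h (g a) acc) (replicate (f a) ()) 0)"
  proof (rule feas_fold[where f = "\<lambda>x acc a. ?h (g a) acc" and xs = "\<lambda>a. replicate (f a) ()" and init = "\<lambda>_. 0"])
    show "small (\<lambda>k n. {fold (\<lambda>_ acc. ?h (g a) acc) ys 0 |a ys zs. a \<in> D k n \<and> replicate (f a) () = ys @ zs})"
    proof (rule small_fold_prefix[OF feas_replicate_unit[OF f]])
      fix a ys zs assume eq: "replicate (f a) () = ys @ zs"
      have "length ys mod g a \<le> length ys" by simp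
      also have "\<dots> \<le> tsize (replicate (f a) ())"
        using order.trans[OF length_le_tsize tsize_prefix, of ys zs] by (simp add: eq)
      finally show "tsize (fold (\<lambda>_ acc. ?h (g a) acc) ys 0) \<le> 2 * tsize (replicate (f a) ()) + 2"
        by (simp add: fold_const_funpow *)
    qed
    fix D' assume D': "D' = (\<lambda>k n. {(x, fold (\<lambda>_ acc. ?h (g a) acc) ys 0, a) |a ys x zs.
          a \<in> D k n \<and> replicate (f a) () = ys @ x # zs})" "small D'"
    have g': "feas D' (\<lambda>p. g (snd (snd p)))"
    proof (rule feas_comp[OF _ g])
      show "feas D' (\<lambda>p. snd (snd p))" by (intro feas_snd feas_id D'(2))
    qed (auto simp: D'(1))
    show "feas D' (\<lambda>p. ?h (g (snd (snd p))) (fst (snd p)))"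
      by (intro feas_if' feas_const feas_eq_nat feas_Suc feas_fst feas_snd feas_id D' g')
  qed (intro feas_replicate_unit f feas_const feas_small[OF f])+
  then show ?thesis by (simp add: fold_const_funpow *)
qed

lemma feas_upt:
  assumes f: "feas D f" and g: "feas D g"
  shows "feas D (\<lambda>a. [f a..<g a])"
proof -
  \<comment> \<open>The length of the list built so far serves as the counter.\<close>
  have *: "fold (\<lambda>x acc. length acc # acc) ys [] = rev [0..<length ys]" for ys :: "unit list"
    by (induction ys rule: rev_induct) auto
  have "feas D (\<lambda>a. fold (\<lambda>x acc. length acc # acc) (replicate (g a) ()) [])"
  proof (rule feas_fold[where f = "\<lambda>x acc a. length acc # acc" and xs = "\<lambda>a. replicate (g a) ()" and init = "\<lambda>_. []"])
    obtain b where b: "fpt_bounded b" "\<And>k n a. a \<in> D k n \<Longrightarrow> tsize (g a) \<le> b k n"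
      using feas_size[OF g] by blast
    show "small (\<lambda>k n. {fold (\<lambda>x acc. length acc # acc) ys [] |a ys zs. a \<in> D k n \<and> replicate (g a) () = ys @ zs})"
    proof (rule smallI)
      show "fpt_bounded (\<lambda>k n. 1 + b k n * (1 + b k n))" using b by (intro fb_intros)
      fix k n x assume "x \<in> {fold (\<lambda>x acc. length acc # acc) ys [] |a ys zs. a \<in> D k n \<and> replicate (g a) () = ys @ zs}"
      then obtain a ys zs where x: "x = rev [0..<length ys]" "a \<in> D k n" "replicate (g a) () = ys @ zs"
        unfolding * by blast
      have len: "length ys \<le> g a" using arg_cong[OF x(3), of length] by simp
      have "tsize x \<le> 1 + length x * (1 + b k n)"
        by (rule tsize_list_le) (use b(2)[OF x(2)] len in \<open>auto simp: x(1)\<close>)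
      also have "\<dots> \<le> 1 + b k n * (1 + b k n)"
        using b(2)[OF x(2)] len by (intro add_left_mono mult_right_mono) (auto simp: x(1))
      finally show "tsize x \<le> 1 + b k n * (1 + b k n)" .
    qed
  qed (intro feas_Cons feas_length feas_fst feas_snd feas_id feas_const feas_replicate_unit g feas_small[OF g] | assumption)+
  from feas_drop[OF f feas_rev[OF this[unfolded *]]] show ?thesis by (simp add: drop_upt)
qed

lemma tsize_bool: "tsize (b :: bool) \<le> 3"
  by (cases b) auto

lemma feas_takeWhile:
  assumes xs: "feas D xs" and f: "small (ext D xs) \<Longrightarrow> feas (ext D xs) (\<lambda>p. f (fst p) (snd p))"
  shows "feas D (\<lambda>a. takeWhile (\<lambda>x. f x a) (xs a))"
proof -
  note f = f[OF small_ext[OF xs]]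
  \<comment> \<open>A fold cannot stop early; the flag remembers whether all elements so far
    satisfied the predicate.\<close>
  let ?h = "\<lambda>x (acc :: bool \<times> 'b list) a. if fst acc \<and> f x a then (True, x # snd acc) else (False, snd acc)"
  have *: "fold (\<lambda>x acc. ?h x acc a) ys (True, []) = (\<forall>x\<in>set ys. f x a, rev (takeWhile (\<lambda>x. f x a) ys))" for a ys
    by (induction ys rule: rev_induct) (auto simp: takeWhile_append)
  have "feas D (\<lambda>a. fold (\<lambda>x acc. ?h x acc a) (xs a) (True, []))"
  proof (rule feas_fold[where f = ?h and init = "\<lambda>_. (True, [])"])
    show "small (\<lambda>k n. {fold (\<lambda>x acc. ?h x acc a) ys (True, []) |a ys zs. a \<in> D k n \<and> xs a = ys @ zs})"
    proof (rule small_fold_prefix[OF xs])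
      fix a ys zs assume xs: "xs a = ys @ zs"
      have "tsize (takeWhile P ys) \<le> tsize ys" for P by (induction ys) auto
      then have "tsize (takeWhile (\<lambda>x. f x a) ys) \<le> tsize (xs a)"
        using order.trans[OF _ tsize_prefix, of _ ys zs] unfolding xs by blast
      moreover have "tsize (\<forall>x\<in>set ys. f x a) \<le> 3" by (rule tsize_bool)
      ultimately show "tsize (fold (\<lambda>x acc. ?h x acc a) ys (True, [])) \<le> 4 * tsize (xs a) + 4"
        unfolding * by simp
    qed
    fix D' assume D': "D' = (\<lambda>k n. {(x, fold (\<lambda>x acc. ?h x acc a) ys (True, []), a) |a ys x zs.
          a \<in> D k n \<and> xs a = ys @ x # zs})" "small D'"
    have "feas D' (\<lambda>p. f (fst p) (snd (snd p)))"
      by (rule feas_ext_body[OF f D'(2)]) (auto simp: D'(1))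
    then show "feas D' (\<lambda>p. ?h (fst p) (fst (snd p)) (snd (snd p)))"
      by (intro feas_if' feas_conj feas_Pair feas_Cons feas_const feas_fst feas_snd feas_id D')
  qed (intro feas_const xs feas_small[OF xs])+
  from feas_rev[OF feas_snd[OF this]] show ?thesis by (simp add: *)
qed

text \<open>In unary the result is as large as its value, so that value must be bounded in advance;
  a bound on the size of \<open>f a\<close> would not do.\<close>

lemma feas_power2:
  assumes f: "feas D f" and bd: "fpt_bounded b" "\<And>k n a. a \<in> D k n \<Longrightarrow> 2 ^ f a \<le> b k n"
  shows "feas D (\<lambda>a. 2 ^ f a :: nat)"
proof -
  have *: "((\<lambda>x::nat. x + x) ^^ i) 1 = 2 ^ i" for i by (induction i) auto
  have "feas D (\<lambda>a. fold (\<lambda>_ x. x + x) (replicate (f a) ()) (1::nat))"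
  proof (rule feas_fold[where f = "\<lambda>_ x a. x + x" and xs = "\<lambda>a. replicate (f a) ()" and init = "\<lambda>_. 1"])
    show "small (\<lambda>k n. {fold (\<lambda>_ x. x + x) ys (1::nat) |a ys zs. a \<in> D k n \<and> replicate (f a) () = ys @ zs})"
    proof (rule smallI)
      show "fpt_bounded (\<lambda>k n. 2 * b k n + 1)" using bd by (intro fb_intros)
      fix k n x assume "x \<in> {fold (\<lambda>_ x. x + x) ys (1::nat) |a ys zs. a \<in> D k n \<and> replicate (f a) () = ys @ zs}"
      then obtain a ys zs where x: "x = 2 ^ length ys" "a \<in> D k n" "replicate (f a) () = ys @ zs"
        unfolding fold_const_funpow * by blast
      have "length ys \<le> f a" using arg_cong[OF x(3), of length] by simp
      then have "x \<le> 2 ^ f a" by (simp add: x(1))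
      with bd(2)[OF x(2)] show "tsize x \<le> 2 * b k n + 1" by simp
    qed
  qed (intro feas_add feas_fst feas_snd feas_id feas_const feas_replicate_unit f feas_small[OF f] | assumption)+
  then show ?thesis unfolding fold_const_funpow * by simp
qed

lemmas feas_intros =
  feas_id feas_fst feas_snd feas_const feas_Pair feas_Cons feas_tl feas_hd feas_Suc feas_Nil_iff
  feas_if' feas_rev feas_map feas_filter feas_not feas_conj feas_disj feas_imp feas_bex feas_ball
  feas_append feas_concat feas_length feas_add feas_mult feas_diff feas_drop feas_eq_nat feas_le_nat
  feas_eq_pair feas_mod feas_upt feas_takeWhile

lemma feas_subst2:
  assumes "\<And>D'. small D' \<Longrightarrow> feas D' (\<lambda>p. h (fst p) (snd p))" "feas D f" "feas D g"
  shows "feas D (\<lambda>a. h (f a) (g a))"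
  using feas_subst[OF assms(1) feas_Pair[OF assms(2,3)]] by simp

lemma feas_subst3:
  assumes "\<And>D'. small D' \<Longrightarrow> feas D' (\<lambda>p. h (fst p) (fst (snd p)) (snd (snd p)))"
    "feas D f" "feas D g" "feas D g'"
  shows "feas D (\<lambda>a. h (f a) (g a) (g' a))"
  using feas_subst[OF assms(1) feas_Pair[OF assms(2) feas_Pair[OF assms(3,4)]]] by simp

lemma feas_ext_snd:
  assumes "feas D g" "small (ext D xs)"
  shows "feas (ext D xs) (\<lambda>p. g (snd p))"
  by (rule feas_comp[OF feas_snd[OF feas_id[OF assms(2)]] assms(1)]) (auto simp: ext_def)

section \<open>Avoiding residue classes\<close>

text \<open>The sequence satisfies the linear recurrence whose characteristic polynomial
  \<open>P\<close> is the product of all \<open>X - z j\<close>. As \<open>P\<close> is monic of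
  degree \<open>card J\<close>, each term is determined by the \<open>card J\<close> terms before
  it, and zeros propagate. Repetitions among the \<open>z j\<close> are allowed, which matters
  because the products in \<open>residue_classes_avoid\<close> may coincide.\<close>

lemma exponential_sum_zero:
  fixes c z :: "'i \<Rightarrow> complex"
  assumes fin: "finite J" and zero: "\<And>x. x < card J \<Longrightarrow> (\<Sum>j\<in>J. c j * z j ^ x) = 0"
  shows "(\<Sum>j\<in>J. c j * z j ^ x) = 0"
proof -
  define P where "P = (\<Prod>j\<in>J. [:- z j, 1:])"
  let ?f = "\<lambda>x. \<Sum>j\<in>J. c j * z j ^ x"
  have "lead_coeff P = 1" by (simp add: P_def lead_coeff_prod)
  moreover have deg: "degree P = card J" unfolding P_def by (simp add: degree_linear_power degree_prod_eq_sum_degree)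
  ultimately have lead: "coeff P (card J) = 1" by simp
  have rec: "(\<Sum>i\<le>card J. coeff P i * ?f (y + i)) = 0" for y
  proof -
    have "(\<Sum>i\<le>card J. coeff P i * ?f (y + i)) = (\<Sum>j\<in>J. c j * z j ^ y * (\<Sum>i\<le>card J. coeff P i * z j ^ i))"
      unfolding sum_distrib_left by (subst sum.swap) (simp add: power_add mult_ac)
    also have "\<dots> = (\<Sum>j\<in>J. c j * z j ^ y * poly P (z j))" by (simp add: poly_altdef deg)
    also have "\<dots> = 0"
      unfolding P_def poly_prod using fin by (intro sum.neutral ballI) (auto intro!: prod_zero)
    finally show ?thesis .
  qed
  show ?thesis
  proof (induction x rule: less_induct)
    case (less x)
    show ?case
    proof (cases "x < card J")
      case False
      then obtain y where x: "x = y + card J" by (metis le_add_diff_inverse2 not_less)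
      have "0 = (\<Sum>i<card J. coeff P i * ?f (y + i)) + coeff P (card J) * ?f (y + card J)"
        using rec[of y] by (simp add: lessThan_Suc_atMost[symmetric])
      also have "(\<Sum>i<card J. coeff P i * ?f (y + i)) = 0"
        by (intro sum.neutral ballI) (use less x in auto)
      finally show ?thesis using lead x by simp
    qed (use zero in simp)
  qed
qed

lemma cis_eq_1_iff: "cis y = 1 \<longleftrightarrow> (\<exists>i::int. y = 2 * pi * i)"
proof -
  have "cis y = 1 \<longleftrightarrow> cos y = 1" using cos_one_sin_zero[of y] by (auto simp: complex_eq_iff)
  then show ?thesis unfolding cos_one_2pi_int by (simp add: mult_ac)
qed

lemma cis_power_eq_iff:
  fixes x a m :: nat
  assumes "0 < m"
  shows "cis (2 * pi / m) ^ x = cis (2 * pi * a / m) \<longleftrightarrow> x mod m = a mod m"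
proof -
  have "cis (2 * pi / m) ^ x = cis (2 * pi * x / m)" by (simp add: DeMoivre mult_ac)
  also have "\<dots> = cis (2 * pi * a / m) \<longleftrightarrow> cis (2 * pi * x / m - 2 * pi * a / m) = 1"
    by (simp add: cis_divide[symmetric])
  also have "\<dots> \<longleftrightarrow> (\<exists>i::int. 2 * pi * x / m - 2 * pi * a / m = 2 * pi * i)"
    by (rule cis_eq_1_iff)
  also have "\<dots> \<longleftrightarrow> (\<exists>i::int. real x - real a = i * m)"
  proof -
    have "2 * pi * x / m - 2 * pi * a / m = 2 * pi * i \<longleftrightarrow> real x - real a = i * m" for i :: int
    proof -
      have "2 * pi * x / m - 2 * pi * a / m = 2 * pi * ((real x - real a) / m)"
        by (simp add: diff_divide_distrib right_diff_distrib)
      moreover have "(real x - real a) / m = i \<longleftrightarrow> real x - real a = i * m"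
        using assms by (simp add: divide_eq_eq)
      moreover have "2 * pi * q = 2 * pi * i \<longleftrightarrow> q = i" for q by simp
      ultimately show ?thesis by (simp only:)
    qed
    then show ?thesis by simp
  qed
  also have "\<dots> \<longleftrightarrow> (\<exists>i::int. int x - int a = i * int m)"
    by (metis (mono_tags, opaque_lifting) of_int_diff of_int_eq_iff of_int_mult of_int_of_nat_eq)
  also have "\<dots> \<longleftrightarrow> int m dvd int x - int a" by (auto simp: dvd_def mult.commute)
  also have "\<dots> \<longleftrightarrow> x mod m = a mod m"
    by (metis mod_eq_dvd_iff of_nat_eq_iff of_nat_mod)
  finally show ?thesis .
qed

text \<open>Due to Crittenden and Vanden Eynden.  The product over the residue classes of
  \<open>1 - cis (2 * pi * (x - r i) / m i)\<close> vanishes exactly on their union, and it is a sum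
  of \<open>2 ^ N\<close> exponentials.\<close>

lemma residue_classes_avoid:
  fixes m r :: "'i \<Rightarrow> nat"
  assumes fin: "finite I" and pos: "\<And>i. i \<in> I \<Longrightarrow> 0 < m i"
    and t: "\<And>i. i \<in> I \<Longrightarrow> t mod m i \<noteq> r i mod m i"
  shows "\<exists>s < 2 ^ card I. \<forall>i\<in>I. s mod m i \<noteq> r i mod m i"
proof (rule ccontr)
  assume contra: "\<not> ?thesis"
  define w where "w i = cis (2 * pi / m i)" for i
  define u where "u i = inverse (cis (2 * pi * r i / m i))" for i
  define f where "f x = (\<Prod>i\<in>I. 1 + - (u i * w i ^ x))" for x
  have f0: "f x = 0 \<longleftrightarrow> (\<exists>i\<in>I. x mod m i = r i mod m i)" for x
  proof -
    have "1 + - (u i * w i ^ x) = 0 \<longleftrightarrow> x mod m i = r i mod m i" if "i \<in> I" for i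
    proof -
      have "1 + - (u i * w i ^ x) = 0 \<longleftrightarrow> w i ^ x = cis (2 * pi * r i / m i)"
        unfolding u_def by (auto simp: field_simps eq_neg_iff_add_eq_0)
      then show ?thesis unfolding w_def using cis_power_eq_iff[OF pos[OF that]] by simp
    qed
    then show ?thesis unfolding f_def using fin by auto
  qed
  have f: "f x = (\<Sum>S\<in>Pow I. (\<Prod>i\<in>I - S. - u i) * (\<Prod>i\<in>I - S. w i) ^ x)" for x
  proof -
    have "f x = (\<Sum>S\<in>Pow I. (\<Prod>i\<in>S. 1) * (\<Prod>i\<in>I - S. - (u i * w i ^ x)))"
      unfolding f_def by (rule prod_add[OF fin])
    also have "\<dots> = (\<Sum>S\<in>Pow I. (\<Prod>i\<in>I - S. - u i) * (\<Prod>i\<in>I - S. w i) ^ x)"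
      by (intro sum.cong refl) (simp add: prod.distrib[symmetric] prod_power_distrib)
    finally show ?thesis .
  qed
  \<comment> \<open>If every \<open>s\<close> below \<open>2 ^ card I\<close> lies in one of the
    classes, \<open>f\<close> vanishes there and hence everywhere, although \<open>t\<close> lies in
    none of them.\<close>
  have "f t = 0" unfolding f
  proof (rule exponential_sum_zero)
    show "finite (Pow I)" using fin by simp
    fix x assume "x < card (Pow I)"
    then have "x < 2 ^ card I" by (simp add: card_Pow[OF fin])
    with contra have "f x = 0" unfolding f0 by blast
    then show "(\<Sum>S\<in>Pow I. (\<Prod>i\<in>I - S. - u i) * (\<Prod>i\<in>I - S. w i) ^ x) = 0" by (simp only: f)
  qed
  with f0 t show False by blast
qed

section \<open>The snapshots of a periodic graph\<close>

text \<open>Composed of \<open>hd\<close>, \<open>drop\<close>, \<open>mod\<close> and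
  \<open>length\<close>, whose feasibility is established, instead of using
  \<open>!\<close>.\<close>

definition entry :: "nat \<Rightarrow> 'x list \<Rightarrow> 'x" where
  "entry t l = hd (drop (t mod length l) l)"

lemma entry_nth: "l \<noteq> [] \<Longrightarrow> entry t l = l ! (t mod length l)"
  by (simp add: entry_def hd_drop_conv_nth)

lemma entry_cong: "t mod length l = t' mod length l \<Longrightarrow> entry t l = entry t' l"
  by (simp add: entry_def)

lemma entry_in_set: "l \<noteq> [] \<Longrightarrow> entry t l \<in> set l"
  by (simp add: entry_nth)

text \<open>The label \<open>s \<mapsto> l (a + m * s)\<close>, written out over its least period.  This keeps the number of
  occurrences of each value from growing.\<close>

definition subsample :: "nat \<Rightarrow> nat \<Rightarrow> 'x list \<Rightarrow> 'x list" where
  "subsample a m l = map (\<lambda>i. entry (a + m * i) l) (0 # takeWhile (\<lambda>i. \<not> (m * i) mod length l = 0) [1..<length l])"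

lemma takeWhile_upt:
  assumes "a \<le> p" "p \<le> b" "\<And>i. a \<le> i \<Longrightarrow> i < p \<Longrightarrow> Q i" "p < b \<Longrightarrow> \<not> Q p"
  shows "takeWhile Q [a..<b] = [a..<p]"
proof -
  have "[a..<b] = [a..<p] @ [p..<b]" using assms(1,2) upt_add_eq_append[of a p "b - p"] by simp
  moreover have "takeWhile Q [p..<b] = []" using assms(4) by (cases "p < b") (auto simp: upt_conv_Cons)
  moreover have "takeWhile Q ([a..<p] @ [p..<b]) = [a..<p] @ takeWhile Q [p..<b]"
    by (rule takeWhile_append2) (use assms(3) in auto)
  ultimately show ?thesis by simp
qed

text \<open>\<open>p\<close> is the additive order of \<open>m\<close> modulo
  \<open>length l\<close>, so it is at most \<open>length l\<close>. In \<open>subsample\<close> the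
  index 0 is put in front by hand, because it would end the \<open>takeWhile\<close> at
  once.\<close>

lemma subsample_period:
  assumes "l \<noteq> []"
  obtains p where "0 < p" "subsample a m l = map (\<lambda>i. entry (a + m * i) l) [0..<p]"
    "(m * p) mod length l = 0" "\<And>i. 0 < i \<Longrightarrow> i < p \<Longrightarrow> (m * i) mod length l \<noteq> 0"
proof
  let ?P = "\<lambda>p. 0 < p \<and> (m * p) mod length l = 0"
  define p where "p = (LEAST p. ?P p)"
  have L: "?P (length l)" using assms by simp
  then have p: "?P p" unfolding p_def by (rule LeastI[of ?P])
  have le: "p \<le> length l" unfolding p_def by (rule Least_le[of ?P, OF L])
  show least: "(m * i) mod length l \<noteq> 0" if "0 < i" "i < p" for i
    using that not_less_Least[of i ?P] unfolding p_def by simp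
  show "0 < p" "(m * p) mod length l = 0" using p by auto
  have "takeWhile (\<lambda>i. \<not> (m * i) mod length l = 0) [1..<length l] = [1..<p]"
    by (rule takeWhile_upt) (use p le least in auto)
  then show "subsample a m l = map (\<lambda>i. entry (a + m * i) l) [0..<p]"
    unfolding subsample_def using p by (simp add: upt_conv_Cons)
qed

lemma subsample_nonempty [simp]: "subsample a m l \<noteq> []"
  by (simp add: subsample_def)

lemma set_subsample: "l \<noteq> [] \<Longrightarrow> set (subsample a m l) \<subseteq> set l"
  unfolding subsample_def using entry_in_set[of l] by auto

lemma entry_subsample:
  assumes "l \<noteq> []"
  shows "entry s (subsample a m l) = entry (a + m * s) l"
proof -
  obtain p where p: "0 < p" "subsample a m l = map (\<lambda>i. entry (a + m * i) l) [0..<p]" "(m * p) mod length l = 0"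
    using subsample_period[OF assms] by metis
  have "entry s (subsample a m l) = entry (a + m * (s mod p)) l"
    using p(1) by (subst entry_nth) (auto simp: p(2))
  also have "\<dots> = entry (a + m * s) l"
  proof (rule entry_cong)
    have "m * s = (m * p) * (s div p) + m * (s mod p)"
      by (metis add_mult_distrib2 mult.assoc mult_div_mod_eq)
    moreover obtain c where "m * p = length l * c" using p(3) by auto
    ultimately have "a + m * s = a + m * (s mod p) + length l * (c * (s div p))" by simp
    then show "(a + m * (s mod p)) mod length l = (a + m * s) mod length l" by (simp only: mod_mult_self2)
  qed
  finally show ?thesis .
qed

text \<open>Within one least period the positions \<open>a + m * i\<close> are pairwise distinct
  modulo \<open>length l\<close>, so the entries of the new label map injectively to entries of
  \<open>l\<close>.\<close>

lemma length_filter_subsample: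
  assumes "l \<noteq> []"
  shows "length (filter P (subsample a m l)) \<le> length (filter P l)"
proof -
  let ?L = "length l"
  obtain p where p: "0 < p" "subsample a m l = map (\<lambda>i. entry (a + m * i) l) [0..<p]"
    and least: "\<And>i. 0 < i \<Longrightarrow> i < p \<Longrightarrow> (m * i) mod ?L \<noteq> 0"
    using subsample_period[OF assms] by metis
  have "length (filter P (subsample a m l)) = card {i. i < p \<and> P (entry (a + m * i) l)}"
    unfolding length_filter_conv_card p(2) by (intro arg_cong[where f = card]) auto
  also have "\<dots> \<le> card {j. j < ?L \<and> P (l ! j)}"
  proof (rule card_inj_on_le[where f = "\<lambda>i. (a + m * i) mod ?L"])
    have *: "i = j" if "i \<le> j" "j < p" "(a + m * i) mod ?L = (a + m * j) mod ?L" for i j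
    proof (rule ccontr)
      assume "i \<noteq> j"
      have "a + m * i \<le> a + m * j" using that(1) by simp
      from mod_eq_dvd_iff_nat[OF this, of ?L] that(3) have "?L dvd (a + m * j) - (a + m * i)" by simp
      also have "(a + m * j) - (a + m * i) = m * (j - i)" by (simp add: right_diff_distrib')
      finally have "m * (j - i) mod ?L = 0" by simp
      moreover have "0 < j - i" "j - i < p" using \<open>i \<noteq> j\<close> that by auto
      note least[OF this]
      ultimately show False by (rule notE[rotated])
    qed
    then have "i = j" if "i < p" "j < p" "(a + m * i) mod ?L = (a + m * j) mod ?L" for i j
    proof (cases "i \<le> j")
      case True
      then show ?thesis by (rule *[OF _ that(2,3)])
    next
      case False
      then show ?thesis using *[OF _ that(1) that(3)[symmetric]] by linarith
    qed
    then show "inj_on (\<lambda>i. (a + m * i) mod ?L) {i. i < p \<and> P (entry (a + m * i) l)}"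
      by (auto simp: inj_on_def)
  qed (use assms in \<open>auto simp: entry_nth\<close>)
  also have "\<dots> = length (filter P l)" by (simp add: length_filter_conv_card)
  finally show ?thesis .
qed

lemma length_subsample_le: "l \<noteq> [] \<Longrightarrow> length (subsample a m l) \<le> length l"
  using length_filter_subsample[of l "\<lambda>_. True" a m] by simp

text \<open>Used twice: with \<open>m = length l\<close> it says that the edge to which a
  restriction belongs becomes constant, and with \<open>length l = 1\<close> that a constant edge
  stays constant.\<close>

lemma length_subsample_dvd:
  assumes "l \<noteq> []" "length l dvd m"
  shows "length (subsample a m l) = 1"
proof -
  obtain p where p: "0 < p" "subsample a m l = map (\<lambda>i. entry (a + m * i) l) [0..<p]"
    and least: "\<And>i. 0 < i \<Longrightarrow> i < p \<Longrightarrow> (m * i) mod length l \<noteq> 0"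
    using subsample_period[OF assms(1)] by metis
  have "p = 1" using least[of 1] p(1) assms(2) by (cases "p = 1") auto
  then show ?thesis by (simp add: p(2))
qed

text \<open>Each label entry is a pair of the value and a mark, where the marks single out the occurrences of
  the value that is less frequent in the label.  A search state is a list of edges with such labels.\<close>

type_synonym search_state = "((nat \<times> nat) \<times> (bool \<times> bool) list) list"

definition mark_minority :: "bool list \<Rightarrow> (bool \<times> bool) list" where
  "mark_minority l = (if length (filter (\<lambda>v. v) l) \<le> length (filter (\<lambda>v. \<not> v) l)
     then map (\<lambda>v. (v, v)) l else map (\<lambda>v. (v, \<not> v)) l)"

text \<open>\<open>b\<close> is the minority value of the label: an entry equals \<open>b\<close>
  iff it is marked. In particular all unmarked entries of a label have the same value.\<close>

definition well_marked :: "search_state \<Rightarrow> bool" where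
  "well_marked st \<longleftrightarrow> (\<forall>e\<in>set st. snd e \<noteq> [] \<and> (\<exists>b. \<forall>x\<in>set (snd e). fst x = (snd x = b)))"

definition marks :: "search_state \<Rightarrow> nat" where
  "marks st = length (filter (\<lambda>x. snd x) (concat (map (\<lambda>e. snd e) st)))"

definition pattern :: "nat \<Rightarrow> search_state \<Rightarrow> ((nat \<times> nat) \<times> bool) list" where
  "pattern t st = map (\<lambda>e. (fst e, fst (entry t (snd e)))) st"

definition restrict :: "nat \<Rightarrow> nat \<Rightarrow> search_state \<Rightarrow> search_state" where
  "restrict a m st = map (\<lambda>e. (fst e, subsample a m (snd e))) st"

text \<open>Either the edge with label \<open>l\<close> is guessed to have its majority value, which is not enforced, or
  the time is restricted to the residue class of one of the marked positions.\<close>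

definition branch :: "(bool \<times> bool) list \<Rightarrow> search_state \<Rightarrow> search_state list" where
  "branch l st = st # map (\<lambda>a. restrict a (length l) st) (filter (\<lambda>a. snd (entry a l)) [0..<length l])"

definition expand :: "nat \<Rightarrow> search_state list \<Rightarrow> search_state list" where
  "expand i sts = concat (map (\<lambda>st. branch (snd (hd (drop i st))) st) sts)"

definition frontier :: "search_state \<Rightarrow> nat list \<Rightarrow> search_state list" where
  "frontier st is = fold expand is [st]"

text \<open>The exponent counts the marks of the initial state for all \<open>st'\<close> alike.
  This is enough because marks never increase (\<open>descends_marks\<close>), and the number
  depends on the parameter only.\<close>

definition patterns :: "search_state \<Rightarrow> ((nat \<times> nat) \<times> bool) list list" where
  "patterns st = concat (map (\<lambda>st'. map (\<lambda>s. pattern s st') [0..<2 ^ marks st]) (frontier st [0..<length st]))"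

lemma frontier_Nil [simp]: "frontier st [] = [st]"
  by (simp add: frontier_def)

lemma frontier_snoc: "frontier st (is @ [i]) = expand i (frontier st is)"
  by (simp add: frontier_def)

lemma pattern_restrict:
  assumes "well_marked st"
  shows "pattern s (restrict a m st) = pattern (a + m * s) st"
  using assms by (auto simp: pattern_def restrict_def entry_subsample well_marked_def)

lemma well_marked_restrict:
  assumes "well_marked st"
  shows "well_marked (restrict a m st)"
  unfolding well_marked_def restrict_def
proof (simp, intro ballI)
  fix e assume e: "e \<in> set st"
  with assms have "snd e \<noteq> []" by (auto simp: well_marked_def)
  note sub = subsetD[OF set_subsample[OF this, of a m]]
  obtain b where "\<forall>x\<in>set (snd e). fst x = (snd x = b)" using assms e unfolding well_marked_def by blast
  then show "\<exists>b. \<forall>x\<in>set (subsample a m (snd e)). fst x = (snd x = b)"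
    by (intro exI[of _ b] ballI) (drule sub, simp)
qed

lemma marks_sum: "marks st = (\<Sum>e\<leftarrow>st. length (filter snd (snd e)))"
  by (induction st) (auto simp: marks_def)

lemma in_branch:
  assumes "st' \<in> set (branch l st)"
  obtains "st' = st" | a where "st' = restrict a (length l) st"
  using assms unfolding branch_def by auto

text \<open>The invariant of the search: \<open>st'\<close> shows only patterns of
  \<open>st\<close>, which is soundness, and no label has become longer or gained marks, which gives
  the size bounds.\<close>

definition descends :: "search_state \<Rightarrow> search_state \<Rightarrow> bool" where
  "descends st st' \<longleftrightarrow> well_marked st' \<and> (\<forall>s. \<exists>t. pattern s st' = pattern t st) \<and>
     list_all2 (\<lambda>e e'. fst e' = fst e \<and> length (snd e') \<le> length (snd e) \<and>
       length (filter snd (snd e')) \<le> length (filter snd (snd e))) st st'"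

lemma descends_refl: "well_marked st \<Longrightarrow> descends st st"
  unfolding descends_def by (auto simp: list_all2_refl)

lemma descends_restrict:
  assumes "descends st st'"
  shows "descends st (restrict a m st')"
proof -
  have "list_all2 (\<lambda>e e'. fst e' = fst e \<and> length (snd e') \<le> length (snd e) \<and>
       length (filter snd (snd e')) \<le> length (filter snd (snd e))) st (restrict a m st')"
    unfolding restrict_def list_all2_conv_all_nth
  proof (intro conjI allI impI)
    have *: "list_all2 (\<lambda>e e'. fst e' = fst e \<and> length (snd e') \<le> length (snd e) \<and>
       length (filter snd (snd e')) \<le> length (filter snd (snd e))) st st'"
      using assms by (simp add: descends_def)
    then show len: "length st = length (map (\<lambda>e. (fst e, subsample a m (snd e))) st')"
      by (simp add: list_all2_lengthD)
    fix i assume i: "i < length st"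
    with len have "st' ! i \<in> set st'" by simp
    with assms have "snd (st' ! i) \<noteq> []" by (simp add: descends_def well_marked_def)
    with list_all2_nthD[OF * i] i len show
      "fst (map (\<lambda>e. (fst e, subsample a m (snd e))) st' ! i) = fst (st ! i)"
      "length (snd (map (\<lambda>e. (fst e, subsample a m (snd e))) st' ! i)) \<le> length (snd (st ! i))"
      "length (filter snd (snd (map (\<lambda>e. (fst e, subsample a m (snd e))) st' ! i))) \<le> length (filter snd (snd (st ! i)))"
      by (auto intro: order.trans[OF length_subsample_le] order.trans[OF length_filter_subsample])
  qed
  then show ?thesis using assms unfolding descends_def
    by (simp add: well_marked_restrict pattern_restrict)
qed

lemma descends_frontier:
  assumes "well_marked st" "st' \<in> set (frontier st is)"
  shows "descends st st'"
  using assms(2)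
proof (induction "is" arbitrary: st' rule: rev_induct)
  case Nil
  then show ?case using descends_refl[OF assms(1)] by simp
next
  case (snoc i "is")
  then obtain st1 where st1: "st1 \<in> set (frontier st is)" "st' \<in> set (branch (snd (hd (drop i st1))) st1)"
    by (auto simp: frontier_snoc expand_def)
  from st1(2) snoc.IH[OF st1(1)] show ?case by (elim in_branch) (auto intro: descends_restrict)
qed

lemma descends_marks:
  assumes "descends st st'"
  shows "marks st' \<le> marks st"
proof -
  have "list_all2 (\<lambda>e e'. length (filter snd (snd e')) \<le> length (filter snd (snd e))) st st'"
    using assms unfolding descends_def by (auto elim: list_all2_mono)
  then show ?thesis unfolding marks_sum by induction auto
qed

text \<open>The label of an edge has length 1 once the time has been restricted to one of its marked positions.\<close>

definition settled :: "nat \<Rightarrow> (bool \<times> bool) list \<Rightarrow> bool" where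
  "settled s l \<longleftrightarrow> (snd (entry s l) \<longrightarrow> length l = 1)"

text \<open>The guesses follow the given time. If label \<open>j\<close> shows a marked entry at the
  current time \<open>s\<close>, the branch for the position \<open>s mod length l\<close> is taken
  and the time becomes \<open>s div length l\<close>; otherwise the state is kept. Every label shows
  the same entry before and after this change of time, so edges settled earlier remain
  settled.\<close>

lemma frontier_complete:
  assumes "well_marked st" "j \<le> length st"
  shows "\<exists>st'\<in>set (frontier st [0..<j]). \<exists>s. pattern s st' = pattern t st \<and> (\<forall>i<j. settled s (snd (st' ! i)))"
  using assms(2)
proof (induction j)
  case (Suc j)
  then obtain st1 s where st1: "st1 \<in> set (frontier st [0..<j])" "pattern s st1 = pattern t st"
    and settled: "\<And>i. i < j \<Longrightarrow> settled s (snd (st1 ! i))" by auto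
  have desc: "descends st st1" by (rule descends_frontier[OF assms(1) st1(1)])
  then have len: "length st1 = length st" unfolding descends_def by (auto dest: list_all2_lengthD)
  have wm: "well_marked st1" using desc by (simp add: descends_def)
  define l where "l = snd (st1 ! j)"
  have ne: "snd (st1 ! i) \<noteq> []" if "i < length st" for i using wm that len by (simp add: well_marked_def)
  have l: "l \<noteq> []" using ne[of j] Suc.prems by (simp add: l_def)
  have sub: "set (branch l st1) \<subseteq> set (frontier st [0..<Suc j])"
    using st1(1) Suc.prems len by (auto simp: frontier_snoc expand_def l_def hd_drop_conv_nth)
  show ?case
  proof (cases "snd (entry s l)")
    case False
    then have "settled s l" by (simp add: settled_def)
    then have "\<forall>i<Suc j. settled s (snd (st1 ! i))" using settled by (auto simp: less_Suc_eq l_def)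
    moreover have "st1 \<in> set (frontier st [0..<Suc j])" using sub by (auto simp: branch_def)
    ultimately show ?thesis using st1(2) by blast
  next
    case True
    define a where "a = s mod length l"
    define st2 where "st2 = restrict a (length l) st1"
    define q where "q = s div length l"
    have s: "a + length l * q = s" by (simp add: a_def q_def)
    have "a < length l" using l by (simp add: a_def)
    moreover have "entry a l = entry s l" by (rule entry_cong) (simp add: a_def)
    ultimately have "st2 \<in> set (branch l st1)" using True by (simp add: branch_def st2_def)
    moreover have "pattern q st2 = pattern t st"
      using pattern_restrict[OF wm] st1(2) s by (simp add: st2_def)
    moreover have "settled q (snd (st2 ! i))" if i: "i < Suc j" for i
    proof -
      have nth: "snd (st2 ! i) = subsample a (length l) (snd (st1 ! i))"
        using i Suc.prems len by (simp add: st2_def restrict_def)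
      have nei: "snd (st1 ! i) \<noteq> []" using ne i Suc.prems by simp
      have "length (snd (st2 ! i)) = 1" if "snd (entry q (snd (st2 ! i)))"
      proof (cases "i = j")
        case True
        then show ?thesis using nth length_subsample_dvd[OF l] by (simp add: l_def)
      next
        case False
        then have "settled s (snd (st1 ! i))" using settled i by simp
        moreover have "snd (entry s (snd (st1 ! i)))" using that by (simp add: nth entry_subsample[OF nei] s)
        ultimately have "length (snd (st1 ! i)) = 1" by (simp add: settled_def)
        then show ?thesis unfolding nth by (intro length_subsample_dvd[OF nei]) simp
      qed
      then show ?thesis by (simp add: settled_def)
    qed
    ultimately show ?thesis using sub by blast
  qed
qed auto

text \<open>An edge that shows a marked entry has a label of length 1 and looks the same at all
  times. For the other edges it suffices to avoid all marked positions, since unmarked entries agree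
  in value. Thus \<open>I\<close> contains only marked positions of the latter edges, and
  \<open>residue_classes_avoid\<close> applies.\<close>

lemma settled_small_time:
  assumes "well_marked st" "\<And>i. i < length st \<Longrightarrow> settled s (snd (st ! i))"
  shows "\<exists>s' < 2 ^ marks st. pattern s' st = pattern s st"
proof -
  let ?l = "\<lambda>i. snd (st ! i)"
  define B where "B i = {j. j < length (?l i) \<and> snd (?l i ! j) \<and> \<not> snd (entry s (?l i))}" for i
  define I where "I = Sigma {..<length st} B"
  have ne: "?l i \<noteq> []" if "i < length st" for i using assms(1) that by (simp add: well_marked_def)
  have finB: "finite (B i)" for i by (simp add: B_def)
  have fin: "finite I" unfolding I_def by (auto simp: finB)
  have "card I = (\<Sum>i<length st. card (B i))" unfolding I_def by (simp add: finB)
  also have "\<dots> \<le> (\<Sum>i<length st. length (filter snd (?l i)))"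
    unfolding length_filter_conv_card by (intro sum_mono card_mono) (auto simp: B_def)
  also have "\<dots> = marks st"
    unfolding marks_sum sum_list_sum_nth by (simp add: atLeast0LessThan)
  finally have card: "card I \<le> marks st" .
  have "\<exists>s' < 2 ^ card I. \<forall>p\<in>I. s' mod length (?l (fst p)) \<noteq> snd p mod length (?l (fst p))"
  proof (rule residue_classes_avoid[OF fin])
    show "0 < length (?l (fst p))" if "p \<in> I" for p using that ne by (auto simp: I_def)
    show "s mod length (?l (fst p)) \<noteq> snd p mod length (?l (fst p))" if "p \<in> I" for p
      using that ne by (auto simp: I_def B_def entry_nth)
  qed
  then obtain s' where s': "s' < 2 ^ card I" "\<And>p. p \<in> I \<Longrightarrow> s' mod length (?l (fst p)) \<noteq> snd p mod length (?l (fst p))"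
    by blast
  have "fst (entry s' (?l i)) = fst (entry s (?l i))" if i: "i < length st" for i
  proof (cases "snd (entry s (?l i))")
    case True
    then have "length (?l i) = 1" using assms(2)[OF i] by (simp add: settled_def)
    then show ?thesis by (simp add: entry_def)
  next
    case False
    have "\<not> snd (entry s' (?l i))"
    proof
      assume "snd (entry s' (?l i))"
      with False i ne[OF i] have "(i, s' mod length (?l i)) \<in> I"
        by (auto simp: I_def B_def entry_nth)
      from s'(2)[OF this] show False by simp
    qed
    moreover obtain b where "\<forall>x\<in>set (?l i). fst x = (snd x = b)"
      using assms(1) i unfolding well_marked_def by (metis nth_mem)
    ultimately show ?thesis using False entry_in_set[OF ne[OF i]] by simp
  qed
  then have "pattern s' st = pattern s st" by (intro nth_equalityI) (auto simp: pattern_def)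
  moreover have "s' < 2 ^ marks st" using s'(1) card by (meson less_le_trans one_le_numeral power_increasing)
  ultimately show ?thesis by blast
qed

theorem set_patterns:
  assumes "well_marked st"
  shows "set (patterns st) = range (\<lambda>t. pattern t st)"
proof (intro equalityI subsetI)
  fix x assume "x \<in> set (patterns st)"
  then obtain st' s where "st' \<in> set (frontier st [0..<length st])" "x = pattern s st'"
    unfolding patterns_def by auto
  then show "x \<in> range (\<lambda>t. pattern t st)"
    using descends_frontier[OF assms] unfolding descends_def by (metis rangeI)
next
  fix x assume "x \<in> range (\<lambda>t. pattern t st)"
  then obtain t where x: "x = pattern t st" by blast
  obtain st' s where st': "st' \<in> set (frontier st [0..<length st])" "pattern s st' = x"
      "\<And>i. i < length st \<Longrightarrow> settled s (snd (st' ! i))"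
    using frontier_complete[OF assms order.refl, of t] x by auto
  have desc: "descends st st'" by (rule descends_frontier[OF assms st'(1)])
  then have "well_marked st'" "length st' = length st"
    unfolding descends_def by (auto dest: list_all2_lengthD)
  with settled_small_time[of st' s] st' obtain s' where s': "s' < 2 ^ marks st'" "pattern s' st' = x"
    by auto
  have "(2::nat) ^ marks st' \<le> 2 ^ marks st" using descends_marks[OF desc] by simp
  from less_le_trans[OF s'(1) this] s'(2)
  have "x \<in> (\<lambda>s. pattern s st') ` {0..<2 ^ marks st}" by (intro image_eqI[of _ _ s']) auto
  with st'(1) show "x \<in> set (patterns st)" unfolding patterns_def by auto
qed

text \<open>Each step multiplies the number of states by at most \<open>1 + k\<close>: the state
  itself, and one restriction per mark that is still present in the label.\<close>

lemma length_frontier: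
  assumes "well_marked st" "\<And>e. e \<in> set st \<Longrightarrow> length (filter snd (snd e)) \<le> k" "\<And>i. i \<in> set is \<Longrightarrow> i < length st"
  shows "length (frontier st is) \<le> (1 + k) ^ length is"
  using assms(3)
proof (induction "is" rule: rev_induct)
  case (snoc i "is")
  have "length (branch (snd (hd (drop i st'))) st') \<le> 1 + k" if "st' \<in> set (frontier st is)" for st'
  proof -
    have desc: "descends st st'" by (rule descends_frontier[OF assms(1) that])
    have i: "i < length st" "i < length st'"
      using snoc.prems[of i] desc unfolding descends_def by (auto dest: list_all2_lengthD)
    let ?l = "snd (st' ! i)"
    have ne: "?l \<noteq> []" using desc i(2) by (simp add: descends_def well_marked_def)
    have "length (filter (\<lambda>a. snd (entry a ?l)) [0..<length ?l]) = card {a. a < length ?l \<and> snd (?l ! a)}"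
      unfolding length_filter_conv_card using ne by (intro arg_cong[where f = card]) (auto simp: entry_nth)
    also have "\<dots> = length (filter snd ?l)" by (simp add: length_filter_conv_card)
    also have "\<dots> \<le> length (filter snd (snd (st ! i)))"
      using desc i(1) unfolding descends_def by (auto dest: list_all2_nthD)
    also have "\<dots> \<le> k" by (rule assms(2)) (use i in simp)
    finally show ?thesis by (simp add: branch_def hd_drop_conv_nth i(2))
  qed
  then have "length (expand i (frontier st is)) \<le> (\<Sum>st'\<leftarrow>frontier st is. 1 + k)"
    unfolding expand_def length_concat map_map comp_def by (intro sum_list_mono)
  also have "\<dots> = length (frontier st is) * (1 + k)" by (simp add: sum_list_triv)
  also have "\<dots> \<le> (1 + k) ^ length is * (1 + k)" using snoc by (intro mult_right_mono) auto
  finally show ?case by (simp add: frontier_snoc mult.commute)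
qed simp

lemma marks_le: "(\<And>e. e \<in> set st \<Longrightarrow> length (filter snd (snd e)) \<le> k) \<Longrightarrow> marks st \<le> length st * k"
  unfolding marks_sum by (induction st) (auto intro: add_mono)

section \<open>Subgraphs and minors\<close>

lemma simple_graphD:
  assumes "simple_graph G" "e \<in> edges G"
  shows "e \<subseteq> verts G" "card e = 2"
  using assms by (auto simp: simple_graph_def)

lemma simple_graph_edgeD:
  assumes "simple_graph G" "{u, v} \<in> edges G"
  shows "u \<in> verts G" "v \<in> verts G" "u \<noteq> v"
  using simple_graphD[OF assms] by (auto simp: card_2_iff doubleton_eq_iff)

lemma simple_graph_contract:
  assumes G: "simple_graph G" and uv: "{u, v} \<in> edges G"
  shows "simple_graph (contract G u v)"
proof -
  have "{u, w} \<subseteq> verts G - {v} \<and> card {u, w} = 2" if "{v, w} \<in> edges G" "w \<noteq> u" for w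
    using simple_graph_edgeD[OF G uv] simple_graph_edgeD[OF G that(1)] that(2) by auto
  then show ?thesis using G unfolding simple_graph_def contract_def by fastforce
qed

lemma simple_graph_minor_step: "minor_step G G' \<Longrightarrow> simple_graph G \<Longrightarrow> simple_graph G'"
proof (induction rule: minor_step.induct)
  case (contract u v G)
  then show ?case by (intro simple_graph_contract)
qed (auto simp: simple_graph_def delete_vertex_def delete_edge_def)

section \<open>Containment expressed by maps from \<open>H\<close>\<close>

definition embedding :: "('w \<Rightarrow> 'v) \<Rightarrow> 'w graph \<Rightarrow> 'v graph \<Rightarrow> bool" where
  "embedding g H G \<longleftrightarrow> inj_on g (verts H) \<and> g ` verts H \<subseteq> verts G \<and> (\<forall>e\<in>edges H. g ` e \<in> edges G)"

definition induced_embedding :: "('w \<Rightarrow> 'v) \<Rightarrow> 'w graph \<Rightarrow> 'v graph \<Rightarrow> bool" where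
  "induced_embedding g H G \<longleftrightarrow> embedding g H G \<and> (\<forall>e\<in>edges G. e \<subseteq> g ` verts H \<longrightarrow> (\<exists>e'\<in>edges H. e = g ` e'))"

text \<open>Isomorphisms are turned around because the brute-force search enumerates maps that start
  in \<open>H\<close>.\<close>

lemma graph_iso_iff:
  assumes G: "\<And>e. e \<in> edges G \<Longrightarrow> e \<subseteq> verts G" and H: "\<And>e. e \<in> edges H \<Longrightarrow> e \<subseteq> verts H"
  shows "graph_iso G H \<longleftrightarrow> (\<exists>g. inj_on g (verts H) \<and> g ` verts H = verts G \<and> (\<lambda>e. g ` e) ` edges H = edges G)"
proof
  assume "graph_iso G H"
  then obtain f where f: "bij_betw f (verts G) (verts H)" "(\<lambda>e. f ` e) ` edges G = edges H"
    unfolding graph_iso_def by blast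
  let ?g = "inv_into (verts G) f"
  have g: "bij_betw ?g (verts H) (verts G)" by (rule bij_betw_inv_into[OF f(1)])
  have "?g ` f ` e = e" if "e \<in> edges G" for e
    using f(1) G[OF that] by (auto simp: bij_betw_def inv_into_image_cancel)
  then have "(\<lambda>e. ?g ` e) ` edges H = edges G" by (simp add: f(2)[symmetric] image_image)
  with g show "\<exists>g. inj_on g (verts H) \<and> g ` verts H = verts G \<and> (\<lambda>e. g ` e) ` edges H = edges G"
    by (auto simp: bij_betw_def)
next
  assume "\<exists>g. inj_on g (verts H) \<and> g ` verts H = verts G \<and> (\<lambda>e. g ` e) ` edges H = edges G"
  then obtain g where g: "inj_on g (verts H)" "g ` verts H = verts G" "(\<lambda>e. g ` e) ` edges H = edges G" by blast
  let ?f = "inv_into (verts H) g"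
  have "bij_betw ?f (verts G) (verts H)" by (rule bij_betw_inv_into) (use g in \<open>auto simp: bij_betw_def\<close>)
  moreover have "?f ` g ` e = e" if "e \<in> edges H" for e
    using g(1) H[OF that] by (rule inv_into_image_cancel)
  then have "(\<lambda>e. ?f ` e) ` edges G = edges H" by (simp add: g(3)[symmetric] image_image)
  ultimately show "graph_iso G H" unfolding graph_iso_def by blast
qed

lemma has_induced_subgraph_iff:
  assumes "simple_graph H"
  shows "has_induced_subgraph G H \<longleftrightarrow> (\<exists>g. induced_embedding g H G)"
proof -
  have *: "(\<lambda>e. g ` e) ` edges H = {e \<in> edges G. e \<subseteq> g ` verts H} \<longleftrightarrow>
     (\<forall>e\<in>edges H. g ` e \<in> edges G) \<and> (\<forall>e\<in>edges G. e \<subseteq> g ` verts H \<longrightarrow> (\<exists>e'\<in>edges H. e = g ` e'))"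
    (is "?L = _ \<longleftrightarrow> ?A \<and> ?B") for g
  proof
    assume eq: "?L = {e \<in> edges G. e \<subseteq> g ` verts H}"
    have "g ` e \<in> edges G" if "e \<in> edges H" for e
    proof -
      have "g ` e \<in> ?L" using that by (rule imageI)
      then show ?thesis unfolding eq by simp
    qed
    moreover have "\<exists>e'\<in>edges H. e = g ` e'" if "e \<in> edges G" "e \<subseteq> g ` verts H" for e
    proof -
      have "e \<in> ?L" unfolding eq using that by simp
      then show ?thesis by blast
    qed
    ultimately show "?A \<and> ?B" by blast
  next
    assume AB: "?A \<and> ?B"
    show "?L = {e \<in> edges G. e \<subseteq> g ` verts H}"
    proof (intro equalityI subsetI)
      fix x assume "x \<in> ?L"
      then obtain e where e: "e \<in> edges H" "x = g ` e" by blast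
      from e(1) have "g ` e \<subseteq> g ` verts H" by (intro image_mono simple_graphD(1)[OF assms])
      with e AB show "x \<in> {e \<in> edges G. e \<subseteq> g ` verts H}" by simp
    next
      fix x assume "x \<in> {e \<in> edges G. e \<subseteq> g ` verts H}"
      then have "x \<in> edges G" "x \<subseteq> g ` verts H" by auto
      with AB obtain e where "e \<in> edges H" "x = g ` e" by meson
      then show "x \<in> ?L" by blast
    qed
  qed
  have iso: "graph_iso (induced_subgraph G S) H \<longleftrightarrow> (\<exists>g. inj_on g (verts H) \<and> g ` verts H = S \<and>
      (\<lambda>e. g ` e) ` edges H = {e \<in> edges G. e \<subseteq> S})" for S
    by (subst graph_iso_iff) (use simple_graphD(1)[OF assms] in \<open>auto simp: induced_subgraph_def\<close>)
  show ?thesis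
  proof
    assume "has_induced_subgraph G H"
    then obtain g where "inj_on g (verts H)" "g ` verts H \<subseteq> verts G"
      "(\<lambda>e. g ` e) ` edges H = {e \<in> edges G. e \<subseteq> g ` verts H}"
      unfolding has_induced_subgraph_def iso by auto
    then have "induced_embedding g H G" unfolding * induced_embedding_def embedding_def by simp
    then show "\<exists>g. induced_embedding g H G" by blast
  next
    assume "\<exists>g. induced_embedding g H G"
    then obtain g where g: "induced_embedding g H G" by blast
    then have "(\<lambda>e. g ` e) ` edges H = {e \<in> edges G. e \<subseteq> g ` verts H}"
      unfolding * induced_embedding_def embedding_def by simp
    moreover have "inj_on g (verts H)" "g ` verts H \<subseteq> verts G"
      using g unfolding induced_embedding_def embedding_def by auto
    ultimately show "has_induced_subgraph G H"
      unfolding has_induced_subgraph_def iso by (intro exI[of _ "g ` verts H"] exI[of _ g] conjI refl)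
  qed
qed

text \<open>Deletions can be postponed until after all contractions.\<close>

definition contract_step :: "'v graph \<Rightarrow> 'v graph \<Rightarrow> bool" where
  "contract_step G G' \<longleftrightarrow> (\<exists>u v. {u, v} \<in> edges G \<and> G' = contract G u v)"

definition subgraph :: "'v graph \<Rightarrow> 'v graph \<Rightarrow> bool" where
  "subgraph G G' \<longleftrightarrow> verts G \<subseteq> verts G' \<and> edges G \<subseteq> edges G'"

text \<open>A deletion leaves a subgraph, and contractions carried out there can be repeated in the
  larger graph, ending in a supergraph. This allows \<open>has_minor_imp\<close> to skip the
  deletions, as an embedding of \<open>H\<close> survives in a supergraph.\<close>

lemma contract_steps_mono:
  assumes "contract_step\<^sup>*\<^sup>* G1 G2" "subgraph G1 G"
  shows "\<exists>G'. contract_step\<^sup>*\<^sup>* G G' \<and> subgraph G2 G'"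
  using assms
proof (induction rule: rtranclp_induct)
  case (step G2 G3)
  then obtain G' where G': "contract_step\<^sup>*\<^sup>* G G'" "subgraph G2 G'" by blast
  from step.hyps(2) obtain u v where uv: "{u, v} \<in> edges G2" "G3 = contract G2 u v"
    unfolding contract_step_def by blast
  have "contract_step G' (contract G' u v)" using uv G' unfolding contract_step_def subgraph_def by blast
  moreover have "subgraph G3 (contract G' u v)"
    using G'(2) unfolding uv(2) subgraph_def contract_def by auto
  ultimately show ?case using G'(1) by (meson rtranclp.rtrancl_into_rtrancl)
qed blast

lemma embedding_mono: "embedding g H G \<Longrightarrow> subgraph G G' \<Longrightarrow> embedding g H G'"
  unfolding embedding_def subgraph_def by blast

lemma has_minor_imp:
  assumes "simple_graph G" "simple_graph H" "has_minor G H"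
  shows "\<exists>G' g. contract_step\<^sup>*\<^sup>* G G' \<and> embedding g H G'"
proof -
  from assms(3) obtain G1 where G1: "minor_step\<^sup>*\<^sup>* G G1" "graph_iso G1 H" unfolding has_minor_def by blast
  have simple: "simple_graph G1" using G1(1) assms(1)
    by (induction rule: rtranclp_induct) (auto intro: simple_graph_minor_step)
  obtain g where "inj_on g (verts H)" "g ` verts H = verts G1" "(\<lambda>e. g ` e) ` edges H = edges G1"
    using G1(2) graph_iso_iff[OF simple_graphD(1)[OF simple] simple_graphD(1)[OF assms(2)]] by auto
  then have "embedding g H G1" unfolding embedding_def by blast
  then have "\<exists>g. embedding g H G1" by blast
  with G1(1) show ?thesis
  proof (induction rule: converse_rtranclp_induct)
    case base
    then show ?case by blast
  next
    case (step G G2)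
    then obtain G' g where G': "contract_step\<^sup>*\<^sup>* G2 G'" "embedding g H G'" by blast
    from step.hyps(1) show ?case
    proof cases
      case (contract u v)
      then have "contract_step G G2" unfolding contract_step_def by blast
      with G' show ?thesis by (meson converse_rtranclp_into_rtranclp)
    next
      case (vertex v)
      then have "subgraph G2 G" by (auto simp: subgraph_def delete_vertex_def)
      then show ?thesis using G' contract_steps_mono embedding_mono by meson
    next
      case (edge e)
      then have "subgraph G2 G" by (auto simp: subgraph_def delete_edge_def)
      then show ?thesis using G' contract_steps_mono embedding_mono by meson
    qed
  qed
qed

lemma minor_steps_delete_vertices:
  assumes "finite X" "X \<subseteq> verts G"
  shows "minor_step\<^sup>*\<^sup>* G \<lparr>verts = verts G - X, edges = {e \<in> edges G. e \<inter> X = {}}\<rparr>"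
  using assms
proof (induction X rule: finite_induct)
  case empty
  show ?case by (cases G) simp
next
  case (insert x X)
  let ?G = "\<lparr>verts = verts G - X, edges = {e \<in> edges G. e \<inter> X = {}}\<rparr>"
  have "minor_step ?G (delete_vertex ?G x)" using insert by (intro minor_step.vertex) auto
  also have "delete_vertex ?G x = \<lparr>verts = verts G - insert x X, edges = {e \<in> edges G. e \<inter> insert x X = {}}\<rparr>"
    by (auto simp: delete_vertex_def)
  finally show ?case using insert by (meson insert_subset rtranclp.rtrancl_into_rtrancl)
qed

lemma minor_steps_delete_edges:
  assumes "finite X" "X \<subseteq> edges G"
  shows "minor_step\<^sup>*\<^sup>* G \<lparr>verts = verts G, edges = edges G - X\<rparr>"
  using assms
proof (induction X rule: finite_induct)
  case empty
  show ?case by (cases G) simp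
next
  case (insert x X)
  let ?G = "\<lparr>verts = verts G, edges = edges G - X\<rparr>"
  have "minor_step ?G (delete_edge ?G x)" using insert by (intro minor_step.edge) auto
  also have "delete_edge ?G x = \<lparr>verts = verts G, edges = edges G - insert x X\<rparr>"
    by (auto simp: delete_edge_def)
  finally show ?case using insert by (meson insert_subset rtranclp.rtrancl_into_rtrancl)
qed

lemma embedding_imp_has_minor:
  assumes G: "simple_graph G" and H: "simple_graph H" and g: "embedding g H G"
  shows "has_minor G H"
proof -
  let ?W = "g ` verts H" and ?F = "(\<lambda>e. g ` e) ` edges H"
  \<comment> \<open>The double differences fit the two deletion lemmas; \<open>T\<close> turns out
    to be the image of \<open>H\<close>.\<close>
  define G1 where "G1 = \<lparr>verts = verts G - (verts G - ?W), edges = {e \<in> edges G. e \<inter> (verts G - ?W) = {}}\<rparr>"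
  define T where "T = \<lparr>verts = verts G1, edges = edges G1 - (edges G1 - ?F)\<rparr>"
  have 1: "minor_step\<^sup>*\<^sup>* G G1" unfolding G1_def
    by (rule minor_steps_delete_vertices) (use G in \<open>auto simp: simple_graph_def\<close>)
  have "edges G1 \<subseteq> Pow (verts G)" using simple_graphD(1)[OF G] by (auto simp: G1_def)
  moreover have "finite (verts G)" using G by (simp add: simple_graph_def)
  ultimately have "finite (edges G1)" by (meson finite_Pow_iff finite_subset)
  then have 2: "minor_step\<^sup>*\<^sup>* G1 T" unfolding T_def by (intro minor_steps_delete_edges) auto
  have "e \<in> edges G1" if "e \<in> ?F" for e
    using that g simple_graphD(1)[OF H] unfolding embedding_def G1_def by fastforce
  then have T: "verts T = ?W" "edges T = ?F"
    using g by (auto simp: T_def G1_def embedding_def)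
  have sub: "e \<subseteq> verts T" if "e \<in> edges T" for e
    using that simple_graphD(1)[OF H] unfolding T by blast
  have iso: "graph_iso T H \<longleftrightarrow>
      (\<exists>g. inj_on g (verts H) \<and> g ` verts H = verts T \<and> (\<lambda>e. g ` e) ` edges H = edges T)"
    by (rule graph_iso_iff; erule sub simple_graphD(1)[OF H])
  have "inj_on g (verts H)" using g by (simp add: embedding_def)
  then have "graph_iso T H" unfolding iso T by (intro exI[of _ g] conjI refl)
  with 1 2 show ?thesis unfolding has_minor_def by (meson rtranclp_trans)
qed

theorem has_minor_iff:
  assumes "simple_graph G" "simple_graph H"
  shows "has_minor G H \<longleftrightarrow> (\<exists>G' g. contract_step\<^sup>*\<^sup>* G G' \<and> embedding g H G')"
proof
  assume "\<exists>G' g. contract_step\<^sup>*\<^sup>* G G' \<and> embedding g H G'"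
  then obtain G' g where G': "contract_step\<^sup>*\<^sup>* G G'" "embedding g H G'" by blast
  from G'(1) have "minor_step\<^sup>*\<^sup>* G G' \<and> simple_graph G'"
  proof (induction rule: rtranclp_induct)
    case (step G1 G2)
    from step.hyps(2) obtain u v where "{u, v} \<in> edges G1" "G2 = contract G1 u v"
      unfolding contract_step_def by blast
    then have "minor_step G1 G2" by (simp add: minor_step.contract)
    with step.IH show ?case using simple_graph_minor_step[of G1 G2]
      by (auto intro: rtranclp.rtrancl_into_rtrancl)
  qed (use assms in simp)
  with embedding_imp_has_minor[OF _ assms(2) G'(2)] show "has_minor G H"
    unfolding has_minor_def by (meson rtranclp_trans)
qed (rule has_minor_imp[OF assms])

section \<open>Graphs as lists\<close>

type_synonym graph_state = "nat list \<times> (nat \<times> nat) list"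

text \<open>Each edge occurs in both orientations, so that adjacency is membership of one ordered
  pair and a pair can be contracted in either direction. Repeated pairs are permitted.\<close>

definition represents :: "(nat \<Rightarrow> 'v) \<Rightarrow> graph_state \<Rightarrow> 'v graph \<Rightarrow> bool" where
  "represents f g G \<longleftrightarrow> inj_on f (set (fst g)) \<and> verts G = f ` set (fst g) \<and>
     edges G = (\<lambda>q. {f (fst q), f (snd q)}) ` set (snd g) \<and>
     (\<forall>(i, j)\<in>set (snd g). i \<in> set (fst g) \<and> j \<in> set (fst g) \<and> i \<noteq> j \<and> (j, i) \<in> set (snd g))"

definition merge :: "nat \<Rightarrow> nat \<Rightarrow> nat \<Rightarrow> nat" where
  "merge u v x = (if x = v then u else x)"

text \<open>Renaming \<open>v\<close> to \<open>u\<close> and dropping loops is enough. Parallel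
  edges become repeated pairs; these may stay, since neither list grows.\<close>

definition contract_state :: "nat \<Rightarrow> nat \<Rightarrow> graph_state \<Rightarrow> graph_state" where
  "contract_state u v g = (filter (\<lambda>x. \<not> x = v) (fst g),
     filter (\<lambda>q. \<not> fst q = snd q) (map (\<lambda>q. (merge u v (fst q), merge u v (snd q))) (snd g)))"

lemma representsD:
  assumes "represents f g G"
  shows "inj_on f (set (fst g))" "verts G = f ` set (fst g)" "edges G = (\<lambda>q. {f (fst q), f (snd q)}) ` set (snd g)"
    "\<And>i j. (i, j) \<in> set (snd g) \<Longrightarrow> i \<in> set (fst g) \<and> j \<in> set (fst g) \<and> i \<noteq> j \<and> (j, i) \<in> set (snd g)"
  using assms unfolding represents_def by auto

lemma represents_edgeE:
  assumes "represents f g G" "e \<in> edges G"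
  obtains i j where "(i, j) \<in> set (snd g)" "e = {f i, f j}"
proof -
  obtain q where "q \<in> set (snd g)" "e = {f (fst q), f (snd q)}"
    using assms(2) unfolding representsD(3)[OF assms(1)] by blast
  then show ?thesis by (intro that[of "fst q" "snd q"]) auto
qed

lemma represents_edgeI: "represents f g G \<Longrightarrow> (i, j) \<in> set (snd g) \<Longrightarrow> {f i, f j} \<in> edges G"
  by (simp add: representsD(3)) (rule image_eqI[of _ _ "(i, j)"], simp_all)

lemma represents_edge_iff:
  assumes g: "represents f g G" and "i \<in> set (fst g)" "j \<in> set (fst g)"
  shows "{f i, f j} \<in> edges G \<longleftrightarrow> (i, j) \<in> set (snd g)"
proof
  assume "{f i, f j} \<in> edges G"
  then obtain i' j' where q: "(i', j') \<in> set (snd g)" "{f i, f j} = {f i', f j'}"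
    using represents_edgeE[OF g] by blast
  note ij = representsD(4)[OF g q(1)]
  from q(2) have "i = i' \<and> j = j' \<or> i = j' \<and> j = i'"
    using representsD(1)[OF g] assms(2,3) ij by (auto simp: doubleton_eq_iff inj_on_eq_iff)
  then show "(i, j) \<in> set (snd g)" using q(1) ij by auto
qed (rule represents_edgeI[OF g])

lemma represents_contract:
  assumes g: "represents f g G" and uv: "(u, v) \<in> set (snd g)"
  shows "represents f (contract_state u v g) (contract G (f u) (f v))"
proof -
  let ?g = "contract_state u v g"
  note rep = representsD[OF g]
  note uv' = rep(4)[OF uv]
  have vs: "set (fst ?g) = set (fst g) - {v}" by (auto simp: contract_state_def)
  have mem: "(i, j) \<in> set (snd ?g) \<longleftrightarrow>
     (\<exists>x y. (x, y) \<in> set (snd g) \<and> i = merge u v x \<and> j = merge u v y \<and> i \<noteq> j)" for i j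
    by (auto simp: contract_state_def image_iff) force+
  have inj: "f x = f y \<longleftrightarrow> x = y" if "x \<in> set (fst g)" "y \<in> set (fst g)" for x y
    using rep(1) that by (simp add: inj_on_eq_iff)
  have "edges (contract G (f u) (f v)) = (\<lambda>q. {f (fst q), f (snd q)}) ` set (snd ?g)"
  proof (intro equalityI subsetI)
    fix e assume "e \<in> edges (contract G (f u) (f v))"
    then consider "e \<in> edges G" "f v \<notin> e" | w where "e = {f u, w}" "{f v, w} \<in> edges G" "w \<noteq> f u"
      by (auto simp: contract_def)
    then show "e \<in> (\<lambda>q. {f (fst q), f (snd q)}) ` set (snd ?g)"
    proof cases
      case 1
      then obtain i j where q: "(i, j) \<in> set (snd g)" "e = {f i, f j}" by (elim represents_edgeE[OF g])
      with 1(2) have "i \<noteq> v" "j \<noteq> v" by auto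
      then have "(i, j) \<in> set (snd ?g)" unfolding mem using q rep(4)[OF q(1)]
        by (intro exI[of _ i] exI[of _ j]) (auto simp: merge_def)
      with q(2) show ?thesis by force
    next
      case 2
      from 2(2) obtain i j where q: "(i, j) \<in> set (snd g)" "{f v, w} = {f i, f j}" by (elim represents_edgeE[OF g])
      note ij = rep(4)[OF q(1)]
      from q(2) have "f i = f v \<and> w = f j \<or> f j = f v \<and> w = f i" by (auto simp: doubleton_eq_iff)
      then have "i = v \<and> w = f j \<or> j = v \<and> w = f i" using inj ij uv' by metis
      then obtain y where y: "(v, y) \<in> set (snd g)" "w = f y" using q(1) ij by auto
      have "y \<noteq> u" "y \<noteq> v" using y 2(3) rep(4)[OF y(1)] by auto
      then have "(u, y) \<in> set (snd ?g)" unfolding mem using y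
        by (intro exI[of _ v] exI[of _ y]) (auto simp: merge_def)
      with 2(1) y(2) show ?thesis by force
    qed
  next
    fix e assume "e \<in> (\<lambda>q. {f (fst q), f (snd q)}) ` set (snd ?g)"
    then obtain x y where q: "(x, y) \<in> set (snd g)" "e = {f (merge u v x), f (merge u v y)}" "merge u v x \<noteq> merge u v y"
      using mem by fastforce
    note xy = rep(4)[OF q(1)]
    note E = represents_edgeI[OF g]
    consider "x \<noteq> v" "y \<noteq> v" | "x = v" | "y = v" by blast
    then show "e \<in> edges (contract G (f u) (f v))"
    proof cases
      case 1
      then have "f v \<noteq> f x" "f v \<noteq> f y" using inj xy uv' by metis+
      with 1 q E[OF q(1)] show ?thesis by (auto simp: contract_def merge_def)
    next
      case 2
      then have y: "y \<noteq> v" "y \<noteq> u" using xy q(3) by (auto simp: merge_def)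
      then have "f y \<noteq> f u" using inj xy uv' by metis
      moreover have "e = {f u, f y}" using q(2) 2 y by (simp add: merge_def)
      ultimately show ?thesis using E[OF q(1)] 2 by (auto simp: contract_def)
    next
      case 3
      then have x: "x \<noteq> v" "x \<noteq> u" using xy q(3) by (auto simp: merge_def)
      then have "f x \<noteq> f u" using inj xy uv' by metis
      moreover have "e = {f u, f x}" using q(2) 3 x by (simp add: merge_def insert_commute)
      moreover have "{f v, f x} \<in> edges G" using E[of y x] xy 3 by simp
      ultimately show ?thesis by (auto simp: contract_def)
    qed
  qed
  moreover have "verts (contract G (f u) (f v)) = f ` set (fst ?g)"
    using rep(1,2) uv' by (auto simp: vs contract_def inj_on_def)
  moreover have "inj_on f (set (fst ?g))" using rep(1) vs by (auto intro: inj_on_subset)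
  moreover have *: "i \<in> set (fst ?g) \<and> j \<in> set (fst ?g) \<and> i \<noteq> j \<and> (j, i) \<in> set (snd ?g)"
    if q: "(i, j) \<in> set (snd ?g)" for i j
  proof -
    obtain x y where "(x, y) \<in> set (snd g)" "i = merge u v x" "j = merge u v y" "i \<noteq> j"
      using q mem[of i j] by auto
    then show ?thesis using rep(4)[of x y] uv' unfolding mem vs by (auto simp: merge_def)
  qed
  have "\<forall>(i, j)\<in>set (snd ?g). i \<in> set (fst ?g) \<and> j \<in> set (fst ?g) \<and> i \<noteq> j \<and> (j, i) \<in> set (snd ?g)"
    by (intro ballI case_prodI2) (use * in blast)
  ultimately show ?thesis unfolding represents_def by blast
qed

text \<open>Each graph is kept beside its contractions, so a fixed number of rounds covers all
  shorter sequences too.\<close>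

definition contractions :: "graph_state list \<Rightarrow> graph_state list" where
  "contractions gs = concat (map (\<lambda>g. g # map (\<lambda>q. contract_state (fst q) (snd q) g) (snd g)) gs)"

lemma set_contractions:
  "g' \<in> set (contractions gs) \<longleftrightarrow>
    (\<exists>g\<in>set gs. g' = g \<or> (\<exists>u v. (u, v) \<in> set (snd g) \<and> g' = contract_state u v g))"
proof -
  have "(\<exists>q\<in>set (snd g). g' = contract_state (fst q) (snd q) g) \<longleftrightarrow>
      (\<exists>u v. (u, v) \<in> set (snd g) \<and> g' = contract_state u v g)" for g
    by (simp only: Bex_def split_paired_Ex fst_conv snd_conv)
  then show ?thesis by (simp add: contractions_def image_iff)
qed

lemma length_contract_state:
  "length (fst (contract_state u v g)) \<le> length (fst g)" "length (snd (contract_state u v g)) \<le> length (snd g)"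
  unfolding contract_state_def fst_conv snd_conv
  by (rule length_filter_le, rule order.trans[OF length_filter_le]) simp

lemma contract_step_represents:
  assumes "represents f g G" "contract_step G G'"
  obtains u v where "(u, v) \<in> set (snd g)" "represents f (contract_state u v g) G'"
proof -
  obtain a b where ab: "{a, b} \<in> edges G" "G' = contract G a b" using assms(2) unfolding contract_step_def by blast
  from ab(1) obtain i j where ij: "(i, j) \<in> set (snd g)" "{a, b} = {f i, f j}" by (elim represents_edgeE[OF assms(1)])
  then consider "a = f i" "b = f j" | "a = f j" "b = f i" by (auto simp: doubleton_eq_iff)
  then obtain u v where "(u, v) \<in> set (snd g)" "a = f u" "b = f v"
    using ij(1) representsD(4)[OF assms(1) ij(1)] by cases auto
  with represents_contract[OF assms(1)] ab(2) that show ?thesis by blast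
qed

text \<open>Every contraction removes a vertex, which bounds the number of rounds.\<close>

lemma contractions_complete:
  assumes "contract_step\<^sup>*\<^sup>* G G'" "represents f g G"
  shows "\<exists>m g'. g' \<in> set ((contractions ^^ m) [g]) \<and> represents f g' G' \<and> m + length (fst g') \<le> length (fst g)"
  using assms(1)
proof (induction rule: rtranclp_induct)
  case base
  show ?case by (rule exI[of _ 0], rule exI[of _ g]) (use assms(2) in simp)
next
  case (step G1 G2)
  then obtain m g1 where g1: "g1 \<in> set ((contractions ^^ m) [g])" "represents f g1 G1"
    "m + length (fst g1) \<le> length (fst g)" by blast
  obtain u v where uv: "(u, v) \<in> set (snd g1)" "represents f (contract_state u v g1) G2"
    using contract_step_represents[OF g1(2) step.hyps(2)] .
  have "v \<in> set (fst g1)" using representsD(4)[OF g1(2) uv(1)] by simp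
  then have "length (fst (contract_state u v g1)) < length (fst g1)"
    unfolding contract_state_def by (auto intro: length_filter_less)
  moreover have "contract_state u v g1 \<in> set ((contractions ^^ Suc m) [g])"
    using g1(1) uv(1) by (auto simp only: funpow.simps o_apply set_contractions)
  ultimately show ?case using g1(3) uv(2) by (intro exI[of _ "Suc m"] exI[of _ "contract_state u v g1"]) auto
qed

lemma contractions_increasing: "set gs \<subseteq> set (contractions gs)"
  unfolding subset_iff set_contractions by blast

lemma contractions_funpow_mono: "m \<le> m' \<Longrightarrow> set ((contractions ^^ m) gs) \<subseteq> set ((contractions ^^ m') gs)"
proof (induction m' rule: dec_induct)
  case (step m')
  then show ?case using contractions_increasing by fastforce
qed simp

lemma contractions_sound:
  assumes "represents f g G" "g' \<in> set ((contractions ^^ m) [g])"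
  shows "\<exists>G'. contract_step\<^sup>*\<^sup>* G G' \<and> represents f g' G'"
  using assms(2)
proof (induction m arbitrary: g')
  case 0
  then show ?case using assms(1) by auto
next
  case (Suc m)
  then obtain g1 where g1: "g1 \<in> set ((contractions ^^ m) [g])"
    "g' = g1 \<or> (\<exists>u v. (u, v) \<in> set (snd g1) \<and> g' = contract_state u v g1)"
    by (auto simp only: funpow.simps o_apply set_contractions)
  obtain G1 where G1: "contract_step\<^sup>*\<^sup>* G G1" "represents f g1 G1" using Suc.IH[OF g1(1)] by blast
  from g1(2) show ?case
  proof
    assume "\<exists>u v. (u, v) \<in> set (snd g1) \<and> g' = contract_state u v g1"
    then obtain u v where uv: "(u, v) \<in> set (snd g1)" "g' = contract_state u v g1" by blast
    have "{f u, f v} \<in> edges G1" by (rule represents_edgeI[OF G1(2) uv(1)])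
    then have "contract_step G1 (contract G1 (f u) (f v))" unfolding contract_step_def by blast
    with G1 represents_contract[OF G1(2) uv(1)] uv(2) show ?thesis
      by (meson rtranclp.rtrancl_into_rtrancl)
  qed (use G1 in blast)
qed

lemma contractions_length:
  assumes "g' \<in> set ((contractions ^^ m) [g])"
  shows "length (fst g') \<le> length (fst g)" "length (snd g') \<le> length (snd g)"
proof -
  have "length (fst g') \<le> length (fst g) \<and> length (snd g') \<le> length (snd g)"
    using assms
  proof (induction m arbitrary: g')
    case (Suc m)
    from Suc.prems obtain g1 where g1: "g1 \<in> set ((contractions ^^ m) [g])" "g' = g1 \<or> (\<exists>u v. g' = contract_state u v g1)"
      by (auto simp only: funpow.simps o_apply set_contractions)
    have "length (fst g') \<le> length (fst g1) \<and> length (snd g') \<le> length (snd g1)"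
      using g1(2) length_contract_state[of _ _ g1] by (elim disjE exE) simp_all
    with Suc.IH[OF g1(1)] show ?case by simp
  qed simp
  then show "length (fst g') \<le> length (fst g)" "length (snd g') \<le> length (snd g)" by auto
qed

lemma length_concat_map_le:
  assumes "\<And>x. x \<in> set xs \<Longrightarrow> length (f x) \<le> b"
  shows "length (concat (map f xs)) \<le> length xs * b"
  using assms
proof (induction xs)
  case (Cons x xs)
  then have "length (f x) \<le> b" "length (concat (map f xs)) \<le> length xs * b" by simp_all
  then show ?case by simp
qed simp

lemma length_contractions:
  "length ((contractions ^^ m) [g]) \<le> (1 + length (snd g)) ^ m"
proof (induction m)
  case (Suc m)
  let ?gs = "(contractions ^^ m) [g]"
  have "length (contractions ?gs) \<le> length ?gs * (1 + length (snd g))"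
    unfolding contractions_def[of ?gs]
    by (rule length_concat_map_le) (simp add: contractions_length(2))
  with Suc have "length (contractions ?gs) \<le> (1 + length (snd g)) ^ m * (1 + length (snd g))"
    by (meson mult_le_mono1 order.trans)
  then show ?case by (simp add: mult.commute)
qed simp

text \<open>A list \<open>a\<close> stands for the injective map that sends the \<open>i\<close>-th
  vertex of \<open>H\<close> to \<open>a ! i\<close>. Membership is spelled out as a bounded
  quantifier to match \<open>feas_bex\<close>, here and in the tests below.\<close>

definition extend :: "nat list \<Rightarrow> nat list list \<Rightarrow> nat list list" where
  "extend xs as = concat (map (\<lambda>a. map (\<lambda>x. x # a) (filter (\<lambda>x. \<not> (\<exists>y\<in>set a. y = x)) xs)) as)"

lemma set_extend: "a \<in> set (extend xs as) \<longleftrightarrow> (\<exists>b\<in>set as. \<exists>x\<in>set xs. x \<notin> set b \<and> a = x # b)"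
  by (induction as) (auto simp: extend_def)

lemma set_extend_funpow:
  "set ((extend xs ^^ m) [[]]) = {a. length a = m \<and> distinct a \<and> set a \<subseteq> set xs}"
proof (induction m)
  case (Suc m)
  have "a \<in> set ((extend xs ^^ Suc m) [[]]) \<longleftrightarrow> length a = Suc m \<and> distinct a \<and> set a \<subseteq> set xs" for a
    unfolding funpow.simps o_apply set_extend Suc by (cases a) auto
  then show ?case by blast
qed auto

text \<open>The bound must not depend on \<open>m\<close>, the number of vertices of
  \<open>H\<close>, because the parameter does not control it. If \<open>m\<close> exceeds the
  number of available vertices, there is no injective list at all.\<close>

lemma length_extend_funpow: "length ((extend xs ^^ m) [[]]) \<le> (1 + length xs) ^ length xs"
proof (cases "m \<le> length xs")
  case True
  have "length ((extend xs ^^ m) [[]]) \<le> length xs ^ m"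
  proof (induction m)
    case (Suc m)
    let ?as = "(extend xs ^^ m) [[]]"
    have "length (extend xs ?as) \<le> length ?as * length xs"
      unfolding extend_def[of xs ?as] by (rule length_concat_map_le) simp
    with Suc have "length (extend xs ?as) \<le> length xs ^ m * length xs"
      by (meson mult_le_mono1 order.trans)
    then show ?case by (simp add: mult.commute)
  qed simp
  also have "\<dots> \<le> (1 + length xs) ^ m" by (intro power_mono) auto
  also have "\<dots> \<le> (1 + length xs) ^ length xs" using True by (intro power_increasing) auto
  finally show ?thesis .
next
  case False
  have "a \<notin> set ((extend xs ^^ m) [[]])" for a
  proof
    assume "a \<in> set ((extend xs ^^ m) [[]])"
    then have a: "length a = m" "distinct a" "set a \<subseteq> set xs" unfolding set_extend_funpow by auto
    then have "m = card (set a)" by (simp add: distinct_card)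
    also have "\<dots> \<le> card (set xs)" using a by (intro card_mono) auto
    also have "\<dots> \<le> length xs" by (rule card_length)
    finally show False using False by simp
  qed
  then have "(extend xs ^^ m) [[]] = []" by (metis list.set_intros(1) neq_Nil_conv)
  then show ?thesis by simp
qed

definition place :: "nat list \<Rightarrow> (nat \<times> nat) list \<Rightarrow> (nat \<times> nat) list" where
  "place a qs = map (\<lambda>q. (hd (drop (fst q) a), hd (drop (snd q) a))) qs"

definition edges_kept :: "graph_state \<Rightarrow> (nat \<times> nat) list \<Rightarrow> bool" where
  "edges_kept g es \<longleftrightarrow> (\<forall>q\<in>set es. \<exists>r\<in>set (snd g). r = q)"

text \<open>The edges of \<open>H\<close> come in one orientation only but those of \<open>g\<close>
  in both, hence the two alternatives.\<close>

definition edges_reflected :: "graph_state \<Rightarrow> nat list \<Rightarrow> (nat \<times> nat) list \<Rightarrow> bool" where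
  "edges_reflected g a es \<longleftrightarrow> (\<forall>r\<in>set (snd g). (\<exists>x\<in>set a. x = fst r) \<and> (\<exists>x\<in>set a. x = snd r) \<longrightarrow>
     (\<exists>q\<in>set es. q = r \<or> (fst q = snd r \<and> snd q = fst r)))"

definition embeds :: "bool \<Rightarrow> graph_state \<Rightarrow> nat \<times> (nat \<times> nat) list \<Rightarrow> bool" where
  "embeds ind g h \<longleftrightarrow> (\<exists>a\<in>set ((extend (fst g) ^^ fst h) [[]]).
     edges_kept g (place a (snd h)) \<and> (ind \<longrightarrow> edges_reflected g a (place a (snd h))))"

text \<open>\<open>a\<close> and \<open>\<phi>\<close> describe the same map, once by vertex numbers
  and once by vertices. In \<open>embeds_iff\<close> each of them is obtained from the
  other.\<close>

lemma enumerates_represented: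
  assumes g: "represents f g G" and H: "simple_graph H" "enumerates ws qs H"
    and a: "length a = length ws" "distinct a" "set a \<subseteq> set (fst g)"
    and \<phi>: "\<And>i. i < length ws \<Longrightarrow> \<phi> (ws ! i) = f (a ! i)"
  shows "embedding \<phi> H G \<longleftrightarrow> edges_kept g (place a qs)"
    "embedding \<phi> H G \<Longrightarrow> induced_embedding \<phi> H G \<longleftrightarrow> edges_reflected g a (place a qs)"
proof -
  note rep = representsD[OF g]
  have ws: "distinct ws" "set ws = verts H" and edges: "edges H = edge_at ws ` set qs"
    and qs: "\<And>i j. (i, j) \<in> set qs \<Longrightarrow> i < length ws \<and> j < length ws"
    using H(2) unfolding enumerates_def by auto
  have in_g: "a ! i \<in> set (fst g)" if "i < length ws" for i using that a by (metis nth_mem subsetD)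
  have place: "set (place a qs) = (\<lambda>(i, j). (a ! i, a ! j)) ` set qs"
    unfolding place_def set_map using qs a(1) by (intro image_cong) (auto simp: hd_drop_conv_nth)
  have img: "\<phi> ` edge_at ws (i, j) = {f (a ! i), f (a ! j)}" if "(i, j) \<in> set qs" for i j
    using qs[OF that] by (simp add: edge_at_def \<phi>)
  have inj: "inj_on \<phi> (verts H)"
  proof (rule inj_onI)
    fix x y assume xy: "x \<in> verts H" "y \<in> verts H" "\<phi> x = \<phi> y"
    then obtain i j where ij: "i < length ws" "j < length ws" "x = ws ! i" "y = ws ! j"
      using ws(2) by (metis in_set_conv_nth)
    then have "a ! i = a ! j" using xy(3) rep(1) in_g by (simp add: \<phi> inj_on_eq_iff)
    then show "x = y" using a ij by (simp add: nth_eq_iff_index_eq)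
  qed
  have verts: "\<phi> ` verts H = f ` set a"
  proof -
    have "\<phi> ` verts H = (\<lambda>i. \<phi> (ws ! i)) ` {..<length ws}"
      unfolding ws(2)[symmetric] set_conv_nth by auto
    also have "\<dots> = (\<lambda>i. f (a ! i)) ` {..<length ws}" using \<phi> by auto
    also have "\<dots> = f ` set a" unfolding set_conv_nth using a(1) by auto
    finally show ?thesis .
  qed
  have kept: "(\<forall>e\<in>edges H. \<phi> ` e \<in> edges G) \<longleftrightarrow> edges_kept g (place a qs)"
  proof -
    have "\<phi> ` edge_at ws (i, j) \<in> edges G \<longleftrightarrow> (a ! i, a ! j) \<in> set (snd g)" if "(i, j) \<in> set qs" for i j
      using represents_edge_iff[OF g] img[OF that] qs[OF that] in_g by simp
    then show ?thesis unfolding edges edges_kept_def place by fastforce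
  qed
  show "embedding \<phi> H G \<longleftrightarrow> edges_kept g (place a qs)"
    unfolding embedding_def kept using inj verts a(3) rep(2) by auto
  assume emb: "embedding \<phi> H G"
  have "(\<forall>e\<in>edges G. e \<subseteq> \<phi> ` verts H \<longrightarrow> (\<exists>e'\<in>edges H. e = \<phi> ` e')) \<longleftrightarrow>
    (\<forall>r\<in>set (snd g). fst r \<in> set a \<and> snd r \<in> set a \<longrightarrow> (\<exists>q\<in>set (place a qs). q = r \<or> (fst q = snd r \<and> snd q = fst r)))"
    unfolding rep(3) ball_simps(9)
  proof (intro ball_cong refl)
    fix r assume r: "r \<in> set (snd g)"
    then have r': "fst r \<in> set (fst g)" "snd r \<in> set (fst g)" using rep(4)[of "fst r" "snd r"] by auto
    have sub: "{f (fst r), f (snd r)} \<subseteq> \<phi> ` verts H \<longleftrightarrow> fst r \<in> set a \<and> snd r \<in> set a"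
      unfolding verts using inj_on_image_mem_iff[OF rep(1) _ a(3)] r' by simp
    have eq: "{f (fst r), f (snd r)} = \<phi> ` edge_at ws (i, j) \<longleftrightarrow>
        (a ! i, a ! j) = r \<or> (a ! i = snd r \<and> a ! j = fst r)" if "(i, j) \<in> set qs" for i j
      unfolding img[OF that] doubleton_eq_iff
      using rep(1) r' in_g qs[OF that] by (auto simp: inj_on_eq_iff prod_eq_iff)
    have "(\<exists>e'\<in>edges H. {f (fst r), f (snd r)} = \<phi> ` e') \<longleftrightarrow>
        (\<exists>p\<in>set qs. {f (fst r), f (snd r)} = \<phi> ` edge_at ws p)"
      by (simp only: edges bex_simps)
    also have "\<dots> \<longleftrightarrow> (\<exists>p\<in>set qs. (\<lambda>q. q = r \<or> (fst q = snd r \<and> snd q = fst r)) (a ! fst p, a ! snd p))"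
      by (intro bex_cong refl) (simp only: fst_conv snd_conv eq[symmetric] prod.collapse)
    also have "\<dots> \<longleftrightarrow> (\<exists>q\<in>set (place a qs). q = r \<or> (fst q = snd r \<and> snd q = fst r))"
      by (simp only: place bex_simps case_prod_beta)
    finally have "(\<exists>e'\<in>edges H. {f (fst r), f (snd r)} = \<phi> ` e') \<longleftrightarrow>
        (\<exists>q\<in>set (place a qs). q = r \<or> (fst q = snd r \<and> snd q = fst r))" .
    with sub show "({f (fst r), f (snd r)} \<subseteq> \<phi> ` verts H \<longrightarrow> (\<exists>e'\<in>edges H. {f (fst r), f (snd r)} = \<phi> ` e')) \<longleftrightarrow>
       (fst r \<in> set a \<and> snd r \<in> set a \<longrightarrow> (\<exists>q\<in>set (place a qs). q = r \<or> (fst q = snd r \<and> snd q = fst r)))"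
      by blast
  qed
  then show "induced_embedding \<phi> H G \<longleftrightarrow> edges_reflected g a (place a qs)"
    unfolding induced_embedding_def edges_reflected_def using emb by auto
qed

lemma embeds_iff:
  assumes g: "represents f g G" and H: "simple_graph H" "enumerates ws qs H"
  shows "embeds ind g (length ws, qs) \<longleftrightarrow> (\<exists>\<phi>. embedding \<phi> H G \<and> (ind \<longrightarrow> induced_embedding \<phi> H G))"
proof
  assume "embeds ind g (length ws, qs)"
  then obtain a where a: "length a = length ws" "distinct a" "set a \<subseteq> set (fst g)"
    and test: "edges_kept g (place a qs)" "ind \<longrightarrow> edges_reflected g a (place a qs)"
    unfolding embeds_def by (auto simp: set_extend_funpow)
  define \<phi> where "\<phi> w = f (a ! inv_into {..<length ws} ((!) ws) w)" for w
  have "inj_on ((!) ws) {..<length ws}"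
    using H(2) by (intro inj_on_nth) (auto simp: enumerates_def)
  then have "\<phi> (ws ! i) = f (a ! i)" if "i < length ws" for i using that by (simp add: \<phi>_def)
  note * = enumerates_represented[OF g H a, where \<phi> = \<phi>, OF this]
  from * test show "\<exists>\<phi>. embedding \<phi> H G \<and> (ind \<longrightarrow> induced_embedding \<phi> H G)" by blast
next
  assume "\<exists>\<phi>. embedding \<phi> H G \<and> (ind \<longrightarrow> induced_embedding \<phi> H G)"
  then obtain \<phi> where \<phi>: "embedding \<phi> H G" "ind \<longrightarrow> induced_embedding \<phi> H G" by blast
  have ws: "distinct ws" "set ws = verts H" using H(2) by (auto simp: enumerates_def)
  have emb: "inj_on \<phi> (verts H)" "\<phi> ` verts H \<subseteq> f ` set (fst g)"
    using \<phi>(1) representsD(2)[OF g] by (auto simp: embedding_def)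
  define a where "a = map (\<lambda>w. inv_into (set (fst g)) f (\<phi> w)) ws"
  have fa: "f (inv_into (set (fst g)) f (\<phi> w)) = \<phi> w" "inv_into (set (fst g)) f (\<phi> w) \<in> set (fst g)" if "w \<in> verts H" for w
  proof -
    have "\<phi> w \<in> f ` set (fst g)" using emb(2) that by blast
    then show "f (inv_into (set (fst g)) f (\<phi> w)) = \<phi> w" "inv_into (set (fst g)) f (\<phi> w) \<in> set (fst g)"
      by (rule f_inv_into_f, rule inv_into_into)
  qed
  have a: "length a = length ws" "distinct a" "set a \<subseteq> set (fst g)"
  proof -
    have "inj_on (\<lambda>w. inv_into (set (fst g)) f (\<phi> w)) (verts H)"
      using emb(1) fa(1) by (metis (mono_tags, lifting) inj_on_def)
    then show "distinct a" using ws by (simp add: a_def distinct_map)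
  qed (use fa(2) ws in \<open>auto simp: a_def\<close>)
  have "\<phi> (ws ! i) = f (a ! i)" if "i < length ws" for i
    using fa(1)[of "ws ! i"] that nth_mem[OF that] unfolding ws(2) by (simp add: a_def)
  note * = enumerates_represented[OF g H a, where \<phi> = \<phi>, OF this]
  show "embeds ind g (length ws, qs)" unfolding embeds_def fst_conv snd_conv set_extend_funpow
  proof (rule bexI[of _ a])
    show "edges_kept g (place a qs) \<and> (ind \<longrightarrow> edges_reflected g a (place a qs))"
      using * \<phi> by simp
  qed (use a in simp)
qed

text \<open>With zero rounds of contractions and the induced test this is the subgraph problem, so
  one program scheme serves both questions.\<close>

definition decide :: "bool \<Rightarrow> graph_state \<Rightarrow> nat \<times> (nat \<times> nat) list \<Rightarrow> bool" where
  "decide mnr g h \<longleftrightarrow> (\<exists>g'\<in>set ((contractions ^^ (if mnr then length (fst g) else 0)) [g]). embeds (\<not> mnr) g' h)"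

lemma decide_simps:
  "decide True g h \<longleftrightarrow> (\<exists>g'\<in>set ((contractions ^^ length (fst g)) [g]). embeds False g' h)"
  "decide False g h \<longleftrightarrow> embeds True g h"
  unfolding decide_def
  by (simp_all only: if_True if_False not_True_eq_False not_False_eq_True funpow.simps id_apply
      list.set empty_iff insert_iff bex_simps ball_simps simp_thms)

lemma decide_iff:
  assumes g: "represents f g G" and G: "simple_graph G" and H: "simple_graph H" "enumerates ws qs H"
  shows "decide mnr g (length ws, qs) \<longleftrightarrow> (if mnr then has_minor G H else has_induced_subgraph G H)"
proof (cases mnr)
  case True
  have "decide True g (length ws, qs) \<longleftrightarrow> (\<exists>G' \<phi>. contract_step\<^sup>*\<^sup>* G G' \<and> embedding \<phi> H G')"
  proof
    assume "decide True g (length ws, qs)"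
    then have "\<exists>g'\<in>set ((contractions ^^ length (fst g)) [g]). embeds False g' (length ws, qs)"
      by (simp only: decide_simps)
    then obtain g' where g': "g' \<in> set ((contractions ^^ length (fst g)) [g])" "embeds False g' (length ws, qs)" ..
    obtain G' where G': "contract_step\<^sup>*\<^sup>* G G'" "represents f g' G'"
      using contractions_sound[OF g g'(1)] by auto
    from g'(2) obtain \<phi> where "embedding \<phi> H G'" unfolding embeds_iff[OF G'(2) H] by auto
    with G'(1) show "\<exists>G' \<phi>. contract_step\<^sup>*\<^sup>* G G' \<and> embedding \<phi> H G'" by blast
  next
    assume "\<exists>G' \<phi>. contract_step\<^sup>*\<^sup>* G G' \<and> embedding \<phi> H G'"
    then obtain G' \<phi> where G': "contract_step\<^sup>*\<^sup>* G G'" "embedding \<phi> H G'" by blast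
    obtain m g' where g': "g' \<in> set ((contractions ^^ m) [g])" "represents f g' G'" "m + length (fst g') \<le> length (fst g)"
      using contractions_complete[OF G'(1) g] by (elim exE conjE)
    from g'(3) have "m \<le> length (fst g)" by simp
    from subsetD[OF contractions_funpow_mono[OF this] g'(1)]
    have "g' \<in> set ((contractions ^^ length (fst g)) [g])" .
    moreover have "embeds False g' (length ws, qs)"
      unfolding embeds_iff[OF g'(2) H] using G'(2) by (intro exI[of _ \<phi>]) simp
    ultimately have "\<exists>g'\<in>set ((contractions ^^ length (fst g)) [g]). embeds False g' (length ws, qs)" ..
    then show "decide True g (length ws, qs)" by (simp only: decide_simps)
  qed
  then show ?thesis using has_minor_iff[OF G H(1)] True by simp
next
  case False
  have "decide False g (length ws, qs) \<longleftrightarrow> embeds True g (length ws, qs)" by (simp only: decide_simps)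
  also have "\<dots> \<longleftrightarrow> has_induced_subgraph G H"
    unfolding embeds_iff[OF g H] has_induced_subgraph_iff[OF H(1)] by (auto simp: induced_embedding_def)
  finally show ?thesis using False by simp
qed

section \<open>Feasibility of the components\<close>

lemma feas_entry: "feas D t \<Longrightarrow> feas D l \<Longrightarrow> feas D (\<lambda>a. entry (t a) (l a))"
  unfolding entry_def by (intro feas_hd feas_drop feas_mod feas_length)

lemma feas_mark_minority: "feas D l \<Longrightarrow> feas D (\<lambda>a. mark_minority (l a))"
  by (rule feas_subst[where g = mark_minority], unfold mark_minority_def) (intro feas_intros | assumption)+

lemma feas_subsample: "feas D a \<Longrightarrow> feas D m \<Longrightarrow> feas D l \<Longrightarrow> feas D (\<lambda>x. subsample (a x) (m x) (l x))"
  by (rule feas_subst3[where h = subsample], unfold subsample_def) (intro feas_intros feas_entry | assumption)+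

lemma feas_restrict: "feas D a \<Longrightarrow> feas D m \<Longrightarrow> feas D st \<Longrightarrow> feas D (\<lambda>x. restrict (a x) (m x) (st x))"
  by (rule feas_subst3[where h = restrict], unfold restrict_def) (intro feas_intros feas_subsample | assumption)+

lemma feas_branch: "feas D l \<Longrightarrow> feas D st \<Longrightarrow> feas D (\<lambda>x. branch (l x) (st x))"
  by (rule feas_subst2[where h = branch], unfold branch_def) (intro feas_intros feas_entry feas_restrict | assumption)+

lemma feas_expand: "feas D i \<Longrightarrow> feas D sts \<Longrightarrow> feas D (\<lambda>x. expand (i x) (sts x))"
  by (rule feas_subst2[where h = expand], unfold expand_def) (intro feas_intros feas_branch | assumption)+

lemma feas_marks: "feas D st \<Longrightarrow> feas D (\<lambda>x. marks (st x))"
  by (rule feas_subst[where g = marks], unfold marks_def) (intro feas_intros | assumption)+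

lemma feas_pattern: "feas D t \<Longrightarrow> feas D st \<Longrightarrow> feas D (\<lambda>x. pattern (t x) (st x))"
  by (rule feas_subst2[where h = pattern], unfold pattern_def) (intro feas_intros feas_entry | assumption)+

lemma feas_merge: "feas D u \<Longrightarrow> feas D v \<Longrightarrow> feas D x \<Longrightarrow> feas D (\<lambda>a. merge (u a) (v a) (x a))"
  unfolding merge_def by (intro feas_if' feas_eq_nat)

lemma feas_contract_state:
  "feas D u \<Longrightarrow> feas D v \<Longrightarrow> feas D g \<Longrightarrow> feas D (\<lambda>x. contract_state (u x) (v x) (g x))"
  by (rule feas_subst3[where h = contract_state], unfold contract_state_def)
     (intro feas_intros feas_merge | assumption)+

lemma feas_contractions: "feas D gs \<Longrightarrow> feas D (\<lambda>x. contractions (gs x))"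
  by (rule feas_subst[where g = contractions], unfold contractions_def)
     (intro feas_intros feas_contract_state | assumption)+

lemma feas_extend: "feas D xs \<Longrightarrow> feas D as \<Longrightarrow> feas D (\<lambda>x. extend (xs x) (as x))"
  by (rule feas_subst2[where h = extend], unfold extend_def) (intro feas_intros | assumption)+

lemma feas_place: "feas D a \<Longrightarrow> feas D qs \<Longrightarrow> feas D (\<lambda>x. place (a x) (qs x))"
  by (rule feas_subst2[where h = place], unfold place_def) (intro feas_intros | assumption)+

lemma feas_edges_kept: "feas D g \<Longrightarrow> feas D es \<Longrightarrow> feas D (\<lambda>x. edges_kept (g x) (es x))"
  by (rule feas_subst2[where h = edges_kept], unfold edges_kept_def) (intro feas_intros | assumption)+

lemma feas_edges_reflected:
  "feas D g \<Longrightarrow> feas D a \<Longrightarrow> feas D es \<Longrightarrow> feas D (\<lambda>x. edges_reflected (g x) (a x) (es x))"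
  by (rule feas_subst3[where h = edges_reflected], unfold edges_reflected_def) (intro feas_intros | assumption)+

section \<open>The candidate snapshots\<close>

text \<open>A shorter label can still be a larger tree, because \<open>True\<close> is larger than
  \<open>False\<close>. The factor 8 is a list cell (1) with a pair of booleans (at most 7).\<close>

lemma tsize_descends: "descends st st' \<Longrightarrow> tsize st' \<le> 8 * tsize st"
proof -
  assume "descends st st'"
  then have "list_all2 (\<lambda>e e'. fst e' = fst e \<and> length (snd e') \<le> length (snd e)) st st'"
    unfolding descends_def by (auto elim: list_all2_mono)
  then show ?thesis
  proof induction
    case (Cons e st e' st')
    have "tsize x \<le> 7" for x :: "bool \<times> bool"
      using tsize_bool[of "fst x"] tsize_bool[of "snd x"] by simp
    then have "tsize (snd e') \<le> 1 + length (snd e') * (1 + 7)" by (intro tsize_list_le)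
    also have "\<dots> \<le> 1 + 8 * length (snd e)" using Cons.hyps by simp
    finally show ?case using Cons length_less_tsize[of "snd e"] by simp
  qed simp
qed

definition state_dom :: "(nat \<Rightarrow> nat \<Rightarrow> nat) \<Rightarrow> nat \<Rightarrow> nat \<Rightarrow> search_state set" where
  "state_dom b k n = {st. well_marked st \<and> (\<forall>e\<in>set st. length (filter snd (snd e)) \<le> k) \<and>
     length st \<le> k * k \<and> tsize st \<le> b k n}"

text \<open>With at most \<open>k * k\<close> edges and \<open>k\<close> marks per label there are
  at most \<open>(1 + k) ^ (k * k)\<close> states and \<open>2 ^ (k * k * k)\<close> times to try in
  each.\<close>

lemma feas_patterns:
  assumes b: "fpt_bounded b"
  shows "feas (state_dom b) patterns"
proof -
  let ?D = "state_dom b"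
  have small: "small ?D" by (rule smallI[OF b]) (simp add: state_dom_def)
  note id = feas_id[OF small]
  have frontier: "feas ?D (\<lambda>st. fold expand [0..<length st] [st])"
  proof (rule feas_fold[where f = "\<lambda>i sts st. expand i sts" and xs = "\<lambda>st. [0..<length st]" and init = "\<lambda>st. [st]"])
    show "small (\<lambda>k n. {fold expand is [st] |st is zs. st \<in> ?D k n \<and> [0..<length st] = is @ zs})"
    proof (rule smallI)
      show "fpt_bounded (\<lambda>k n. 1 + (1 + k) ^ (k * k) * (1 + 8 * b k n))"
        by (intro fb_intros b fb_param pab_intros)
      fix k n x assume "x \<in> {fold expand is [st] |st is zs. st \<in> ?D k n \<and> [0..<length st] = is @ zs}"
      then obtain st "is" zs where x: "x = frontier st is" and st: "st \<in> ?D k n" and eq: "[0..<length st] = is @ zs"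
        unfolding frontier_def by blast
      have wm: "well_marked st" using st by (simp add: state_dom_def)
      have "set is \<subseteq> set [0..<length st]" unfolding eq by simp
      then have lt: "i < length st" if "i \<in> set is" for i using that by auto
      have "length is \<le> k * k" using arg_cong[OF eq, of length] st by (simp add: state_dom_def)
      then have "(1 + k) ^ length is \<le> (1 + k) ^ (k * k)" by (intro power_increasing) auto
      moreover have "length x \<le> (1 + k) ^ length is"
        unfolding x by (rule length_frontier) (use wm st lt in \<open>auto simp: state_dom_def\<close>)
      ultimately have len: "length x \<le> (1 + k) ^ (k * k)" by simp
      have "tsize x \<le> 1 + length x * (1 + 8 * b k n)"
      proof (rule tsize_list_le)
        fix st' assume "st' \<in> set x"
        then have "tsize st' \<le> 8 * tsize st" unfolding x by (intro tsize_descends descends_frontier[OF wm])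
        also have "\<dots> \<le> 8 * b k n" using st by (simp add: state_dom_def)
        finally show "tsize st' \<le> 8 * b k n" .
      qed
      also have "\<dots> \<le> 1 + (1 + k) ^ (k * k) * (1 + 8 * b k n)" using len by (intro add_left_mono mult_right_mono) auto
      finally show "tsize x \<le> 1 + (1 + k) ^ (k * k) * (1 + 8 * b k n)" .
    qed
  qed (intro feas_intros feas_expand small | assumption)+
  have power: "feas ?D (\<lambda>st. 2 ^ marks st :: nat)"
  proof (rule feas_power2)
    show "feas ?D marks" by (rule feas_marks[OF id])
    show "fpt_bounded (\<lambda>k n. 2 ^ (k * k * k))" by (intro fb_param pab_intros)
    fix k n st assume st: "st \<in> ?D k n"
    have "marks st \<le> length st * k" by (rule marks_le) (use st in \<open>simp add: state_dom_def\<close>)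
    also have "\<dots> \<le> k * k * k" using st by (intro mult_right_mono) (auto simp: state_dom_def)
    finally show "(2::nat) ^ marks st \<le> 2 ^ (k * k * k)" by simp
  qed
  show ?thesis unfolding patterns_def frontier_def
  proof (intro feas_concat feas_map[where f = "\<lambda>st' st. map (\<lambda>s. pattern s st') [0..<2 ^ marks st]"] frontier)
    assume small': "small (ext ?D (\<lambda>st. fold expand [0..<length st] [st]))"
    show "feas (ext ?D (\<lambda>st. fold expand [0..<length st] [st]))
       (\<lambda>p. map (\<lambda>s. pattern s (fst p)) [0..<2 ^ marks (snd p)])"
      by (intro feas_map feas_upt feas_const small' feas_pattern feas_fst feas_snd feas_id feas_ext_snd[OF power] | assumption)+
  qed
qed

section \<open>Deciding a single snapshot\<close>

text \<open>Vertex numbers are unary and contribute to the size of a graph, so bounding the lengths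
  of its two lists is not enough. Contractions only reuse numbers that are already present.\<close>

definition numbers :: "graph_state \<Rightarrow> nat set" where
  "numbers g = set (fst g) \<union> fst ` set (snd g) \<union> snd ` set (snd g)"

lemma numbers_contract_state:
  assumes "(u, v) \<in> set (snd g)"
  shows "numbers (contract_state u v g) \<subseteq> numbers g"
proof -
  have "merge u v x \<in> numbers g" if "x \<in> numbers g" for x
    using assms that by (auto simp: merge_def numbers_def intro: image_eqI[of _ _ "(u, v)"])
  then have "merge u v ` numbers g \<subseteq> numbers g" by blast
  moreover have "fst ` set (snd (contract_state u v g)) \<subseteq> merge u v ` numbers g"
    "snd ` set (snd (contract_state u v g)) \<subseteq> merge u v ` numbers g"
    unfolding contract_state_def numbers_def by force+
  moreover have "set (fst (contract_state u v g)) \<subseteq> numbers g"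
    unfolding contract_state_def numbers_def by auto
  ultimately show ?thesis unfolding numbers_def[of "contract_state u v g"] by blast
qed

lemma numbers_contractions:
  "g' \<in> set ((contractions ^^ m) [g]) \<Longrightarrow> numbers g' \<subseteq> numbers g"
proof (induction m arbitrary: g')
  case (Suc m)
  then obtain g1 where "g1 \<in> set ((contractions ^^ m) [g])"
    "g' = g1 \<or> (\<exists>u v. (u, v) \<in> set (snd g1) \<and> g' = contract_state u v g1)"
    by (auto simp only: funpow.simps o_apply set_contractions)
  with Suc.IH[of g1] numbers_contract_state[of _ _ g1] show ?case by blast
qed simp

lemma numbers_tsize:
  assumes "x \<in> numbers g"
  shows "tsize x \<le> tsize g"
proof -
  have "tsize (fst q) \<le> tsize (snd g)" "tsize (snd q) \<le> tsize (snd g)" if "q \<in> set (snd g)" for q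
    using tsize_mem[OF that] by auto
  then show ?thesis using assms tsize_mem[of x "fst g"] unfolding numbers_def
    by (simp del: tsize_simps(2)) fastforce
qed

text \<open>With \<open>T = tsize g\<close>, the vertex list has size at most
  \<open>1 + T * (1 + T)\<close>, the edge list at most \<open>1 + T * (2 + 2 * T)\<close>, and
  pairing them adds 1.\<close>

lemma tsize_contractions_mem:
  assumes "g' \<in> set ((contractions ^^ m) [g])"
  shows "tsize g' \<le> 3 + tsize g * (3 + 3 * tsize g)"
proof -
  let ?T = "tsize g"
  have num: "tsize x \<le> ?T" if "x \<in> numbers g'" for x
    using numbers_contractions[OF assms] that by (intro numbers_tsize) blast
  have len: "length (fst g') \<le> ?T" "length (snd g') \<le> ?T"
    using contractions_length[OF assms] length_le_tsize[of "fst g"] length_le_tsize[of "snd g"] by simp_all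
  have "tsize (fst g') \<le> 1 + length (fst g') * (1 + ?T)"
    by (rule tsize_list_le) (rule num, simp add: numbers_def)
  also have "\<dots> \<le> 1 + ?T * (1 + ?T)" using len(1) by (intro add_left_mono mult_right_mono) auto
  finally have 1: "tsize (fst g') \<le> 1 + ?T * (1 + ?T)" .
  have "tsize (snd g') \<le> 1 + length (snd g') * (1 + (1 + ?T + ?T))"
  proof (rule tsize_list_le)
    fix q assume "q \<in> set (snd g')"
    then have "tsize (fst q) \<le> ?T" "tsize (snd q) \<le> ?T" by (intro num; simp add: numbers_def)+
    then show "tsize q \<le> 1 + ?T + ?T" by simp
  qed
  also have "\<dots> \<le> 1 + ?T * (1 + (1 + ?T + ?T))" using len(2) by (intro add_left_mono mult_right_mono) auto
  finally have 2: "tsize (snd g') \<le> 1 + ?T * (1 + (1 + ?T + ?T))" .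
  have "tsize g' = 1 + tsize (fst g') + tsize (snd g')" by (rule tsize_simps)
  also have "\<dots> \<le> 3 + ?T * (3 + 3 * ?T)" using 1 2 by (simp only: distrib_left mult_1_right mult.assoc)
  finally show ?thesis .
qed

definition embed_dom :: "(nat \<Rightarrow> nat \<Rightarrow> nat) \<Rightarrow> nat \<Rightarrow> nat \<Rightarrow> (graph_state \<times> nat \<times> (nat \<times> nat) list) set" where
  "embed_dom b k n = {p. length (fst (fst p)) \<le> k \<and> tsize p \<le> b k n}"

lemma feas_embeds:
  assumes b: "fpt_bounded b"
  shows "feas (embed_dom b) (\<lambda>p. embeds ind (fst p) (snd p))"
proof -
  let ?D = "embed_dom b"
  have small: "small ?D" by (rule smallI[OF b]) (simp add: embed_dom_def)
  have "feas ?D (\<lambda>p. (extend (fst (fst p)) ^^ fst (snd p)) [[]])"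
  proof (rule feas_funpow[where h = "\<lambda>p. extend (fst (fst p))"])
    show "feas D' (\<lambda>p. extend (fst (fst (snd p))) (fst p))"
      if "small D'" for D' :: "nat \<Rightarrow> nat \<Rightarrow> (nat list list \<times> graph_state \<times> nat \<times> (nat \<times> nat) list) set"
      by (intro feas_extend feas_fst feas_snd feas_id that)
    show "fpt_bounded (\<lambda>k n. 1 + (1 + k) ^ k * (1 + (1 + k * (1 + b k n))))"
      by (intro fb_intros b fb_param pab_intros)
    fix k n i and p :: "graph_state \<times> nat \<times> (nat \<times> nat) list"
    assume p: "p \<in> ?D k n"
    let ?xs = "fst (fst p)" and ?as = "(extend (fst (fst p)) ^^ i) [[]]"
    have "length ?as \<le> (1 + length ?xs) ^ length ?xs" by (rule length_extend_funpow)
    also have "\<dots> \<le> (1 + k) ^ length ?xs" using p by (intro power_mono) (auto simp: embed_dom_def)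
    also have "\<dots> \<le> (1 + k) ^ k" using p by (intro power_increasing) (auto simp: embed_dom_def)
    finally have len: "length ?as \<le> (1 + k) ^ k" .
    have "tsize ?as \<le> 1 + length ?as * (1 + (1 + k * (1 + b k n)))"
    proof (rule tsize_list_le)
      fix a assume "a \<in> set ?as"
      then have a: "distinct a" "set a \<subseteq> set ?xs" unfolding set_extend_funpow by auto
      have "length a = card (set a)" using a(1) by (simp add: distinct_card)
      also have "\<dots> \<le> card (set ?xs)" using a(2) by (intro card_mono) auto
      also have "\<dots> \<le> length ?xs" by (rule card_length)
      also have "\<dots> \<le> k" using p by (simp add: embed_dom_def)
      finally have "length a \<le> k" .
      have "tsize a \<le> 1 + length a * (1 + b k n)"
      proof (rule tsize_list_le)
        fix x assume "x \<in> set a"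
        then have "x \<in> set ?xs" using a(2) by blast
        from tsize_mem[OF this] show "tsize x \<le> b k n" using p unfolding embed_dom_def
          by (simp del: tsize_simps(2))
      qed
      also have "\<dots> \<le> 1 + k * (1 + b k n)" using \<open>length a \<le> k\<close> by (intro add_left_mono mult_right_mono) auto
      finally show "tsize a \<le> 1 + k * (1 + b k n)" .
    qed
    also have "\<dots> \<le> 1 + (1 + k) ^ k * (1 + (1 + k * (1 + b k n)))" using len by (intro add_left_mono mult_right_mono) auto
    finally show "tsize ?as \<le> 1 + (1 + k) ^ k * (1 + (1 + k * (1 + b k n)))" .
  qed (intro feas_intros small)+
  then show ?thesis unfolding embeds_def
    by (intro feas_bex feas_conj feas_imp feas_const feas_edges_kept feas_edges_reflected feas_place feas_fst feas_snd feas_id | assumption)+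
qed

text \<open>\<open>2 * k * k\<close> accounts for both orientations of at most \<open>k * k\<close>
  edges.\<close>

definition graph_dom :: "(nat \<Rightarrow> nat \<Rightarrow> nat) \<Rightarrow> nat \<Rightarrow> nat \<Rightarrow> (graph_state \<times> nat \<times> (nat \<times> nat) list) set" where
  "graph_dom b k n = {p. length (fst (fst p)) \<le> k \<and> length (snd (fst p)) \<le> 2 * k * k \<and> tsize p \<le> b k n}"

text \<open>For minors there are at most \<open>k\<close> rounds, each multiplying the number of
  graphs by at most \<open>1 + 2 * k * k\<close>.\<close>

lemma feas_decide:
  assumes b: "fpt_bounded b"
  shows "feas (graph_dom b) (\<lambda>p. decide mnr (fst p) (snd p))"
proof (cases mnr)
  case False
  have "feas (graph_dom b) (\<lambda>p. embeds True (fst p) (snd p))"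
    by (rule feas_subset[OF feas_embeds[OF b]]) (auto simp: graph_dom_def embed_dom_def)
  then show ?thesis using False by (simp add: decide_simps)
next
  case True
  let ?D = "graph_dom b"
  let ?B = "\<lambda>k n. 3 + b k n * (3 + 3 * b k n)"
  have small: "small ?D" by (rule smallI[OF b]) (simp add: graph_dom_def)
  have mem: "tsize g' \<le> ?B k n" if "p \<in> ?D k n" "g' \<in> set ((contractions ^^ i) [fst p])" for k n i p g'
  proof -
    have "tsize (fst p) \<le> b k n" using that(1) by (simp add: graph_dom_def)
    then have "3 + tsize (fst p) * (3 + 3 * tsize (fst p)) \<le> ?B k n"
      by (intro add_left_mono mult_le_mono) auto
    then show ?thesis using tsize_contractions_mem[OF that(2)] by simp
  qed
  have gs: "feas ?D (\<lambda>p. (contractions ^^ length (fst (fst p))) [fst p])"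
  proof (rule feas_funpow[where h = "\<lambda>_. contractions"])
    show "feas D' (\<lambda>p. contractions (fst p))"
      if "small D'" for D' :: "nat \<Rightarrow> nat \<Rightarrow> (graph_state list \<times> graph_state \<times> nat \<times> (nat \<times> nat) list) set"
      by (intro feas_contractions feas_fst feas_id that)
    show "fpt_bounded (\<lambda>k n. 1 + (1 + 2 * k * k) ^ k * (1 + ?B k n))"
      by (intro fb_intros b fb_param pab_intros)
    fix k n i p assume p: "p \<in> ?D k n" and i: "i \<le> length (fst (fst p))"
    let ?gs = "(contractions ^^ i) [fst p]"
    have "length ?gs \<le> (1 + length (snd (fst p))) ^ i" by (rule length_contractions)
    also have "\<dots> \<le> (1 + 2 * k * k) ^ i" using p by (intro power_mono) (auto simp: graph_dom_def)
    also have "\<dots> \<le> (1 + 2 * k * k) ^ k" using p i by (intro power_increasing) (auto simp: graph_dom_def)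
    finally have len: "length ?gs \<le> (1 + 2 * k * k) ^ k" .
    have "tsize ?gs \<le> 1 + length ?gs * (1 + ?B k n)" by (intro tsize_list_le mem[OF p])
    also have "\<dots> \<le> 1 + (1 + 2 * k * k) ^ k * (1 + ?B k n)" using len by (intro add_left_mono mult_right_mono) auto
    finally show "tsize ?gs \<le> 1 + (1 + 2 * k * k) ^ k * (1 + ?B k n)" .
  qed (intro feas_intros small)+
  have "feas ?D (\<lambda>p. \<exists>g'\<in>set ((contractions ^^ length (fst (fst p))) [fst p]). embeds False g' (snd p))"
  proof (rule feas_bex[OF gs])
    let ?E = "ext ?D (\<lambda>p. (contractions ^^ length (fst (fst p))) [fst p])"
    let ?b = "\<lambda>k n. 1 + ?B k n + b k n"
    assume small': "small ?E"
    have "fpt_bounded ?b" by (intro fb_intros b)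
    note embeds = feas_embeds[OF this, of False]
    have "feas ?E (\<lambda>q. (\<lambda>p. embeds False (fst p) (snd p)) (fst q, snd (snd q)))"
    proof (rule feas_comp[OF _ embeds])
      show "feas ?E (\<lambda>q. (fst q, snd (snd q)))" by (intro feas_intros small')
      fix k n q assume "q \<in> ?E k n"
      then have q: "snd q \<in> ?D k n" "fst q \<in> set ((contractions ^^ length (fst (fst (snd q)))) [fst (snd q)])"
        by (auto simp: ext_def)
      have "length (fst (fst q)) \<le> k" using contractions_length(1)[OF q(2)] q(1) by (simp add: graph_dom_def)
      moreover have "tsize (snd (snd q)) \<le> b k n" using q(1) by (simp add: graph_dom_def)
      ultimately show "(fst q, snd (snd q)) \<in> embed_dom ?b k n"
        using mem[OF q] unfolding embed_dom_def mem_Collect_eq fst_conv tsize_simps(5)[of "(fst q, snd (snd q))"] snd_conv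
        by (intro conjI add_mono) simp_all
    qed
    then show "feas ?E (\<lambda>q. embeds False (fst q) (snd (snd q)))" by simp
  qed
  then show ?thesis using True by (simp add: decide_simps)
qed

section \<open>Feasible functions and fixed-parameter tractability\<close>

text \<open>If the parameter is the input itself, every bound in the parameter is admissible, and
  feasibility entails computability.\<close>

lemma computable_tow: "computable (tow d)"
proof -
  have "feas (\<lambda>k n. {k}) (tow d)"
  proof (induction d)
    case 0
    have "feas (\<lambda>k n. {k}) (\<lambda>k. Suc (Suc (Suc (Suc k))))"
      by (intro feas_Suc feas_id smallI[of "\<lambda>k n. 2 * k + 1"] fb_intros fb_param pab_intros) auto
    then show ?case by (rule feas_cong) simp
  next
    case (Suc d)
    have "fpt_bounded (\<lambda>k n. tow (Suc d) k)"
      by (rule fb_param) (auto simp: param_bounded_def simp del: tow.simps)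
    from feas_power2[OF Suc this] show ?case by simp
  qed
  then obtain p and b :: "nat \<Rightarrow> nat \<Rightarrow> nat" where "\<And>k n a st. a \<in> {k} \<Longrightarrow> steps p (encode a) st (b k n) (encode (tow d a)) st"
    by (rule feasE) blast
  then have p: "steps p (enc_nat k) Leaf (b k 0) (enc_nat (tow d k)) Leaf" for k by simp
  have "\<exists>t. runs p (enc_nat k) t (enc_nat (tow d k))" for k
    by (rule steps_runs[OF p]) blast
  then show ?thesis unfolding computable_def by blast
qed

lemma fpt_if_feas:
  fixes D :: "nat \<Rightarrow> nat \<Rightarrow> 'a::encodable set" and f :: "'a \<Rightarrow> bool"
  assumes feas: "feas D f"
    and enc: "\<And>i x. E i x \<Longrightarrow> \<exists>a\<in>D (\<kappa> i) (tree_size x). x = encode a \<and> f a = P i"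
    and two: "\<And>i x. E i x \<Longrightarrow> 2 \<le> tree_size x"
  shows "fpt E \<kappa> P"
proof -
  obtain p b where p: "fpt_bounded b" "\<And>k n a st. a \<in> D k n \<Longrightarrow> steps p (encode a) st (b k n) (encode (f a)) st"
    using feas by (rule feasE) blast
  obtain d c where b: "\<And>k n. b k n \<le> tow d k * (n + 2) ^ c" using p(1) unfolding fpt_bounded_def by blast
  have "\<exists>t y. runs p x t y \<and> t \<le> tow d (\<kappa> i) * tree_size x ^ (2 * c) \<and> (y \<noteq> Leaf \<longleftrightarrow> P i)"
    if ix: "E i x" for i x
  proof -
    let ?n = "tree_size x"
    obtain a where a: "a \<in> D (\<kappa> i) ?n" "x = encode a" "f a = P i" using enc[OF ix] by blast
    obtain t where t: "runs p x t (encode (f a))" "t \<le> b (\<kappa> i) ?n"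
      unfolding a(2) by (rule steps_runs[OF p(2)[OF a(1), unfolded a(2)]])
    have "?n + 2 \<le> ?n ^ 2"
    proof -
      have "2 * ?n \<le> ?n * ?n" using two[OF ix] by (intro mult_right_mono) auto
      then show ?thesis using two[OF ix] unfolding power2_eq_square by linarith
    qed
    then have "(?n + 2) ^ c \<le> ?n ^ (2 * c)" unfolding power_mult by (rule power_mono) simp
    then have "t \<le> tow d (\<kappa> i) * ?n ^ (2 * c)"
      using t(2) b[of "\<kappa> i" ?n] by (meson mult_le_mono2 order.trans)
    moreover have "encode (f a) \<noteq> Leaf \<longleftrightarrow> P i" using a(3) by (cases "f a") auto
    ultimately show ?thesis using t(1) by blast
  qed
  then show ?thesis unfolding fpt_def using computable_tow by blast
qed

section \<open>The algorithm\<close>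

type_synonym input = "(nat \<times> ((nat \<times> nat) \<times> bool list) list) \<times> nat \<times> (nat \<times> nat) list"

definition initial_state :: "input \<Rightarrow> search_state" where
  "initial_state a = map (\<lambda>e. (fst e, mark_minority (snd e))) (snd (fst a))"

definition graph_of :: "nat \<Rightarrow> ((nat \<times> nat) \<times> bool) list \<Rightarrow> graph_state" where
  "graph_of n x = ([0..<n], map (\<lambda>e. fst e) (filter (\<lambda>e. snd e) x) @
     map (\<lambda>e. (snd (fst e), fst (fst e))) (filter (\<lambda>e. snd e) x))"

text \<open>The four problems are the four choices of \<open>mnr\<close> and
  \<open>ans\<close>.\<close>

definition solve :: "bool \<Rightarrow> bool \<Rightarrow> input \<Rightarrow> bool" where
  "solve mnr ans a \<longleftrightarrow>
     (\<exists>x\<in>set (patterns (initial_state a)). decide mnr (graph_of (fst (fst a)) x) (snd a) = ans)"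

definition minority_count :: "bool list \<Rightarrow> nat" where
  "minority_count l = min (count_list l True) (count_list l False)"

text \<open>The parameter enters through the number of vertices, hence of edges, and through the
  minority count of each label. The size of \<open>H\<close> is bounded by that of the input
  alone.\<close>

definition input_dom :: "nat \<Rightarrow> nat \<Rightarrow> input set" where
  "input_dom k n = {a. tsize a \<le> n \<and> fst (fst a) \<le> k \<and> length (snd (fst a)) \<le> k * k \<and>
     (\<forall>e\<in>set (snd (fst a)). snd e \<noteq> [] \<and> minority_count (snd e) \<le> k)}"

lemma count_list_filter: "count_list l True = length (filter (\<lambda>v. v) l)"
  "count_list l False = length (filter (\<lambda>v. \<not> v) l)"
  by (induction l) auto

lemma mark_minority_props:
  "map fst (mark_minority l) = l"
  "length (filter snd (mark_minority l)) = minority_count l"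
  "\<exists>b. \<forall>x\<in>set (mark_minority l). fst x = (snd x = b)"
proof -
  show "map fst (mark_minority l) = l" by (simp add: mark_minority_def comp_def)
  show "length (filter snd (mark_minority l)) = minority_count l"
    by (simp add: mark_minority_def minority_count_def count_list_filter filter_map comp_def)
  show "\<exists>b. \<forall>x\<in>set (mark_minority l). fst x = (snd x = b)"
    by (cases "length (filter (\<lambda>v. v) l) \<le> length (filter (\<lambda>v. \<not> v) l)") (auto simp: mark_minority_def)
qed

lemma mark_minority_Nil: "mark_minority l = [] \<longleftrightarrow> l = []"
  by (simp add: mark_minority_def)

lemma initial_state_props:
  assumes "a \<in> input_dom k n"
  shows "well_marked (initial_state a)" "length (initial_state a) \<le> k * k"
    "\<And>e. e \<in> set (initial_state a) \<Longrightarrow> length (filter snd (snd e)) \<le> k"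
  using assms mark_minority_props(3)
  by (auto simp: well_marked_def initial_state_def input_dom_def mark_minority_Nil mark_minority_props(2))

lemma feas_initial_state: "feas input_dom initial_state"
proof -
  have "small input_dom" by (rule smallI[OF fb_size]) (simp add: input_dom_def)
  then show ?thesis unfolding initial_state_def by (intro feas_intros feas_mark_minority | assumption)+
qed

lemma feas_graph_of: "feas D m \<Longrightarrow> feas D x \<Longrightarrow> feas D (\<lambda>a. graph_of (m a) (x a))"
  by (rule feas_subst2[where h = graph_of], unfold graph_of_def) (intro feas_intros | assumption)+

lemma feas_solve: "feas input_dom (solve mnr ans)"
proof -
  have small: "small input_dom" by (rule feas_small[OF feas_initial_state])
  obtain b where b: "fpt_bounded b" "\<And>k n a. a \<in> input_dom k n \<Longrightarrow> tsize (initial_state a) \<le> b k n"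
    using feas_size[OF feas_initial_state] by blast
  have pats: "feas input_dom (\<lambda>a. patterns (initial_state a))"
    by (rule feas_comp[OF feas_initial_state feas_patterns[OF b(1)]])
       (use b(2) initial_state_props in \<open>simp add: state_dom_def\<close>)
  let ?E = "ext input_dom (\<lambda>a. patterns (initial_state a))"
  have decide: "feas ?E (\<lambda>p. decide mnr (graph_of (fst (fst (snd p))) (fst p)) (snd (snd p)))"
  proof -
    have small': "small ?E" by (rule small_ext[OF pats])
    let ?args = "\<lambda>p :: ((nat \<times> nat) \<times> bool) list \<times> input. (graph_of (fst (fst (snd p))) (fst p), snd (snd p))"
    have args: "feas ?E ?args" by (intro feas_intros feas_graph_of small')
    obtain c where c: "fpt_bounded c" "\<And>k n p. p \<in> ?E k n \<Longrightarrow> tsize (?args p) \<le> c k n"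
      using feas_size[OF args] by blast
    have "feas ?E (\<lambda>p. (\<lambda>q. decide mnr (fst q) (snd q)) (?args p))"
    proof (rule feas_comp[OF args feas_decide[OF c(1)]])
      fix k n p assume p: "p \<in> ?E k n"
      then have a: "snd p \<in> input_dom k n" "fst p \<in> set (patterns (initial_state (snd p)))"
        by (auto simp: ext_def)
      note init = initial_state_props[OF a(1)]
      have "length (fst p) = length (initial_state (snd p))"
        using a(2) unfolding set_patterns[OF init(1)] by (auto simp: pattern_def)
      with init(2) have "length (filter (\<lambda>e. snd e) (fst p)) \<le> k * k"
        using length_filter_le[of "\<lambda>e. snd e" "fst p"] by simp
      then show "?args p \<in> graph_dom c k n"
        using a(1) c(2)[OF p] by (simp add: graph_dom_def graph_of_def input_dom_def mult.assoc)
    qed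
    then show ?thesis by simp
  qed
  have "feas input_dom (\<lambda>a. \<exists>x\<in>set (patterns (initial_state a)). decide mnr (graph_of (fst (fst a)) x) (snd a))"
    by (rule feas_bex[OF pats decide])
  moreover have "feas input_dom (\<lambda>a. \<exists>x\<in>set (patterns (initial_state a)). \<not> decide mnr (graph_of (fst (fst a)) x) (snd a))"
    by (rule feas_bex[OF pats feas_not[OF decide]])
  ultimately show ?thesis unfolding solve_def by (cases ans) simp_all
qed

definition input_of :: "'v list \<Rightarrow> (nat \<times> nat) list \<Rightarrow> 'v epg \<Rightarrow> 'w list \<Rightarrow> (nat \<times> nat) list \<Rightarrow> input" where
  "input_of vs ps G ws qs = ((length vs, map (\<lambda>p. (p, label G (edge_at vs p))) ps), (length ws, qs))"

lemma represents_snapshot: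
  assumes G: "epg G" "enumerates vs ps G"
  shows "represents ((!) vs) (graph_of (length vs) (pattern t (initial_state (input_of vs ps G ws qs)))) (snapshot G t)"
proof -
  have vs: "distinct vs" "set vs = verts G" and edges: "edges G = edge_at vs ` set ps"
    and ps: "\<And>i j. (i, j) \<in> set ps \<Longrightarrow> i < length vs \<and> j < length vs"
    using G(2) unfolding enumerates_def by auto
  have simple: "simple_graph G" and lab: "\<And>e. e \<in> edges G \<Longrightarrow> label G e \<noteq> []"
    using G(1) by (auto simp: epg_def)
  let ?g = "graph_of (length vs) (pattern t (initial_state (input_of vs ps G ws qs)))"
  let ?ps = "filter (\<lambda>p. present G (edge_at vs p) t) ps"
  have "fst (entry t (mark_minority (label G (edge_at vs p)))) = present G (edge_at vs p) t" if "p \<in> set ps" for p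
  proof -
    let ?l = "label G (edge_at vs p)"
    have "?l \<noteq> []" using lab edges that by simp
    then have "fst (entry t (mark_minority ?l)) = map fst (mark_minority ?l) ! (t mod length (map fst (mark_minority ?l)))"
      using mark_minority_Nil[of ?l] by (simp add: entry_nth)
    then show ?thesis unfolding mark_minority_props(1) present_def .
  qed
  then have "map (\<lambda>e. fst e) (filter (\<lambda>e. snd e) (pattern t (initial_state (input_of vs ps G ws qs)))) = ?ps"
    unfolding pattern_def initial_state_def input_of_def by (simp add: filter_map comp_def cong: filter_cong)
  moreover have "map (\<lambda>e. (snd (fst e), fst (fst e))) xs = map (\<lambda>q. (snd q, fst q)) (map (\<lambda>e. fst e) xs)"
    for xs :: "((nat \<times> nat) \<times> bool) list" by simp
  ultimately have g: "?g = ([0..<length vs], ?ps @ map (\<lambda>q. (snd q, fst q)) ?ps)"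
    unfolding graph_of_def by (simp only:)
  have es: "edges (snapshot G t) = edge_at vs ` set ?ps"
    unfolding snapshot_def by (auto simp: edges)
  have ne: "i \<noteq> j" if "(i, j) \<in> set ps" for i j
  proof -
    have "{vs ! i, vs ! j} \<in> edges G" using that unfolding edges by (force simp: edge_at_def)
    then show ?thesis using simple_graph_edgeD(3)[OF simple] by auto
  qed
  show ?thesis unfolding represents_def g
  proof (intro conjI)
    show "inj_on ((!) vs) (set (fst ([0..<length vs], ?ps @ map (\<lambda>q. (snd q, fst q)) ?ps)))"
      using vs(1) by (simp add: inj_on_nth)
    show "verts (snapshot G t) = (!) vs ` set (fst ([0..<length vs], ?ps @ map (\<lambda>q. (snd q, fst q)) ?ps))"
      by (simp add: snapshot_def vs(2)[symmetric] nth_image)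
    show "edges (snapshot G t) = (\<lambda>q. {vs ! fst q, vs ! snd q}) ` set (snd ([0..<length vs], ?ps @ map (\<lambda>q. (snd q, fst q)) ?ps))"
      unfolding es by (auto simp: edge_at_def image_Un image_image insert_commute case_prod_beta)
    show "\<forall>(i, j)\<in>set (snd ([0..<length vs], ?ps @ map (\<lambda>q. (snd q, fst q)) ?ps)).
      i \<in> set (fst ([0..<length vs], ?ps @ map (\<lambda>q. (snd q, fst q)) ?ps)) \<and>
      j \<in> set (fst ([0..<length vs], ?ps @ map (\<lambda>q. (snd q, fst q)) ?ps)) \<and> i \<noteq> j \<and>
      (j, i) \<in> set (snd ([0..<length vs], ?ps @ map (\<lambda>q. (snd q, fst q)) ?ps))"
      using ps ne by (fastforce simp: image_iff)
  qed
qed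

lemma input_of_in_dom:
  assumes G: "epg G" "enumerates vs ps G"
  shows "input_of vs ps G ws qs \<in> input_dom (epg_parameter (G, H)) (tsize (input_of vs ps G ws qs))"
proof -
  let ?k = "epg_parameter (G, H)"
  have vs: "distinct vs" "set vs = verts G" and edges: "edges G = edge_at vs ` set ps"
    and ps: "\<And>i j. (i, j) \<in> set ps \<Longrightarrow> i < length vs \<and> j < length vs" and dist: "distinct (map (edge_at vs) ps)"
    using G(2) unfolding enumerates_def by auto
  have "length vs = card (verts G)" using vs by (metis distinct_card)
  then have len: "length vs \<le> ?k" by simp
  have "length ps = card (set ps)" using dist by (simp add: distinct_map distinct_card)
  also have "\<dots> \<le> card ({..<length vs} \<times> {..<length vs})" by (rule card_mono) (use ps in auto)
  also have "\<dots> \<le> ?k * ?k" using len by (simp add: mult_le_mono del: epg_parameter.simps)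
  finally have "length ps \<le> ?k * ?k" .
  moreover have "minority_count (label G e) \<le> ?k" if e: "e \<in> edges G" for e
  proof -
    have "finite (edges G)" unfolding edges by simp
    then have "count_list (label G e) v \<le> label_max v G" for v
      unfolding label_max_def using e by (intro Max_ge) auto
    \<comment> \<open>The minimum for one label is at most the minimum of the two maxima, even if
      these are attained at different edges.\<close>
    then have "min (count_list (label G e) True) (count_list (label G e) False) \<le> min (ones_max G) (zeros_max G)"
      by (intro min.mono)
    then show ?thesis unfolding minority_count_def epg_parameter.simps by linarith
  qed
  moreover have "label G e \<noteq> []" if "e \<in> edges G" for e using G(1) that by (simp add: epg_def)
  ultimately show ?thesis using len unfolding input_dom_def input_of_def edges
    by (simp del: epg_parameter.simps tsize_simps)
qed

lemma solve_iff:
  assumes G: "epg G" "enumerates vs ps G" and H: "simple_graph H" "enumerates ws qs H"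
  shows "solve mnr ans (input_of vs ps G ws qs) \<longleftrightarrow>
    (\<exists>t. (if mnr then has_minor (snapshot G t) H else has_induced_subgraph (snapshot G t) H) = ans)"
proof -
  let ?a = "input_of vs ps G ws qs"
  have simple: "simple_graph (snapshot G t)" for t
    using G(1) by (auto simp: epg_def simple_graph_def snapshot_def)
  have "decide mnr (graph_of (length vs) (pattern t (initial_state ?a))) (length ws, qs) \<longleftrightarrow>
     (if mnr then has_minor (snapshot G t) H else has_induced_subgraph (snapshot G t) H)" for t
    by (rule decide_iff[OF represents_snapshot[OF G] simple H])
  moreover have "fst (fst ?a) = length vs" "snd ?a = (length ws, qs)" by (simp_all add: input_of_def)
  moreover have "well_marked (initial_state ?a)"
    by (rule initial_state_props(1)[OF input_of_in_dom[OF G]])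
  ultimately show ?thesis unfolding solve_def by (simp add: set_patterns)
qed

lemma fpt_solve:
  assumes P: "\<And>G H. P (G, H) \<longleftrightarrow>
    (\<exists>t. (if mnr then has_minor (snapshot G t) H else has_induced_subgraph (snapshot G t) H) = ans)"
  shows "fpt (encodes_instance :: 'v epg \<times> 'w graph \<Rightarrow> tree \<Rightarrow> bool) epg_parameter P"
proof (rule fpt_if_feas[OF feas_solve[of mnr ans]])
  fix i :: "'v epg \<times> 'w graph" and x assume "encodes_instance i x"
  moreover obtain G H where i: "i = (G, H)" by (cases i)
  ultimately obtain y z where "encodes_epg G y" "encodes_graph H z" "x = Node y z" by auto
  then obtain vs ps ws qs where G: "epg G" "enumerates vs ps G" and H: "simple_graph H" "enumerates ws qs H"
    and x: "x = Node (Node (enc_nat (length vs))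
              (enc_list (map (\<lambda>p. Node (enc_pair p) (enc_list (map enc_bool (label G (edge_at vs p))))) ps)))
              (Node (enc_nat (length ws)) (enc_list (map enc_pair qs)))"
    unfolding encodes_epg_def encodes_graph_def by blast
  \<comment> \<open>The prescribed tree is literally the encoding of a value of type
    \<open>input\<close>, so the program works on it without any conversion.\<close>
  have pair: "enc_pair = encode" by (auto simp: fun_eq_iff)
  have bool: "enc_bool = encode" by (auto simp: fun_eq_iff)
  have enc: "x = encode (input_of vs ps G ws qs)"
    unfolding x input_of_def pair bool by (simp add: comp_def)
  show "2 \<le> tree_size x" unfolding x by simp
  show "\<exists>a\<in>input_dom (epg_parameter i) (tree_size x). x = encode a \<and> solve mnr ans a = P i"
  proof (intro bexI conjI)
    show "input_of vs ps G ws qs \<in> input_dom (epg_parameter i) (tree_size x)"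
      using input_of_in_dom[OF G, of ws qs H] unfolding i enc tsize_def .
    show "solve mnr ans (input_of vs ps G ws qs) = P i" unfolding i P by (rule solve_iff[OF G H])
  qed (rule enc)
qed

theorem theorem15:
  shows "fpt (encodes_instance :: nat epg \<times> nat graph \<Rightarrow> tree \<Rightarrow> bool) epg_parameter epg_subgraph \<and>
    fpt (encodes_instance :: nat epg \<times> nat graph \<Rightarrow> tree \<Rightarrow> bool) epg_parameter epg_subgraph_free \<and>
    fpt (encodes_instance :: nat epg \<times> nat graph \<Rightarrow> tree \<Rightarrow> bool) epg_parameter epg_minor \<and>
    fpt (encodes_instance :: nat epg \<times> nat graph \<Rightarrow> tree \<Rightarrow> bool) epg_parameter epg_minor_free"
proof (intro conjI)
  show "fpt (encodes_instance :: nat epg \<times> nat graph \<Rightarrow> tree \<Rightarrow> bool) epg_parameter epg_subgraph"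
    by (rule fpt_solve[where mnr = False and ans = True]) simp
  show "fpt (encodes_instance :: nat epg \<times> nat graph \<Rightarrow> tree \<Rightarrow> bool) epg_parameter epg_subgraph_free"
    by (rule fpt_solve[where mnr = False and ans = False]) simp
  show "fpt (encodes_instance :: nat epg \<times> nat graph \<Rightarrow> tree \<Rightarrow> bool) epg_parameter epg_minor"
    by (rule fpt_solve[where mnr = True and ans = True]) simp
  show "fpt (encodes_instance :: nat epg \<times> nat graph \<Rightarrow> tree \<Rightarrow> bool) epg_parameter epg_minor_free"
    by (rule fpt_solve[where mnr = True and ans = False]) simp
qed

end
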